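(* Let $(X,f)$ be a topological dynamical system with a metric $d\in\mathscr{D}(X)$. Then the following statements hold. (i) Suppose that $\mu\in M(X,f)$. If $Y\subset X$ is a Borel set with $\mu(Y)=1$, then $$\limsup_{\epsilon\to0}\frac{\underline h_\mu^{BK}(f,d,\epsilon)}{\log\frac1\epsilon}\le\overline{\mathrm{mdim}}_M(f,Y,d).$$ (ii) Suppose that $\mu\in E(X,f)$. If $\limsup_{\epsilon\to0}\frac{\overline h_\mu^{BK}(f,d,\epsilon)}{\log\frac1\epsilon}=\limsup_{\epsilon\to0}\frac{\underline h_\mu^{BK}(f,d,\epsilon)}{\log\frac1\epsilon}$, then $$\overline{\mathrm{mdim}}_M(f,G_\mu,d)=\limsup_{\epsilon\to0}\frac{PS(f,d,\mu,\epsilon)}{\log\frac1\epsilon}=\limsup_{\epsilon\to0}\frac{\overline h_\mu^{K}(f,d,\epsilon)}{\log\frac1\epsilon}=\limsup_{\epsilon\to0}\frac{\overline h_\mu^{BK}(f,d,\epsilon)}{\log\frac1\epsilon}=\limsup_{\epsilon\to0}\frac{\underline h_\mu^{BK}(f,d,\epsilon)}{\log\frac1\epsilon}=\overline{\mathrm{rdim}}_{L^\infty}(X,f,d,\mu).$$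
   Context: A topological dynamical system $(X,f)$ is a compact metrizable space $X$ with a continuous map $f:X\to X$; $\mathscr{D}(X)$ is the set of compatible metrics. $M(X)$, $M(X,f)$, $E(X,f)$ are the sets of Borel probability measures, $f$-invariant ones, and ergodic ones; $M(X)$ carries the weak* topology. $d_n(x,y)=\max_{0\le j\le n-1}d(f^jx,f^jy)$, $B_n(x,\epsilon)=\{y:d_n(x,y)<\epsilon\}$. The set of generic points of $\mu$ is $G_\mu=\{x\in X:\lim_{n\to\infty}\frac1n\sum_{j=0}^{n-1}\varphi(f^jx)=\int\varphi\,d\mu\ \ \forall\varphi\in C(X,\mathbb{R})\}$. Bowen upper metric mean dimension on $Z\subset X$: for $0<\epsilon<1$, $\lambda\in\mathbb{R}$, $N\in\mathbb{N}$ let $M(Z,\lambda,N,\epsilon)=\inf\sum_{i\in I}e^{-n_i\lambda}$ over all finite or countable covers $\{B_{n_i}(x_i,\epsilon)\}_{i\in I}$ of $Z$ with $n_i\ge N$; $M(Z,\lambda,\epsilon)=\lim_{N\to\infty}M(Z,\lambda,N,\epsilon)$; $\overline{\mathrm{mdim}}_{M,Z,f}(0,d,\epsilon)=\inf\{\lambda:M(Z,\lambda,\epsilon)=0\}=\sup\{\lambda:M(Z,\lambda,\epsilon)=\infty\}$; $\overline{\mathrm{mdim}}_M(f,Z,d)=\limsup_{\epsilon\to0}\overline{\mathrm{mdim}}_{M,Z,f}(0,d,\epsilon)/\log\frac1\epsilon$. $\underline h_\mu^{BK}(f,d,\epsilon)=\int\liminf_{n\to\infty}-\frac1n\log\mu(B_n(x,\epsilon))\,d\mu$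 and $\overline h_\mu^{BK}(f,d,\epsilon)=\int\limsup_{n\to\infty}-\frac1n\log\mu(B_n(x,\epsilon))\,d\mu$ (for ergodic $\mu$ the integrands are $\mu$-a.e. constant). $PS(f,d,\mu,\epsilon)=\inf_{F\ni\mu}\limsup_{n\to\infty}\frac1n\log s_n(f,d,\epsilon,X_{n,F})$, the infimum over all neighborhoods $F$ of $\mu$ in $M(X)$, where $X_{n,F}=\{x\in X:\frac1n\sum_{j=1}^n\delta_{f^j(x)}\in F\}$ and $s_n(f,d,\epsilon,Z)$ is the maximal cardinality of a set $F'\subset Z$ with $d_n(x,y)\ge\epsilon$ for all distinct $x,y\in F'$. $\overline h_\mu^K(f,d,\epsilon)=\lim_{\delta\to0}\limsup_{n\to\infty}\frac1n\log r_n(\mu;d,\epsilon,\delta)$, where for $\delta\in(0,1)$, $r_n(\mu;d,\epsilon,\delta)=\min\{\#F:F\subset X,\ \mu(\bigcup_{x\in F}B_n(x,\epsilon))>1-\delta\}$. Upper $L^\infty$-rate distortion dimension: for $\mu\in M(X,f)$, $\epsilon>0$, $\alpha>0$, let $R_{L^\infty}(d,\mu,\epsilon,\alpha)$ be the infimum of $\frac1n I(\xi;\eta)$ ($I$ = mutual information) over all $n\ge1$ and all pairs of random variables on a common probability space with $\xi$ an $X$-valued variable of law $\mu$, $\eta=(\eta_0,\dots,\eta_{n-1})$ an $X^n$-valued variable, and $\mathbb{E}\big(\#\{0\le k\le n-1:d(f^k\xi,\eta_k)\ge\epsilon\}\big)<\alpha n$. Put $R_{L^\infty}(d,\mu,\epsilon)=\lim_{\alpha\to0}R_{L^\infty}(d,\mu,\epsilon,\alpha)$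 and $\overline{\mathrm{rdim}}_{L^\infty}(X,f,d,\mu)=\limsup_{\epsilon\to0}\frac{R_{L^\infty}(d,\mu,\epsilon)}{\log(1/\epsilon)}$. *)

theory Defs
  imports "HOL-Probability.Probability"
begin

text \<open>
  The phase space is the whole type \<open>'a :: metric_space\<close>; its distance \<open>dist\<close> is the fixed
  compatible metric. Compactness of \<open>UNIV\<close> and continuity of \<open>f\<close> are hypotheses of the theorem.
\<close>

text \<open>Logarithm of a nonnegative real, with \<open>log 0 = -\<infinity>\<close>.\<close>

definition xln :: "real \<Rightarrow> ereal" where
  "xln t = (if t = 0 then -\<infinity> else ereal (ln t))"

definition log_growth :: "(real \<Rightarrow> ereal) \<Rightarrow> ereal" where
  "log_growth h = Limsup (at_right 0) (\<lambda>\<epsilon>. h \<epsilon> / ereal (ln (1 / \<epsilon>)))"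


subsection \<open>Measures\<close>

definition borel_probs :: "'a::topological_space measure set" where
  "borel_probs = {\<mu>. sets \<mu> = sets borel \<and> prob_space \<mu>}"

definition invariant_probs :: "('a::topological_space \<Rightarrow> 'a) \<Rightarrow> 'a measure set" where
  "invariant_probs f = {\<mu> \<in> borel_probs. distr \<mu> borel f = \<mu>}"

definition ergodic_probs :: "('a::topological_space \<Rightarrow> 'a) \<Rightarrow> 'a measure set" where
  "ergodic_probs f =
     {\<mu> \<in> invariant_probs f. \<forall>A\<in>sets borel. f -` A = A \<longrightarrow> measure \<mu> A = 0 \<or> measure \<mu> A = 1}"

text \<open>The coarsest topology making all integrals of continuous functions continuous. The type is
  compact in all uses, so continuous functions are bounded.\<close>

definition weak_star :: "'a::topological_space measure topology" where
  "weak_star = topology_generated_by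
     {{\<nu> \<in> borel_probs. (\<integral>x. \<phi> x \<partial>\<nu>) \<in> U} |(\<phi> :: 'a \<Rightarrow> real) (U :: real set).
        continuous_on UNIV \<phi> \<and> open U}"

definition weak_star_nhds :: "'a::topological_space measure \<Rightarrow> 'a measure set set" where
  "weak_star_nhds \<mu> =
     {F. F \<subseteq> borel_probs \<and> (\<exists>U. openin weak_star U \<and> \<mu> \<in> U \<and> U \<subseteq> F)}"

definition generic_points :: "('a::topological_space \<Rightarrow> 'a) \<Rightarrow> 'a measure \<Rightarrow> 'a set" where
  "generic_points f \<mu> =
     {x. \<forall>\<phi> :: 'a \<Rightarrow> real. continuous_on UNIV \<phi> \<longrightarrow>
           (\<lambda>n. (1 / real n) * (\<Sum>j<n. \<phi> ((f ^^ j) x))) \<longlonglongrightarrow> (\<integral>y. \<phi> y \<partial>\<mu>)}"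

text \<open>The measure \<open>(1/n) \<Sum>\<^sub>j \<delta>\<close> at \<open>f\<^sup>j x\<close>, with \<open>j\<close> running from \<open>1\<close> to \<open>n\<close>.\<close>

definition empirical :: "('a::topological_space \<Rightarrow> 'a) \<Rightarrow> nat \<Rightarrow> 'a \<Rightarrow> 'a measure" where
  "empirical f n x = measure_of UNIV (sets borel)
     (\<lambda>A. ennreal (1 / real n) * (\<Sum>j=1..n. emeasure (return borel ((f ^^ j) x)) A))"


subsection \<open>Bowen balls and the Bowen upper metric mean dimension\<close>

text \<open>Only \<open>n \<ge> 1\<close> matters; truncated subtraction makes the index \<open>0\<close> behave like \<open>1\<close>.\<close>

definition bowen_dist :: "('a::metric_space \<Rightarrow> 'a) \<Rightarrow> nat \<Rightarrow> 'a \<Rightarrow> 'a \<Rightarrow> real" where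
  "bowen_dist f n x y = (MAX j\<in>{0..n-1}. dist ((f ^^ j) x) ((f ^^ j) y))"

definition bowen_ball :: "('a::metric_space \<Rightarrow> 'a) \<Rightarrow> nat \<Rightarrow> 'a \<Rightarrow> real \<Rightarrow> 'a set" where
  "bowen_ball f n x \<epsilon> = {y. bowen_dist f n x y < \<epsilon>}"

text \<open>Finite and countable families are indexed by arbitrary subsets \<open>I\<close> of the naturals.\<close>

definition bowen_cover_sum ::
    "('a::metric_space \<Rightarrow> 'a) \<Rightarrow> 'a set \<Rightarrow> real \<Rightarrow> nat \<Rightarrow> real \<Rightarrow> ennreal" where
  "bowen_cover_sum f Z t N \<epsilon> =
     Inf {(\<Sum>\<^sub>\<infinity>i\<in>I. ennreal (exp (- (real (m i) * t)))) |(I :: nat set) m x.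
            (\<forall>i\<in>I. N \<le> m i) \<and> Z \<subseteq> (\<Union>i\<in>I. bowen_ball f (m i) (x i) \<epsilon>)}"

definition bowen_outer ::
    "('a::metric_space \<Rightarrow> 'a) \<Rightarrow> 'a set \<Rightarrow> real \<Rightarrow> real \<Rightarrow> ennreal" where
  "bowen_outer f Z t \<epsilon> = lim (\<lambda>N. bowen_cover_sum f Z t N \<epsilon>)"

definition bowen_mdim_at :: "('a::metric_space \<Rightarrow> 'a) \<Rightarrow> 'a set \<Rightarrow> real \<Rightarrow> ereal" where
  "bowen_mdim_at f Z \<epsilon> = Inf {ereal t |t. bowen_outer f Z t \<epsilon> = 0}"

definition upper_bowen_mdim :: "('a::metric_space \<Rightarrow> 'a) \<Rightarrow> 'a set \<Rightarrow> ereal" where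
  "upper_bowen_mdim f Z = log_growth (bowen_mdim_at f Z)"


subsection \<open>Brin-Katok, Pfister-Sullivan and Katok entropies at scale \<open>\<epsilon>\<close>\<close>

text \<open>The rates are nonnegative for a probability measure, so the integrals are nonnegative
  integrals with values in \<open>[0,\<infinity>]\<close>.\<close>

definition local_rate ::
    "('a::metric_space \<Rightarrow> 'a) \<Rightarrow> 'a measure \<Rightarrow> real \<Rightarrow> 'a \<Rightarrow> nat \<Rightarrow> ereal" where
  "local_rate f \<mu> \<epsilon> x n = - (ereal (1 / real n) * xln (measure \<mu> (bowen_ball f n x \<epsilon>)))"

definition lower_BK :: "('a::metric_space \<Rightarrow> 'a) \<Rightarrow> 'a measure \<Rightarrow> real \<Rightarrow> ereal" where
  "lower_BK f \<mu> \<epsilon> = enn2ereal (\<integral>\<^sup>+x. e2ennreal (liminf (local_rate f \<mu> \<epsilon> x)) \<partial>\<mu>)"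

definition upper_BK :: "('a::metric_space \<Rightarrow> 'a) \<Rightarrow> 'a measure \<Rightarrow> real \<Rightarrow> ereal" where
  "upper_BK f \<mu> \<epsilon> = enn2ereal (\<integral>\<^sup>+x. e2ennreal (limsup (local_rate f \<mu> \<epsilon> x)) \<partial>\<mu>)"

text \<open>On a compact space the cardinalities below are bounded, so the maximum exists.\<close>

definition sep_number :: "('a::metric_space \<Rightarrow> 'a) \<Rightarrow> nat \<Rightarrow> real \<Rightarrow> 'a set \<Rightarrow> nat" where
  "sep_number f n \<epsilon> Z =
     Max (card ` {E. E \<subseteq> Z \<and> finite E \<and> (\<forall>x\<in>E. \<forall>y\<in>E. x \<noteq> y \<longrightarrow> \<epsilon> \<le> bowen_dist f n x y)})"

definition PS_entropy :: "('a::metric_space \<Rightarrow> 'a) \<Rightarrow> 'a measure \<Rightarrow> real \<Rightarrow> ereal" where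
  "PS_entropy f \<mu> \<epsilon> =
     (INF F\<in>weak_star_nhds \<mu>.
        limsup (\<lambda>n. ereal (1 / real n) * xln (real (sep_number f n \<epsilon> {x. empirical f n x \<in> F}))))"

definition katok_number ::
    "('a::metric_space \<Rightarrow> 'a) \<Rightarrow> 'a measure \<Rightarrow> nat \<Rightarrow> real \<Rightarrow> real \<Rightarrow> nat" where
  "katok_number f \<mu> n \<epsilon> \<delta> =
     (INF F\<in>{F. finite F \<and> measure \<mu> (\<Union>x\<in>F. bowen_ball f n x \<epsilon>) > 1 - \<delta>}. card F)"

definition upper_katok :: "('a::metric_space \<Rightarrow> 'a) \<Rightarrow> 'a measure \<Rightarrow> real \<Rightarrow> ereal" where
  "upper_katok f \<mu> \<epsilon> =
     Lim (at_right 0)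
       (\<lambda>\<delta>. limsup (\<lambda>n. ereal (1 / real n) * xln (real (katok_number f \<mu> n \<epsilon> \<delta>))))"


subsection \<open>Rate distortion dimension\<close>

text \<open>
  Mutual information of general random variables, in nats: the supremum over all finite
  measurable quantisations. The library's \<open>mutual_information\<close> is applied only to finite-valued
  variables, because its integral defaults to a real number even when the mutual information
  is infinite or the joint law is not absolutely continuous.
\<close>

definition mutual_info ::
    "'w measure \<Rightarrow> 'b measure \<Rightarrow> 'c measure \<Rightarrow> ('w \<Rightarrow> 'b) \<Rightarrow> ('w \<Rightarrow> 'c) \<Rightarrow> ereal" where
  "mutual_info P S T \<xi> \<eta> =
     Sup {ereal (prob_space.mutual_information P (exp 1)
            (count_space {..<k}) (count_space {..<l}) (p \<circ> \<xi>) (q \<circ> \<eta>)) |(k :: nat) (l :: nat) p q.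
          p \<in> measurable S (count_space {..<k}) \<and> q \<in> measurable T (count_space {..<l})}"

text \<open>
  All quantities depend only on the joint law of \<open>\<xi>\<close> and \<open>\<eta>\<close>, so it is no restriction to take
  sample spaces whose points lie in \<open>'a \<times> (nat \<Rightarrow> 'a)\<close>, the type carrying that joint law.
\<close>

definition rate_distortion_at ::
    "('a::metric_space \<Rightarrow> 'a) \<Rightarrow> 'a measure \<Rightarrow> real \<Rightarrow> real \<Rightarrow> ereal" where
  "rate_distortion_at f \<mu> \<epsilon> \<alpha> =
     Inf {ereal (1 / real n) * mutual_info P borel (\<Pi>\<^sub>M k\<in>{..<n}. borel) \<xi> \<eta>
          |n (P :: ('a \<times> (nat \<Rightarrow> 'a)) measure) \<xi> \<eta>.
            n \<ge> 1 \<and> prob_space P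
            \<and> \<xi> \<in> measurable P borel \<and> distr P borel \<xi> = \<mu>
            \<and> \<eta> \<in> measurable P (\<Pi>\<^sub>M k\<in>{..<n}. borel)
            \<and> (\<integral>\<omega>. real (card {k\<in>{..<n}. \<epsilon> \<le> dist ((f ^^ k) (\<xi> \<omega>)) (\<eta> \<omega> k)}) \<partial>P) < \<alpha> * real n}"

definition rate_distortion :: "('a::metric_space \<Rightarrow> 'a) \<Rightarrow> 'a measure \<Rightarrow> real \<Rightarrow> ereal" where
  "rate_distortion f \<mu> \<epsilon> = Lim (at_right 0) (rate_distortion_at f \<mu> \<epsilon>)"

definition upper_rdim :: "('a::metric_space \<Rightarrow> 'a) \<Rightarrow> 'a measure \<Rightarrow> ereal" where
  "upper_rdim f \<mu> = log_growth (rate_distortion f \<mu>)"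

end

theory Submission
  imports Defs
begin

text \<open>
  At every scale the quantities are compared, up to a bounded factor in the scale, along the cycles
  lower Brin-Katok \<open>\<le>\<close> Bowen (generic points) \<open>\<le>\<close> Pfister-Sullivan \<open>\<le>\<close> Katok \<open>\<le>\<close> upper Brin-Katok
  and lower Brin-Katok \<open>\<le>\<close> rate distortion \<open>\<le>\<close> Katok; the hypothesis closes both.

  The first inequality is the mass distribution principle, together with Birkhoff's theorem, which
  gives the generic points full measure. For Pfister-Sullivan \<open>\<le>\<close> Katok, fix finitely many Bowen balls
  of length \<open>m\<close> whose union \<open>U\<close> has measure almost \<open>1\<close>. An orbit with empirical measure close to the
  given one visits \<open>U\<close> most of the time, so it is coded by naming a ball for a whole block of length
  \<open>m\<close> when it is in \<open>U\<close> and by single symbols at the few remaining times. For the lower bound on rate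
  distortion, Gibbs' inequality bounds the information of a coding of \<open>n\<close> symbols from below by the
  mean of \<open>- ln Z\<close> for a partition function \<open>Z\<close>; the product of \<open>Z\<close> along consecutive blocks is a
  partition function for arbitrarily long orbit segments, and its integral over the points with small
  Bowen balls is exponentially small.
\<close>

section \<open>Preliminaries\<close>

text \<open>At a fixed scale the lower and upper Brin-Katok rates may differ, so all comparisons are
  made scale by scale, and \<epsilon> tends to 0 only in \<open>log_growth\<close>, which forgets a
  factor C because ln (1 / (C \<epsilon>)) = ln (1 / \<epsilon>) - ln C. Two obstacles shape the
  harder comparisons. Pfister-Sullivan entropy counts orbits in sets that may be null, which Katok
  covers do not see; but the mass of an open set is bounded below by a continuous test function, and
  that is seen by nearby empirical measures. Rate distortion is an infimum over all n, small ones
  included, whereas local rates speak of long orbits; invariance lets one code of n symbols be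
  repeated over consecutive blocks, so n stays fixed while the number of blocks grows. In both cases
  an exceptional time may take any of K symbols. Hence the order of choices: K comes from
  \<epsilon>, next the weight u = exp (- s) of an exceptional time with K u negligible, and only
  after that the allowed frequency \<delta> or \<alpha> of such times, with \<delta> s or \<alpha> s
  negligible.\<close>

lemma eventually_at_right_0_less:
  fixes b :: real
  assumes "b > 0"
  shows "\<forall>\<^sub>F x in at_right 0. 0 < x \<and> x < b"
  using eventually_at_right_real[OF assms] by simp

text \<open>Gives the \<open>Lim\<close> at 0 in \<open>upper_katok\<close> and
  \<open>rate_distortion\<close> its value: both inner quantities grow as their tolerance shrinks,
  so the one-sided limit exists and is a supremum.\<close>

lemma tendsto_SUP_at_right_0:
  fixes g :: "real \<Rightarrow> ereal"
  assumes "\<And>s t. 0 < s \<Longrightarrow> s \<le> t \<Longrightarrow> g t \<le> g s"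
  shows "(g \<longlongrightarrow> (SUP t\<in>{0<..}. g t)) (at_right 0)"
proof (rule order_tendstoI)
  fix a assume "a < (SUP t\<in>{0<..}. g t)"
  then obtain t where t: "0 < t" "a < g t" by (auto simp: less_SUP_iff)
  show "\<forall>\<^sub>F s in at_right 0. a < g s"
    using eventually_at_right_0_less[OF t(1)]
    by eventually_elim (use t assms in \<open>force intro: less_le_trans\<close>)
next
  fix a assume a: "(SUP t\<in>{0<..}. g t) < a"
  show "\<forall>\<^sub>F s in at_right 0. g s < a"
    using eventually_at_right_less[of "0::real"]
    by eventually_elim (rule le_less_trans[OF SUP_upper a], simp)
qed

lemma ereal_le_real_gtI:
  fixes x y :: ereal
  assumes "\<And>a::real. x < ereal a \<Longrightarrow> y \<le> ereal a"
  shows "y \<le> x"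
  using assms by (metis ereal_dense2 not_le)

lemma ereal_le_real_ltI:
  fixes x y :: ereal
  assumes "\<And>a::real. ereal a < x \<Longrightarrow> ereal a \<le> y"
  shows "x \<le> y"
  using assms by (metis ereal_dense2 not_le)

text \<open>Passes from exponential rates to counts. A count 0, of rate -\<infinity>, lies trivially
  below the exponential.\<close>

lemma le_exp_of_xln_rate:
  assumes "n \<ge> 1" "ereal (1 / real n) * xln (real k) < ereal a"
  shows "real k \<le> exp (real n * a)"
proof (cases "k = 0")
  case False
  then have "ln (real k) \<le> real n * a" using assms by (simp add: xln_def field_simps)
  then have "exp (ln (real k)) \<le> exp (real n * a)" by (simp only: exp_le_cancel_iff)
  moreover have "exp (ln (real k)) = real k" using False by simp
  ultimately show ?thesis by (simp only:)
qed simp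

lemma xln_rate_le:
  assumes "n \<ge> 1" "real k \<le> exp (real n * a)"
  shows "ereal (1 / real n) * xln (real k) \<le> ereal a"
proof (cases "k = 0")
  case False
  then have "ln (real k) \<le> ln (exp (real n * a))" using assms(2) by (subst ln_le_cancel_iff) auto
  then show ?thesis using False assms(1) by (simp add: xln_def field_simps)
qed (use assms(1) in \<open>simp add: xln_def\<close>)

section \<open>Logarithmic growth under a change of scale\<close>

lemma Limsup_le_real_iff:
  fixes g :: "'b \<Rightarrow> ereal"
  shows "Limsup F g \<le> C \<longleftrightarrow> (\<forall>c::real. C < ereal c \<longrightarrow> (\<forall>\<^sub>F x in F. g x < ereal c))"
proof
  assume "Limsup F g \<le> C"
  then show "\<forall>c::real. C < ereal c \<longrightarrow> (\<forall>\<^sub>F x in F. g x < ereal c)"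
    by (simp add: Limsup_le_iff)
next
  assume *: "\<forall>c::real. C < ereal c \<longrightarrow> (\<forall>\<^sub>F x in F. g x < ereal c)"
  show "Limsup F g \<le> C"
    unfolding Limsup_le_iff
  proof safe
    fix y assume "C < y"
    then obtain c :: real where c: "C < ereal c" "ereal c < y"
      using ereal_dense2 by blast
    from *[rule_format, OF c(1)] show "\<forall>\<^sub>F x in F. g x < y"
      by eventually_elim (use c(2) in order)
  qed
qed

lemma eventually_at_right_0_scale:
  fixes C :: real
  assumes "C > 0" "\<forall>\<^sub>F x in at_right 0. P (C * x)"
  shows "\<forall>\<^sub>F x in at_right 0. P x"
proof -
  from assms(2) obtain b where b: "b > 0" "\<And>y. 0 < y \<Longrightarrow> y < b \<Longrightarrow> P (C * y)"
    unfolding eventually_at_right[OF zero_less_one] by blast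
  show ?thesis
    unfolding eventually_at_right[OF zero_less_one]
  proof (intro exI[of _ "C * b"] conjI allI impI)
    fix y assume y: "0 < y" "y < C * b"
    then show "P y" using b(2)[of "y / C"] assms(1) by (simp add: field_simps)
  qed (use assms(1) b in simp)
qed

text \<open>A factor C in the scale replaces l = ln (1 / \<epsilon>) by l - ln C, and the quotient
  of the two tends to 1. This is why the comparisons below may lose a constant factor in the
  scale.\<close>

lemma log_growth_mono_scale:
  assumes C: "C \<ge> 1" and le: "\<And>\<epsilon>. 0 < \<epsilon> \<Longrightarrow> h1 (C * \<epsilon>) \<le> h2 \<epsilon>"
    and nonneg: "\<And>\<epsilon>. 0 < \<epsilon> \<Longrightarrow> 0 \<le> h2 \<epsilon>"
  shows "log_growth h1 \<le> log_growth h2"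
proof -
  have C0: "C > 0" using C by simp
  define L where "L = log_growth h2"
  have L0: "0 \<le> L" unfolding L_def log_growth_def
  proof (rule le_Limsup)
    show "\<forall>\<^sub>F \<epsilon> in at_right 0. 0 \<le> h2 \<epsilon> / ereal (ln (1 / \<epsilon>))"
      using eventually_at_right_0_less[OF zero_less_one]
    proof eventually_elim
      case (elim \<epsilon>)
      then have "ln (1 / \<epsilon>) > 0" by simp
      then show ?case using nonneg[of \<epsilon>] elim by (intro zero_le_divide_ereal) auto
    qed
  qed simp
  have "log_growth h1 \<le> L"
    unfolding log_growth_def[of h1] Limsup_le_real_iff
  proof safe
    fix c :: real assume c: "L < ereal c"
    then obtain c' :: real where c': "L < ereal c'" "c' < c"
      using ereal_dense2 by (metis ereal_less_eq(3) less_ereal.simps(1))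
    have c'0: "c' > 0" using L0 c'(1) by (metis ereal_less(2) order_le_less_trans)
    have "\<forall>\<^sub>F \<epsilon> in at_right 0. h2 \<epsilon> / ereal (ln (1 / \<epsilon>)) < ereal c'"
      using c'(1) unfolding L_def log_growth_def by (rule Limsup_lessD)
    moreover have "\<forall>\<^sub>F \<epsilon> in at_right 0. 0 < \<epsilon> \<and> \<epsilon> < 1 / C"
      by (rule eventually_at_right_0_less) (use C0 in simp)
    \<comment> \<open>This size of l = ln (1 / \<epsilon>) is what gives c' l < c (l - ln C): the
      gap between c' and c pays for ln C.\<close>
    moreover have "\<forall>\<^sub>F \<epsilon> in at_right 0. ln (1 / \<epsilon>) > c * ln C / (c - c')"
    proof -
      have "filterlim (\<lambda>\<epsilon>::real. ln (1 / \<epsilon>)) at_top (at_right 0)"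
        by (rule filterlim_compose[OF ln_at_top])
           (simp add: filterlim_inverse_at_top_right flip: inverse_eq_divide)
      then show ?thesis by (simp add: filterlim_at_top_dense)
    qed
    ultimately have "\<forall>\<^sub>F \<epsilon> in at_right 0. h1 (C * \<epsilon>) / ereal (ln (1 / (C * \<epsilon>))) < ereal c"
    proof eventually_elim
      case (elim \<epsilon>)
      define l where "l = ln (1 / \<epsilon>)"
      have Ce: "C * \<epsilon> < 1" using elim C0 by (simp add: field_simps)
      have pos: "ln (1 / (C * \<epsilon>)) > 0" using Ce elim C0 by simp
      have eq: "ln (1 / (C * \<epsilon>)) = l - ln C"
        using elim C0 by (simp add: l_def ln_div ln_mult)
      have l0: "l > 0" using pos eq C by (smt (verit) ln_ge_zero)
      have "h2 \<epsilon> < ereal (c' * l)"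
        using elim(1) l0 unfolding l_def[symmetric] by (simp add: ereal_divide_less_iff mult.commute)
      moreover have "c' * l < c * (l - ln C)"
      proof -
        have "c * ln C < l * (c - c')"
          using elim(3) c'(2) unfolding l_def[symmetric] by (simp add: pos_divide_less_eq)
        then show ?thesis by (simp add: algebra_simps)
      qed
      ultimately have "h2 \<epsilon> < ereal (c * (l - ln C))"
        by (metis ereal_less_le less_ereal.simps(1) order_less_trans)
      then have "h1 (C * \<epsilon>) < ereal (c * (l - ln C))"
        using le[of \<epsilon>] elim by (meson order_le_less_trans)
      then show ?case using pos unfolding eq
        by (simp add: ereal_divide_less_iff mult.commute)
    qed
    from eventually_at_right_0_scale[OF C0 this]
    show "\<forall>\<^sub>F \<epsilon> in at_right 0. h1 \<epsilon> / ereal (ln (1 / \<epsilon>)) < ereal c" .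
  qed
  then show ?thesis unfolding L_def .
qed

lemma log_growth_mono:
  assumes "\<And>\<epsilon>. 0 < \<epsilon> \<Longrightarrow> h1 \<epsilon> \<le> h2 \<epsilon>" "\<And>\<epsilon>. 0 < \<epsilon> \<Longrightarrow> 0 \<le> h2 \<epsilon>"
  shows "log_growth h1 \<le> log_growth h2"
  using log_growth_mono_scale[of 1 h1 h2] assms by simp

text \<open>Dominated convergence for indicators. It turns almost sure eventual bounds on the local
  rates into sets of nearly full measure at a single large time.\<close>

lemma (in prob_space) prob_tendsto_1_of_AE_eventually:
  assumes [measurable]: "\<And>n. S n \<in> events"
    and ae: "AE x in M. \<forall>\<^sub>F n in sequentially. x \<in> S n"
  shows "(\<lambda>n. prob (S n)) \<longlonglongrightarrow> 1"
proof -
  have "(\<lambda>n. \<integral>x. indicator (S n) x \<partial>M) \<longlonglongrightarrow> (\<integral>x. (1::real) \<partial>M)"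
  proof (rule integral_dominated_convergence[where w = "\<lambda>_. 1"])
    show "AE x in M. (\<lambda>n. indicator (S n) x) \<longlonglongrightarrow> (1::real)"
      using ae
    proof eventually_elim
      case (elim x)
      then have "\<forall>\<^sub>F n in sequentially. indicator (S n) x = (1::real)"
        by eventually_elim simp
      then show ?case by (rule tendsto_eventually)
    qed
  qed (auto simp: indicator_def)
  then show ?thesis by (simp add: prob_space)
qed

text \<open>The covers in \<open>bowen_cover_sum\<close> are indexed by a subset of the naturals;
  padding with empty sets and zero terms reduces this to countable subadditivity.\<close>

lemma emeasure_le_infsum:
  fixes \<phi> :: "nat \<Rightarrow> ennreal"
  assumes A: "A \<in> sets M" "\<And>i. i \<in> I \<Longrightarrow> B i \<in> sets M" "A \<subseteq> (\<Union>i\<in>I. B i)"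
    and le: "\<And>i. i \<in> I \<Longrightarrow> emeasure M (B i) \<le> \<phi> i"
  shows "emeasure M A \<le> (\<Sum>\<^sub>\<infinity>i\<in>I. \<phi> i)"
proof -
  define B' where "B' i = (if i \<in> I then B i else {})" for i
  define \<psi> where "\<psi> i = (if i \<in> I then \<phi> i else 0)" for i
  have "emeasure M A \<le> emeasure M (\<Union>i. B' i)"
    using A by (intro emeasure_mono) (auto simp: B'_def)
  also have "\<dots> \<le> (\<Sum>i. emeasure M (B' i))"
    using A by (intro emeasure_subadditive_countably) (auto simp: B'_def)
  also have "\<dots> \<le> (\<Sum>i. \<psi> i)"
    by (intro suminf_le) (auto simp: B'_def \<psi>_def le)
  also have "\<dots> \<le> (\<Sum>\<^sub>\<infinity>i\<in>I. \<phi> i)"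
  proof (rule suminf_le_const)
    fix n
    have "(\<Sum>i<n. \<psi> i) = (\<Sum>i\<in>{..<n} \<inter> I. \<phi> i)"
      unfolding \<psi>_def by (simp add: sum.inter_restrict)
    also have "\<dots> = (\<Sum>\<^sub>\<infinity>i\<in>{..<n} \<inter> I. \<phi> i)" by simp
    also have "\<dots> \<le> (\<Sum>\<^sub>\<infinity>i\<in>I. \<phi> i)"
      by (rule infsum_mono_neutral) (auto simp: nonneg_summable_on_complete)
    finally show "(\<Sum>i<n. \<psi> i) \<le> (\<Sum>\<^sub>\<infinity>i\<in>I. \<phi> i)" .
  qed simp
  finally show ?thesis .
qed

section \<open>The compact system and its finite Borel partitions\<close>

locale compact_dynamics =
  fixes f :: "'a::metric_space \<Rightarrow> 'a"
  assumes compact_space: "compact (UNIV :: 'a set)"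
    and continuous_map: "continuous_on UNIV f"
begin

lemma continuous_iterate: "continuous_on UNIV (f ^^ n)"
proof (induction n)
  case (Suc n)
  then show ?case
    using continuous_on_compose[OF Suc continuous_on_subset[OF continuous_map]] by simp
qed (simp add: id_def)

lemma measurable_iterate [measurable]: "f ^^ n \<in> borel \<rightarrow>\<^sub>M borel"
  by (rule borel_measurable_continuous_onI[OF continuous_iterate])

lemma measurable_map [measurable]: "f \<in> borel \<rightarrow>\<^sub>M borel"
  using measurable_iterate[of 1] by simp

text \<open>\<open>q\<close> names the first centre of a finite net within \<epsilon> of the point;
  taking the first one makes the cells Borel. This finite alphabet serves for counting separated
  sets, for approximating continuous functions and for quantising codes.\<close>

lemma finite_partition:
  assumes "\<epsilon> > 0"
  obtains K :: nat and z :: "nat \<Rightarrow> 'a" and q :: "'a \<Rightarrow> nat"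
  where "q \<in> borel \<rightarrow>\<^sub>M count_space UNIV" "\<And>x. q x < K" "\<And>x. dist x (z (q x)) < \<epsilon>"
proof -
  obtain F :: "'a set" where F: "finite F" "UNIV \<subseteq> (\<Union>x\<in>F. ball x \<epsilon>)"
    using compactE_image[OF compact_space, of UNIV "\<lambda>x. ball x \<epsilon>"] assms
    by (metis UNIV_I UN_I centre_in_ball open_ball subsetI)
  obtain xs where xs: "set xs = F" using F(1) finite_list by blast
  define q where "q x = (LEAST i. x \<in> ball (xs ! i) \<epsilon> \<and> i < length xs)" for x
  have ex: "\<exists>i. x \<in> ball (xs ! i) \<epsilon> \<and> i < length xs" for x
    using F(2) unfolding xs[symmetric] set_conv_nth by (force simp: subset_eq)
  have "x \<in> ball (xs ! q x) \<epsilon> \<and> q x < length xs" for x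
    unfolding q_def using LeastI_ex[OF ex] .
  moreover have [measurable]: "ball y \<epsilon> \<in> sets borel" for y :: 'a by simp
  have "q \<in> borel \<rightarrow>\<^sub>M count_space UNIV"
    unfolding q_def by (rule measurable_Least) measurable
  ultimately show ?thesis
    using that[of q "length xs" "(!) xs"] by (simp add: dist_commute)
qed

end

section \<open>Bowen balls and the mass distribution principle\<close>

lemma bowen_dist_less_iff:
  assumes "n \<ge> 1"
  shows "bowen_dist f n x y < \<epsilon> \<longleftrightarrow> (\<forall>j<n. dist ((f ^^ j) x) ((f ^^ j) y) < \<epsilon>)"
proof -
  have "{0..n - 1} = {..<n}" using assms by auto
  moreover have "{..<n} \<noteq> {}" using assms lessThan_empty_iff[of n] by simp
  ultimately show ?thesis
    unfolding bowen_dist_def by (subst Max_less_iff) auto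
qed

lemma le_bowen_dist_iff:
  assumes "n \<ge> 1"
  shows "\<epsilon> \<le> bowen_dist f n x y \<longleftrightarrow> (\<exists>j<n. \<epsilon> \<le> dist ((f ^^ j) x) ((f ^^ j) y))"
  using bowen_dist_less_iff[OF assms, of f x y \<epsilon>] by (meson linorder_not_less)

lemma bowen_dist_0: "bowen_dist f 0 = bowen_dist f 1"
  by (simp add: bowen_dist_def fun_eq_iff)

lemma mem_bowen_ball_iff:
  assumes "n \<ge> 1"
  shows "y \<in> bowen_ball f n x \<epsilon> \<longleftrightarrow> (\<forall>j<n. dist ((f ^^ j) x) ((f ^^ j) y) < \<epsilon>)"
  unfolding bowen_ball_def mem_Collect_eq by (rule bowen_dist_less_iff[OF assms])

lemma bowen_ball_0: "bowen_ball f 0 x \<epsilon> = bowen_ball f 1 x \<epsilon>"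
  by (simp add: bowen_ball_def bowen_dist_0)

context compact_dynamics
begin

lemma open_bowen_ball: "open (bowen_ball f n x \<epsilon>)"
proof -
  have *: "open (bowen_ball f n x \<epsilon>)" if "n \<ge> 1" for n
  proof -
    have "bowen_ball f n x \<epsilon> = (\<Inter>j\<in>{..<n}. (f ^^ j) -` ball ((f ^^ j) x) \<epsilon>)"
      using that by (auto simp: mem_bowen_ball_iff)
    also have "open \<dots>"
      by (intro open_INT) (auto intro!: open_vimage continuous_iterate)
    finally show ?thesis .
  qed
  show ?thesis
    using *[of 1] *[of n] bowen_ball_0[of f x \<epsilon>] by (cases "n = 0") auto
qed

lemma sets_bowen_ball [measurable]: "bowen_ball f n x \<epsilon> \<in> sets borel"
  using open_bowen_ball by simp

lemma measurable_dist_iterate [measurable]: 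
  "(\<lambda>y. dist ((f ^^ j) y) w) \<in> borel_measurable borel"
  by (intro borel_measurable_continuous_onI continuous_intros continuous_iterate)

lemma finite_bowen_cover:
  assumes "\<epsilon> > 0"
  obtains F where "finite F" "(\<Union>x\<in>F. bowen_ball f n x \<epsilon>) = UNIV"
proof -
  have "x \<in> bowen_ball f n x \<epsilon>" for x
    using assms by (cases "n = 0") (auto simp: mem_bowen_ball_iff bowen_ball_0)
  then obtain F where "finite F" "UNIV \<subseteq> (\<Union>x\<in>F. bowen_ball f n x \<epsilon>)"
    using compactE_image[OF compact_space, of UNIV "\<lambda>x. bowen_ball f n x \<epsilon>"] open_bowen_ball
    by (metis UNIV_I UN_I subsetI)
  then show ?thesis using that by blast
qed

text \<open>The measure of a Bowen ball is lower semicontinuous in its centre.\<close>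

lemma measurable_measure_bowen_ball:
  assumes "\<mu> \<in> borel_probs"
  shows "(\<lambda>x. measure \<mu> (bowen_ball f n x \<epsilon>)) \<in> borel_measurable borel"
proof -
  interpret prob_space \<mu> using assms by (simp add: borel_probs_def)
  have sets [measurable_cong]: "sets \<mu> = sets borel" using assms by (simp add: borel_probs_def)
  have *: "(\<lambda>x. measure \<mu> (bowen_ball f n x \<epsilon>)) \<in> borel_measurable borel" if n: "n \<ge> 1" for n
  proof (rule borel_measurableI_greater)
    fix a
    have "open {x. a < measure \<mu> (bowen_ball f n x \<epsilon>)}"
      unfolding open_contains_ball
    proof (rule ballI)
      fix x assume "x \<in> {x. a < measure \<mu> (bowen_ball f n x \<epsilon>)}"
      then have x: "a < measure \<mu> (bowen_ball f n x \<epsilon>)" by simp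
      \<comment> \<open>Radii slightly below \<epsilon> exhaust the open Bowen ball from inside and
        leave the room by which the centre is moved in \<open>V\<close>.\<close>
      define A where "A k = bowen_ball f n x (\<epsilon> - 1 / real (Suc k))" for k
      have inc: "incseq A"
        unfolding A_def incseq_def bowen_ball_def
        by (intro allI impI Collect_mono) (erule less_le_trans, simp add: frac_le)
      have "(\<Union>k. A k) = bowen_ball f n x \<epsilon>"
      proof safe
        fix y k assume "y \<in> A k"
        then show "y \<in> bowen_ball f n x \<epsilon>"
          unfolding A_def bowen_ball_def mem_Collect_eq
          by (rule less_le_trans) simp
      next
        fix y assume "y \<in> bowen_ball f n x \<epsilon>"
        then have "\<epsilon> - bowen_dist f n x y > 0" by (simp add: bowen_ball_def)
        then obtain k where "inverse (real (Suc k)) < \<epsilon> - bowen_dist f n x y"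
          using reals_Archimedean by blast
        then have "y \<in> A k" by (simp add: A_def bowen_ball_def inverse_eq_divide)
        then show "y \<in> (\<Union>k. A k)" by blast
      qed
      then have "(\<lambda>k. measure \<mu> (A k)) \<longlonglongrightarrow> measure \<mu> (bowen_ball f n x \<epsilon>)"
        using finite_Lim_measure_incseq[OF _ inc] by (simp add: A_def image_subset_iff)
      then obtain k where k: "a < measure \<mu> (A k)"
        using x by (metis eventually_sequentially order_refl order_tendstoD(1))
      define V where "V = bowen_ball f n x (1 / real (Suc k))"
      have "open V" "x \<in> V" using n open_bowen_ball by (auto simp: V_def mem_bowen_ball_iff)
      moreover have "V \<subseteq> {x. a < measure \<mu> (bowen_ball f n x \<epsilon>)}"
      proof safe
        fix y assume y: "y \<in> V"
        have "A k \<subseteq> bowen_ball f n y \<epsilon>"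
        proof
          fix w assume w: "w \<in> A k"
          show "w \<in> bowen_ball f n y \<epsilon>"
            unfolding mem_bowen_ball_iff[OF n]
          proof safe
            fix j assume j: "j < n"
            have "dist ((f ^^ j) x) ((f ^^ j) y) < 1 / real (Suc k)"
              "dist ((f ^^ j) x) ((f ^^ j) w) < \<epsilon> - 1 / real (Suc k)"
              using y w j by (auto simp: V_def A_def mem_bowen_ball_iff[OF n])
            then show "dist ((f ^^ j) y) ((f ^^ j) w) < \<epsilon>"
              using dist_triangle3[of "(f ^^ j) y" "(f ^^ j) w" "(f ^^ j) x"] by linarith
          qed
        qed
        then have "measure \<mu> (A k) \<le> measure \<mu> (bowen_ball f n y \<epsilon>)"
          by (intro finite_measure_mono) auto
        with k show "a < measure \<mu> (bowen_ball f n y \<epsilon>)" by simp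
      qed
      ultimately show "\<exists>e>0. ball x e \<subseteq> {x. a < measure \<mu> (bowen_ball f n x \<epsilon>)}"
        by (meson open_contains_ball subset_trans)
    qed
    then show "{x \<in> space borel. a < measure \<mu> (bowen_ball f n x \<epsilon>)} \<in> sets borel" by simp
  qed
  show ?thesis
    using *[of 1] *[of n] bowen_ball_0[of f _ \<epsilon>] by (cases "n = 0") auto
qed

section \<open>Local rates and Bowen outer measures\<close>

lemma measurable_local_rate:
  assumes "\<mu> \<in> borel_probs"
  shows "(\<lambda>x. local_rate f \<mu> \<epsilon> x n) \<in> borel_measurable borel"
proof -
  note [measurable] = measurable_measure_bowen_ball[OF assms]
  show ?thesis unfolding local_rate_def xln_def by measurable
qed

lemma local_rate_nonneg:
  assumes "\<mu> \<in> borel_probs"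
  shows "0 \<le> local_rate f \<mu> \<epsilon> x n"
proof -
  interpret prob_space \<mu> using assms by (simp add: borel_probs_def)
  show ?thesis
    unfolding local_rate_def xln_def
    by (auto simp: divide_nonpos_nonneg zero_less_measure_iff)
qed

lemma less_local_rateD:
  assumes "n \<ge> 1" "ereal s < local_rate f \<mu> \<epsilon> x n"
  shows "measure \<mu> (bowen_ball f n x \<epsilon>) \<le> exp (- (real n * s))"
proof (cases "measure \<mu> (bowen_ball f n x \<epsilon>) = 0")
  case False
  then have pos: "measure \<mu> (bowen_ball f n x \<epsilon>) > 0" by (simp add: zero_less_measure_iff)
  have "s < - (ln (measure \<mu> (bowen_ball f n x \<epsilon>)) / real n)"
    using assms(2) False by (simp add: local_rate_def xln_def)
  then have "ln (measure \<mu> (bowen_ball f n x \<epsilon>)) \<le> - (real n * s)"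
    using assms(1) by (simp add: field_simps)
  then have "exp (ln (measure \<mu> (bowen_ball f n x \<epsilon>))) \<le> exp (- (real n * s))" by simp
  then show ?thesis using pos by simp
qed simp

lemma local_rate_lessD:
  assumes "n \<ge> 1" "local_rate f \<mu> \<epsilon> x n < ereal s"
  shows "exp (- (real n * s)) \<le> measure \<mu> (bowen_ball f n x \<epsilon>)"
proof -
  have nz: "measure \<mu> (bowen_ball f n x \<epsilon>) \<noteq> 0"
    using assms by (auto simp: local_rate_def xln_def)
  then have pos: "measure \<mu> (bowen_ball f n x \<epsilon>) > 0" by (simp add: zero_less_measure_iff)
  have "- (ln (measure \<mu> (bowen_ball f n x \<epsilon>)) / real n) < s"
    using assms(2) nz by (simp add: local_rate_def xln_def)
  then have "- (real n * s) \<le> ln (measure \<mu> (bowen_ball f n x \<epsilon>))"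
    using assms(1) by (simp add: field_simps)
  then have "exp (- (real n * s)) \<le> exp (ln (measure \<mu> (bowen_ball f n x \<epsilon>)))" by simp
  then show ?thesis using pos by simp
qed

lemma bowen_cover_sum_mono:
  assumes "Z \<subseteq> Z'"
  shows "bowen_cover_sum f Z t N \<epsilon> \<le> bowen_cover_sum f Z' t N \<epsilon>"
  unfolding bowen_cover_sum_def using assms by (intro Inf_superset_mono) blast

text \<open>Raising N leaves fewer admissible covers, so the limit in \<open>bowen_outer\<close> is
  that of an increasing sequence.\<close>

lemma bowen_outer_eq_SUP: "bowen_outer f Z t \<epsilon> = (SUP N. bowen_cover_sum f Z t N \<epsilon>)"
proof -
  have "incseq (\<lambda>N. bowen_cover_sum f Z t N \<epsilon>)"
    unfolding bowen_cover_sum_def incseq_def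
    by (intro allI impI Inf_superset_mono) (use le_trans in blast)
  then show ?thesis
    unfolding bowen_outer_def by (intro limI LIMSEQ_SUP)
qed

lemma bowen_mdim_at_mono:
  assumes "Z \<subseteq> Z'"
  shows "bowen_mdim_at f Z \<epsilon> \<le> bowen_mdim_at f Z' \<epsilon>"
proof -
  have "bowen_outer f Z t \<epsilon> \<le> bowen_outer f Z' t \<epsilon>" for t
    unfolding bowen_outer_eq_SUP by (intro SUP_mono') (rule bowen_cover_sum_mono[OF assms])
  then show ?thesis
    unfolding bowen_mdim_at_def by (intro Inf_superset_mono) (auto, metis le_zero_eq)
qed

text \<open>Mass distribution principle. If t is below the integrated rate, some set
  \<open>S N\<close> of positive measure consists of points whose rates exceed t at all times from N
  on. A ball of a cover that meets \<open>S N\<close> lies in a ball of radius 2 \<epsilon> centred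
  in \<open>S N\<close>, hence has mass at most exp (- m t), so the cover sum is at least the mass
  of \<open>S N\<close>.\<close>

lemma lower_BK_le_bowen_mdim_at:
  assumes \<mu>: "\<mu> \<in> borel_probs" and Y: "Y \<in> sets borel" "measure \<mu> Y = 1" "Y \<subseteq> Z"
  shows "lower_BK f \<mu> (2 * \<epsilon>) \<le> bowen_mdim_at f Z \<epsilon>"
proof (rule ccontr)
  assume "\<not> ?thesis"
  then have less: "bowen_mdim_at f Y \<epsilon> < lower_BK f \<mu> (2 * \<epsilon>)"
    using bowen_mdim_at_mono[OF Y(3), of \<epsilon>] by simp
  interpret prob_space \<mu> using \<mu> by (simp add: borel_probs_def)
  have sets [measurable_cong]: "sets \<mu> = sets borel" using \<mu> by (simp add: borel_probs_def)
  have space: "space \<mu> = UNIV" using sets_eq_imp_space_eq[OF sets] by simp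
  note [measurable] = measurable_local_rate[OF \<mu>] measurable_measure_bowen_ball[OF \<mu>] Y(1)
  obtain t where t: "bowen_outer f Y t \<epsilon> = 0" "ereal t < lower_BK f \<mu> (2 * \<epsilon>)"
    using less unfolding bowen_mdim_at_def Inf_less_iff by auto
  define g where "g x = liminf (local_rate f \<mu> (2 * \<epsilon>) x)" for x
  have [measurable]: "g \<in> borel_measurable borel" unfolding g_def by measurable
  define s where "s = {x \<in> Y. ereal t < g x}"
  have [measurable]: "s \<in> sets borel" unfolding s_def by measurable
  have pos: "measure \<mu> s \<noteq> 0"
  proof
    assume 0: "measure \<mu> s = 0"
    have "AE x in \<mu>. x \<notin> s" using 0 
      by (intro AE_not_in) (auto simp: null_sets_def sets emeasure_eq_measure)
    moreover have "AE x in \<mu>. x \<in> Y" using Y prob_eq_1[of Y] by (simp add: sets)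
    ultimately have ae: "AE x in \<mu>. g x \<le> ereal t"
      by eventually_elim (auto simp: s_def)
    have "(\<integral>\<^sup>+x. e2ennreal (g x) \<partial>\<mu>) \<le> (\<integral>\<^sup>+x. e2ennreal (ereal t) \<partial>\<mu>)"
      by (rule nn_integral_mono_AE, use ae in eventually_elim) (rule e2ennreal_mono)
    also have "\<dots> = e2ennreal (ereal t)" by (simp add: emeasure_space_1)
    finally have "lower_BK f \<mu> (2 * \<epsilon>) \<le> enn2ereal (e2ennreal (ereal t))"
      unfolding lower_BK_def g_def by (simp add: less_eq_ennreal.rep_eq)
    also have "\<dots> = max 0 (ereal t)" by (simp add: ennreal.rep_eq)
    \<comment> \<open>\<open>e2ennreal\<close> clips negative values at 0, so the integral
      comparison alone leaves the case t < 0, which nonnegativity of the rates excludes.\<close>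
    finally have "ereal t < 0" using t(2) by (simp add: max_def split: if_splits)
    have "AE x in \<mu>. False"
      using ae
    proof eventually_elim
      case (elim x)
      have "0 \<le> g x" unfolding g_def by (intro Liminf_bounded) (simp add: local_rate_nonneg[OF \<mu>])
      then show ?case using elim \<open>ereal t < 0\<close> by order
    qed
    then show False by simp
  qed
  define S where "S N = {x\<in>s. \<forall>n\<ge>N. ereal t < local_rate f \<mu> (2 * \<epsilon>) x n}" for N
  have [measurable]: "S N \<in> sets borel" for N unfolding S_def by measurable
  have "s = (\<Union>N. S N)"
  proof safe
    fix x assume x: "x \<in> s"
    then have "\<forall>\<^sub>F n in sequentially. ereal t < local_rate f \<mu> (2 * \<epsilon>) x n"
      unfolding s_def g_def by (auto intro: less_LiminfD)
    then show "x \<in> (\<Union>N. S N)" using x by (auto simp: S_def eventually_sequentially)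
  qed (auto simp: S_def)
  moreover have "emeasure \<mu> (\<Union>N. S N) = 0" if "\<And>N. emeasure \<mu> (S N) = 0"
    using that by (intro emeasure_UN_eq_0) (auto simp: sets)
  ultimately obtain N where N: "emeasure \<mu> (S N) \<noteq> 0"
    using pos by (auto simp: emeasure_eq_measure)
  \<comment> \<open>Keeps the lengths at least 1, so that membership in a Bowen ball is a condition
    on all times below the length.\<close>
  define N' where "N' = max N 1"
  have "emeasure \<mu> (S N) \<le> bowen_cover_sum f Y t N' \<epsilon>"
    unfolding bowen_cover_sum_def
  proof (rule Inf_greatest, safe)
    fix I :: "nat set" and m x
    assume m: "\<forall>i\<in>I. N' \<le> m i" and cover: "Y \<subseteq> (\<Union>i\<in>I. bowen_ball f (m i) (x i) \<epsilon>)"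
    show "emeasure \<mu> (S N) \<le> (\<Sum>\<^sub>\<infinity>i\<in>I. ennreal (exp (- (real (m i) * t))))"
    proof (rule emeasure_le_infsum)
      show "S N \<subseteq> (\<Union>i\<in>I. S N \<inter> bowen_ball f (m i) (x i) \<epsilon>)"
        using cover by (auto simp: S_def s_def)
    next
      fix i assume i: "i \<in> I"
      show "emeasure \<mu> (S N \<inter> bowen_ball f (m i) (x i) \<epsilon>) \<le> ennreal (exp (- (real (m i) * t)))"
      proof (cases "S N \<inter> bowen_ball f (m i) (x i) \<epsilon> = {}")
        case False
        then obtain y where y: "y \<in> S N" "y \<in> bowen_ball f (m i) (x i) \<epsilon>" by blast
        have mi: "m i \<ge> N" "m i \<ge> 1" using m i by (auto simp: N'_def)
        have "bowen_ball f (m i) (x i) \<epsilon> \<subseteq> bowen_ball f (m i) y (2 * \<epsilon>)"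
        proof
          fix w assume w: "w \<in> bowen_ball f (m i) (x i) \<epsilon>"
          show "w \<in> bowen_ball f (m i) y (2 * \<epsilon>)"
            unfolding mem_bowen_ball_iff[OF mi(2)]
          proof safe
            fix j assume "j < m i"
            then have "dist ((f ^^ j) (x i)) ((f ^^ j) w) < \<epsilon>" "dist ((f ^^ j) (x i)) ((f ^^ j) y) < \<epsilon>"
              using w y(2) by (auto simp: mem_bowen_ball_iff[OF mi(2)])
            then show "dist ((f ^^ j) y) ((f ^^ j) w) < 2 * \<epsilon>"
              using dist_triangle3[of "(f ^^ j) y" "(f ^^ j) w" "(f ^^ j) (x i)"] by linarith
          qed
        qed
        then have "emeasure \<mu> (S N \<inter> bowen_ball f (m i) (x i) \<epsilon>)
            \<le> emeasure \<mu> (bowen_ball f (m i) y (2 * \<epsilon>))"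
          by (intro emeasure_mono) (auto simp: sets)
        also have "\<dots> \<le> ennreal (exp (- (real (m i) * t)))"
          unfolding emeasure_eq_measure using less_local_rateD[OF mi(2), of t \<mu> "2 * \<epsilon>" y] y(1) mi
          by (intro ennreal_leI) (auto simp: S_def)
        finally show ?thesis .
      qed simp
    qed (auto simp: sets)
  qed
  also have "\<dots> \<le> bowen_outer f Y t \<epsilon>" unfolding bowen_outer_eq_SUP by (rule SUP_upper) simp
  finally show False using t N by simp
qed

end

section \<open>Separated sets and Katok numbers\<close>

text \<open>Written through single times instead of \<open>bowen_dist\<close>, so that at length 0
  it admits at most one point; dropping initial steps may use up the whole length.\<close>

definition bowen_separated :: "('a::metric_space \<Rightarrow> 'a) \<Rightarrow> nat \<Rightarrow> real \<Rightarrow> 'a set \<Rightarrow> bool" where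
  "bowen_separated f n \<epsilon> E \<longleftrightarrow>
     (\<forall>x\<in>E. \<forall>y\<in>E. x \<noteq> y \<longrightarrow> (\<exists>j<n. \<epsilon> \<le> dist ((f ^^ j) x) ((f ^^ j) y)))"

lemma bowen_separated_subset: "bowen_separated f n \<epsilon> E \<Longrightarrow> E' \<subseteq> E \<Longrightarrow> bowen_separated f n \<epsilon> E'"
  unfolding bowen_separated_def by blast

text \<open>Points that stay together during the first k steps must be separated later, so dropping
  these steps loses neither points nor separation. This is the recursion behind the greedy reading
  of orbits.\<close>

lemma bowen_separated_image:
  assumes sep: "bowen_separated f n \<eta> E" and \<eta>: "\<eta> > 0" and "k \<le> n"
    and close: "\<And>x y j. x \<in> E \<Longrightarrow> y \<in> E \<Longrightarrow> j < k \<Longrightarrow> dist ((f ^^ j) x) ((f ^^ j) y) < \<eta>"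
  shows "inj_on (f ^^ k) E" "bowen_separated f (n - k) \<eta> ((f ^^ k) ` E)"
proof -
  have *: "\<exists>j<n - k. \<eta> \<le> dist ((f ^^ j) ((f ^^ k) x)) ((f ^^ j) ((f ^^ k) y))"
    if xy: "x \<in> E" "y \<in> E" "x \<noteq> y" for x y
  proof -
    obtain j where j: "j < n" "\<eta> \<le> dist ((f ^^ j) x) ((f ^^ j) y)"
      using sep xy unfolding bowen_separated_def by blast
    have "k \<le> j" using close[OF xy(1,2), of j] j(2) by (meson leI not_le)
    then have "(f ^^ j) x = (f ^^ (j - k)) ((f ^^ k) x)" "(f ^^ j) y = (f ^^ (j - k)) ((f ^^ k) y)"
      by (simp_all flip: funpow_add comp_apply[of "f ^^ (j - k)" "f ^^ k"])
    then show ?thesis using j \<open>k \<le> j\<close> by (intro exI[of _ "j - k"]) auto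
  qed
  show "inj_on (f ^^ k) E"
  proof (rule inj_onI, rule ccontr)
    fix x y assume xy: "x \<in> E" "y \<in> E" "(f ^^ k) x = (f ^^ k) y" "x \<noteq> y"
    with *[of x y] \<eta> show False by auto
  qed
  show "bowen_separated f (n - k) \<eta> ((f ^^ k) ` E)"
    unfolding bowen_separated_def using * by blast
qed

context compact_dynamics
begin

text \<open>Two orbits running through the same cells of radius \<epsilon> / 2 stay closer than
  \<epsilon>, so itineraries bound the cardinality. The bound also makes finite the set whose
  maximum defines \<open>sep_number\<close>.\<close>

lemma card_bowen_separated_le:
  assumes "\<epsilon> > 0"
  obtains K :: nat where "K \<ge> 1"
    "\<And>n E. bowen_separated f n \<epsilon> E \<Longrightarrow> finite E \<and> card E \<le> K ^ n"
proof -
  obtain K and z :: "nat \<Rightarrow> 'a" and q where q: "\<And>x::'a. q x < K" "\<And>x. dist x (z (q x)) < \<epsilon> / 2"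
    using finite_partition[of "\<epsilon> / 2"] assms by (metis half_gt_zero)
  have "finite E \<and> card E \<le> K ^ n" if sep: "bowen_separated f n \<epsilon> E" for n E
  proof -
    define w where "w x = (\<lambda>k\<in>{..<n}. q ((f ^^ k) x))" for x
    have fin: "finite (PiE {..<n} (\<lambda>_. {..<K}))" by (intro finite_PiE) auto
    have sub: "w ` E \<subseteq> PiE {..<n} (\<lambda>_. {..<K})" 
      using q(1) by (auto simp: w_def PiE_iff extensional_def split: if_splits)
    have inj: "inj_on w E"
    proof (rule inj_onI, rule ccontr)
      fix x y assume xy: "x \<in> E" "y \<in> E" "w x = w y" "x \<noteq> y"
      then obtain j where j: "j < n" "\<epsilon> \<le> dist ((f ^^ j) x) ((f ^^ j) y)"
        using sep unfolding bowen_separated_def by blast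
      have "q ((f ^^ j) x) = q ((f ^^ j) y)"
        using fun_cong[OF xy(3), of j] j(1) by (simp add: w_def)
      then show False
        using q(2)[of "(f ^^ j) x"] q(2)[of "(f ^^ j) y"] j(2)
          dist_triangle2[of "(f ^^ j) x" "(f ^^ j) y" "z (q ((f ^^ j) x))"] by simp
    qed
    have "finite E" using inj_on_finite[OF inj sub fin] .
    moreover have "card E \<le> K ^ n"
      using card_inj_on_le[OF inj sub fin] by (simp add: card_PiE)
    ultimately show ?thesis by simp
  qed
  moreover have "K \<ge> 1" using q(1)[of undefined] by simp
  ultimately show ?thesis using that by blast
qed

lemma sep_number_eq:
  assumes "n \<ge> 1"
  shows "sep_number f n \<epsilon> Z = Max (card ` {E. E \<subseteq> Z \<and> finite E \<and> bowen_separated f n \<epsilon> E})"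
  unfolding sep_number_def bowen_separated_def le_bowen_dist_iff[OF assms] ..

text \<open>A separated set of largest cardinality also spans: a point outside all its Bowen balls
  could be added.\<close>

lemma sep_number_attained:
  assumes "n \<ge> 1" "\<epsilon> > 0"
  obtains E where "E \<subseteq> Z" "finite E" "bowen_separated f n \<epsilon> E" "card E = sep_number f n \<epsilon> Z"
    "Z \<subseteq> (\<Union>x\<in>E. bowen_ball f n x \<epsilon>)"
proof -
  define \<E> where "\<E> = {E. E \<subseteq> Z \<and> finite E \<and> bowen_separated f n \<epsilon> E}"
  obtain K where K: "\<And>n E. bowen_separated f n \<epsilon> E \<Longrightarrow> finite E \<and> card E \<le> K ^ n"
    using card_bowen_separated_le[OF assms(2)] by metis
  have fin: "finite (card ` \<E>)"
    by (rule finite_subset[of _ "{..K ^ n}"]) (use K in \<open>auto simp: \<E>_def\<close>)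
  have "{} \<in> \<E>" by (simp add: \<E>_def bowen_separated_def)
  then have "Max (card ` \<E>) \<in> card ` \<E>" using fin by (intro Max_in) auto
  then obtain E where E: "E \<in> \<E>" "card E = Max (card ` \<E>)" by force
  have "Z \<subseteq> (\<Union>x\<in>E. bowen_ball f n x \<epsilon>)"
  proof (rule ccontr)
    assume "\<not> ?thesis"
    then obtain z where z: "z \<in> Z" "\<And>x. x \<in> E \<Longrightarrow> z \<notin> bowen_ball f n x \<epsilon>" by blast
    have far: "\<exists>j<n. \<epsilon> \<le> dist ((f ^^ j) x) ((f ^^ j) z)" if "x \<in> E" for x
      using z(2)[OF that] unfolding mem_bowen_ball_iff[OF assms(1)] by (meson linorder_not_less)
    have "z \<notin> E"
    proof
      assume "z \<in> E"
      from far[OF this] show False using assms(2) by auto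
    qed
    have "bowen_separated f n \<epsilon> (insert z E)"
      using E(1) far unfolding \<E>_def bowen_separated_def by (auto simp: dist_commute)
    then have "insert z E \<in> \<E>" using E(1) z(1) by (auto simp: \<E>_def)
    then have "card (insert z E) \<le> card E" unfolding E(2) using fin by (intro Max_ge) auto
    then show False using \<open>z \<notin> E\<close> E(1) by (simp add: \<E>_def)
  qed
  then show ?thesis using that[of E] E unfolding \<E>_def sep_number_eq[OF assms(1)] by auto
qed

section \<open>Katok numbers and their exponential rates\<close>

lemma katok_number_le:
  assumes "finite F" "measure \<mu> (\<Union>x\<in>F. bowen_ball f n x \<epsilon>) > 1 - \<delta>"
  shows "katok_number f \<mu> n \<epsilon> \<delta> \<le> card F"
  unfolding katok_number_def using assms by (intro cINF_lower) auto

lemma katok_number_attained: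
  assumes "\<mu> \<in> borel_probs" "\<epsilon> > 0" "\<delta> > 0"
  obtains F where "finite F" "measure \<mu> (\<Union>x\<in>F. bowen_ball f n x \<epsilon>) > 1 - \<delta>"
    "card F = katok_number f \<mu> n \<epsilon> \<delta>"
proof -
  interpret prob_space \<mu> using assms by (simp add: borel_probs_def)
  have sp: "space \<mu> = UNIV" using assms sets_eq_imp_space_eq[of \<mu> borel] by (simp add: borel_probs_def)
  define \<F> where "\<F> = {F. finite F \<and> measure \<mu> (\<Union>x\<in>F. bowen_ball f n x \<epsilon>) > 1 - \<delta>}"
  obtain F0 where "finite F0" "(\<Union>x\<in>F0. bowen_ball f n x \<epsilon>) = UNIV"
    using finite_bowen_cover[OF assms(2)] .
  then have "F0 \<in> \<F>" using assms(3) prob_space by (simp add: \<F>_def sp)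
  then have "Inf (card ` \<F>) \<in> card ` \<F>" by (intro Inf_nat_def1) auto
  then show ?thesis using that unfolding katok_number_def \<F>_def[symmetric]
    by (auto simp: \<F>_def)
qed

lemma katok_number_antimono:
  assumes "\<mu> \<in> borel_probs" "\<epsilon> > 0" "0 < \<delta>" "\<delta> \<le> \<delta>'"
  shows "katok_number f \<mu> n \<epsilon> \<delta>' \<le> katok_number f \<mu> n \<epsilon> \<delta>"
proof -
  obtain F where F: "finite F" "measure \<mu> (\<Union>x\<in>F. bowen_ball f n x \<epsilon>) > 1 - \<delta>"
    "card F = katok_number f \<mu> n \<epsilon> \<delta>"
    using katok_number_attained[OF assms(1-3)] .
  then show ?thesis using katok_number_le[of F \<delta>' \<mu> n \<epsilon>] assms by simp
qed

lemma katok_number_pos: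
  assumes "\<mu> \<in> borel_probs" "\<epsilon> > 0" "0 < \<delta>" "\<delta> \<le> 1"
  shows "katok_number f \<mu> n \<epsilon> \<delta> \<ge> 1"
proof -
  obtain F where F: "finite F" "measure \<mu> (\<Union>x\<in>F. bowen_ball f n x \<epsilon>) > 1 - \<delta>"
    "card F = katok_number f \<mu> n \<epsilon> \<delta>"
    using katok_number_attained[OF assms(1-3)] .
  have "F \<noteq> {}" using F(2) assms by auto
  then show ?thesis using F by (simp add: Suc_le_eq card_gt_0_iff flip: F(3))
qed

definition katok_rate :: "'a measure \<Rightarrow> real \<Rightarrow> real \<Rightarrow> ereal" where
  "katok_rate \<mu> \<epsilon> \<delta> = limsup (\<lambda>n. ereal (1 / real n) * xln (real (katok_number f \<mu> n \<epsilon> \<delta>)))"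

lemma upper_katok_eq_SUP:
  assumes "\<mu> \<in> borel_probs" "\<epsilon> > 0"
  shows "upper_katok f \<mu> \<epsilon> = (SUP \<delta>\<in>{0<..}. katok_rate \<mu> \<epsilon> \<delta>)"
proof -
  have "(katok_rate \<mu> \<epsilon> \<longlongrightarrow> (SUP \<delta>\<in>{0<..}. katok_rate \<mu> \<epsilon> \<delta>)) (at_right 0)"
  proof (rule tendsto_SUP_at_right_0)
    fix s t :: real assume st: "0 < s" "s \<le> t"
    show "katok_rate \<mu> \<epsilon> t \<le> katok_rate \<mu> \<epsilon> s"
      unfolding katok_rate_def
    proof (rule Limsup_mono[OF always_eventually], rule allI, rule ereal_mult_left_mono)
      fix n
      show "xln (real (katok_number f \<mu> n \<epsilon> t)) \<le> xln (real (katok_number f \<mu> n \<epsilon> s))"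
        using katok_number_antimono[OF assms st, of n] by (auto simp: xln_def)
    qed simp
  qed
  then show ?thesis
    unfolding upper_katok_def katok_rate_def[abs_def] by (intro tendsto_Lim) simp_all
qed

lemma katok_rate_le_upper_katok:
  assumes "\<mu> \<in> borel_probs" "\<epsilon> > 0" "\<delta> > 0"
  shows "katok_rate \<mu> \<epsilon> \<delta> \<le> upper_katok f \<mu> \<epsilon>"
  unfolding upper_katok_eq_SUP[OF assms(1,2)] using assms(3) by (intro SUP_upper) simp

lemma upper_katok_nonneg:
  assumes "\<mu> \<in> borel_probs" "\<epsilon> > 0"
  shows "0 \<le> upper_katok f \<mu> \<epsilon>"
proof -
  have "0 \<le> katok_rate \<mu> \<epsilon> 1"
    unfolding katok_rate_def
  proof (rule le_Limsup[OF _ always_eventually], simp, rule allI)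
    fix n
    have "katok_number f \<mu> n \<epsilon> 1 \<ge> 1" using katok_number_pos[OF assms, of 1] by simp
    then show "0 \<le> ereal (1 / real n) * xln (real (katok_number f \<mu> n \<epsilon> 1))"
      by (simp add: xln_def)
  qed
  also have "\<dots> \<le> upper_katok f \<mu> \<epsilon>" by (rule katok_rate_le_upper_katok[OF assms]) simp
  finally show ?thesis .
qed

text \<open>One exponent a serves every tolerance \<delta>, so \<delta> may be chosen after all
  constants that depend on a.\<close>

lemma eventually_katok_number_le:
  assumes "\<mu> \<in> borel_probs" "\<epsilon> > 0" "\<delta> > 0" "upper_katok f \<mu> \<epsilon> < ereal a"
  shows "\<forall>\<^sub>F n in sequentially. real (katok_number f \<mu> n \<epsilon> \<delta>) \<le> exp (real n * a)"
proof -
  have "katok_rate \<mu> \<epsilon> \<delta> < ereal a"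
    using katok_rate_le_upper_katok[OF assms(1-3)] assms(4) by order
  then have "\<forall>\<^sub>F n in sequentially. ereal (1 / real n) * xln (real (katok_number f \<mu> n \<epsilon> \<delta>)) < ereal a"
    unfolding katok_rate_def by (rule Limsup_lessD)
  then show ?thesis
    using eventually_ge_at_top[of 1] by eventually_elim (rule le_exp_of_xln_rate)
qed

section \<open>Greedy coding of orbits by Bowen balls and single symbols\<close>

definition bad_visits :: "'a set \<Rightarrow> nat \<Rightarrow> 'a \<Rightarrow> nat" where
  "bad_visits U n x = card {j. j < n \<and> (f ^^ j) x \<notin> U}"

lemma bad_visits_shift_le: "k \<le> n \<Longrightarrow> bad_visits U (n - k) ((f ^^ k) x) \<le> bad_visits U n x"
  unfolding bad_visits_def
  by (rule card_inj_on_le[of "\<lambda>j. j + k"])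
     (auto simp: funpow_add inj_on_def)

lemma bad_visits_Suc_le:
  assumes "n \<ge> 1" "x \<notin> U"
  shows "Suc (bad_visits U (n - 1) (f x)) \<le> bad_visits U n x"
proof -
  have "Suc (bad_visits U (n - 1) (f x)) = card (insert 0 (Suc ` {j. j < n - 1 \<and> (f ^^ j) (f x) \<notin> U}))"
    unfolding bad_visits_def by (subst card_insert_disjoint) (auto simp: card_image)
  also have "\<dots> \<le> bad_visits U n x"
    unfolding bad_visits_def using assms by (intro card_mono) (auto simp: funpow_swap1)
  finally show ?thesis .
qed

text \<open>Read an orbit greedily: while it is in \<open>U\<close>, a whole block of length \<open>m\<close> is described by
  the centre of one Bowen ball; outside \<open>U\<close> a single step is described by one of \<open>K\<close> symbols, and
  costs a factor \<open>u\<close>. The constant \<open>c + K u\<close> dominates both transitions.\<close>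

lemma weighted_separated_bound:
  assumes \<epsilon>: "\<epsilon> > 0" and m: "m \<ge> 1" and F: "finite F" "real (card F) \<le> c ^ m" and c: "c \<ge> 1"
    and u: "0 < u" "u \<le> 1"
    and q: "\<And>x::'a. q x < K" "\<And>x. dist x (z (q x)) < \<epsilon>"
    and U: "U = (\<Union>x\<in>F. bowen_ball f m x \<epsilon>)"
  obtains D where "D \<ge> 1" "\<And>n E. bowen_separated f n (2 * \<epsilon>) E \<Longrightarrow>
    (\<Sum>x\<in>E. u ^ bad_visits U n x) \<le> D * (c + real K * u) ^ n"
proof -
  obtain K' where K': "K' \<ge> 1"
    "\<And>n E. bowen_separated f n (2 * \<epsilon>) E \<Longrightarrow> finite E \<and> card E \<le> K' ^ n"
    using card_bowen_separated_le[of "2 * \<epsilon>"] \<epsilon> by (metis mult_pos_pos zero_less_numeral)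
  \<comment> \<open>Absorbs the end of the reading, when fewer than m steps are left and at most
    \<open>K' ^ m\<close> points remain.\<close>
  define D where "D = real K' ^ m"
  define b where "b = c + real K * u"
  have D: "D \<ge> 1" unfolding D_def using K'(1) by (intro one_le_power) simp
  have b: "b \<ge> c" "b \<ge> 1" unfolding b_def using c u by (auto intro: add_increasing2)
  \<comment> \<open>Points indistinguishable for k steps are pushed forward by k, and the bound for
    the shorter length applies to their images.\<close>
  have image_bound: "(\<Sum>x\<in>E. u ^ bad_visits U (n - k) ((f ^^ k) x)) \<le> D * b ^ (n - k)"
    if IH: "\<And>E. bowen_separated f (n - k) (2 * \<epsilon>) E \<Longrightarrow> (\<Sum>x\<in>E. u ^ bad_visits U (n - k) x) \<le> D * b ^ (n - k)"
      and E: "bowen_separated f n (2 * \<epsilon>) E" "k \<le> n"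
        "\<And>x y j. x \<in> E \<Longrightarrow> y \<in> E \<Longrightarrow> j < k \<Longrightarrow> dist ((f ^^ j) x) ((f ^^ j) y) < 2 * \<epsilon>" for n k E
  proof -
    note image = bowen_separated_image[OF E(1) _ E(2) E(3)]
    have "(\<Sum>x\<in>E. u ^ bad_visits U (n - k) ((f ^^ k) x)) = (\<Sum>y\<in>(f ^^ k) ` E. u ^ bad_visits U (n - k) y)"
      using image(1) \<epsilon> by (subst sum.reindex) auto
    also have "\<dots> \<le> D * b ^ (n - k)" using image(2) \<epsilon> by (intro IH) auto
    finally show ?thesis .
  qed
  have "(\<Sum>x\<in>E. u ^ bad_visits U n x) \<le> D * b ^ n" if "bowen_separated f n (2 * \<epsilon>) E" for n E
    using that
  proof (induction n arbitrary: E rule: less_induct)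
    case (less n)
    have finE: "finite E" using K'(2)[OF less.prems] by simp
    show ?case
    proof (cases "n < m")
      case True
      have "(\<Sum>x\<in>E. u ^ bad_visits U n x) \<le> (\<Sum>x\<in>E. 1)"
        using u by (intro sum_mono power_le_one) auto
      also have "\<dots> \<le> real (K' ^ n)" using K'(2)[OF less.prems] by simp
      also have "\<dots> \<le> D" unfolding D_def using True K'(1) by (simp add: power_increasing)
      also have "\<dots> \<le> D * b ^ n" using D b one_le_power[of b n] by (simp add: mult_le_cancel_left1)
      finally show ?thesis .
    next
      case False
      then have n: "n \<ge> 1" "m \<le> n" using m by auto
      define Eb where "Eb = {x\<in>E. x \<notin> U}"
      define Eg where "Eg = {x\<in>E. x \<in> U}"
      have fin: "finite Eb" "finite Eg" using finE by (auto simp: Eb_def Eg_def)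
      \<comment> \<open>One symbol out of K is named, and the bad visit at time 0 yields the factor
        u.\<close>
      have bad: "(\<Sum>x\<in>Eb. u ^ bad_visits U n x) \<le> real K * u * (D * b ^ (n - 1))"
      proof -
        have "(\<Sum>x\<in>Eb. u ^ bad_visits U n x) = (\<Sum>i<K. \<Sum>x\<in>{x\<in>Eb. q x = i}. u ^ bad_visits U n x)"
          using q(1) by (subst sum.group) (auto simp: fin)
        also have "\<dots> \<le> (\<Sum>i<K. u * (D * b ^ (n - 1)))"
        proof (rule sum_mono)
          fix i
          have "(\<Sum>x\<in>{x\<in>Eb. q x = i}. u ^ bad_visits U n x)
              \<le> (\<Sum>x\<in>{x\<in>Eb. q x = i}. u * u ^ bad_visits U (n - 1) ((f ^^ 1) x))"
          proof (rule sum_mono)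
            fix x assume "x \<in> {x\<in>Eb. q x = i}"
            then have "Suc (bad_visits U (n - 1) (f x)) \<le> bad_visits U n x"
              using bad_visits_Suc_le[OF n(1)] by (auto simp: Eb_def)
            from power_decreasing[OF this, of u] u
            show "u ^ bad_visits U n x \<le> u * u ^ bad_visits U (n - 1) ((f ^^ 1) x)" by simp
          qed
          also have "\<dots> = u * (\<Sum>x\<in>{x\<in>Eb. q x = i}. u ^ bad_visits U (n - 1) ((f ^^ 1) x))"
            by (simp add: sum_distrib_left)
          also have "\<dots> \<le> u * (D * b ^ (n - 1))"
          proof (intro mult_left_mono image_bound)
            show "bowen_separated f n (2 * \<epsilon>) {x\<in>Eb. q x = i}"
              using less.prems by (rule bowen_separated_subset) (auto simp: Eb_def)
            fix x y j assume "x \<in> {x\<in>Eb. q x = i}" "y \<in> {x\<in>Eb. q x = i}" "j < (1::nat)"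
            then show "dist ((f ^^ j) x) ((f ^^ j) y) < 2 * \<epsilon>"
              using q(2)[of x] q(2)[of y] dist_triangle2[of x y "z i"] by auto
          qed (use n u less.IH in auto)
          finally show "(\<Sum>x\<in>{x\<in>Eb. q x = i}. u ^ bad_visits U n x) \<le> u * (D * b ^ (n - 1))" .
        qed
        finally show ?thesis by simp
      qed
      \<comment> \<open>One of the balls around F is named. Bad visits during the block are
        discarded, which can only increase the weight since u \<le> 1.\<close>
      have good: "(\<Sum>x\<in>Eg. u ^ bad_visits U n x) \<le> c ^ m * (D * b ^ (n - m))"
      proof -
        obtain p where p: "\<And>x. x \<in> U \<Longrightarrow> p x \<in> F \<and> x \<in> bowen_ball f m (p x) \<epsilon>"
          unfolding U by (metis UN_E)
        have "(\<Sum>x\<in>Eg. u ^ bad_visits U n x) = (\<Sum>i\<in>F. \<Sum>x\<in>{x\<in>Eg. p x = i}. u ^ bad_visits U n x)"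
          using p by (subst sum.group[OF fin(2) F(1)]) (auto simp: Eg_def)
        also have "\<dots> \<le> (\<Sum>i\<in>F. D * b ^ (n - m))"
        proof (rule sum_mono)
          fix i
          have "(\<Sum>x\<in>{x\<in>Eg. p x = i}. u ^ bad_visits U n x)
              \<le> (\<Sum>x\<in>{x\<in>Eg. p x = i}. u ^ bad_visits U (n - m) ((f ^^ m) x))"
            using u by (intro sum_mono power_decreasing bad_visits_shift_le n) auto
          also have "\<dots> \<le> D * b ^ (n - m)"
          proof (rule image_bound)
            show "bowen_separated f n (2 * \<epsilon>) {x\<in>Eg. p x = i}"
              using less.prems by (rule bowen_separated_subset) (auto simp: Eg_def)
            fix x y j assume "x \<in> {x\<in>Eg. p x = i}" "y \<in> {x\<in>Eg. p x = i}" "j < m"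
            then have "dist ((f ^^ j) i) ((f ^^ j) x) < \<epsilon>" "dist ((f ^^ j) i) ((f ^^ j) y) < \<epsilon>"
              using p[of x] p[of y] by (auto simp: Eg_def mem_bowen_ball_iff[OF m])
            then show "dist ((f ^^ j) x) ((f ^^ j) y) < 2 * \<epsilon>"
              using dist_triangle3[of "(f ^^ j) x" "(f ^^ j) y" "(f ^^ j) i"] by linarith
          qed (use n m less.IH in auto)
          finally show "(\<Sum>x\<in>{x\<in>Eg. p x = i}. u ^ bad_visits U n x) \<le> D * b ^ (n - m)" .
        qed
        also have "\<dots> = real (card F) * (D * b ^ (n - m))" by simp
        also have "\<dots> \<le> c ^ m * (D * b ^ (n - m))"
          using F(2) D b by (intro mult_right_mono) auto
        finally show ?thesis .
      qed
      have "(\<Sum>x\<in>E. u ^ bad_visits U n x) = (\<Sum>x\<in>Eb. u ^ bad_visits U n x) + (\<Sum>x\<in>Eg. u ^ bad_visits U n x)"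
      proof -
        have "E = Eb \<union> Eg" "Eb \<inter> Eg = {}" by (auto simp: Eb_def Eg_def)
        then show ?thesis using sum.union_disjoint[OF fin] by simp
      qed
      also have "\<dots> \<le> D * (real K * u * b ^ (n - 1) + c ^ m * b ^ (n - m))"
        using bad good by (simp add: algebra_simps)
      \<comment> \<open>Since c \<le> b, naming a ball for m steps costs no more than paying c once
        and b for each of the other m - 1 steps; with the bad part this adds up to (c + K u) b ^ (n
        - 1).\<close>
      also have "\<dots> \<le> D * (real K * u * b ^ (n - 1) + c * b ^ (n - 1))"
      proof -
        have "c ^ m = c * c ^ (m - 1)" using m by (simp flip: power_Suc)
        also have "\<dots> \<le> c * b ^ (m - 1)" using c b by (intro mult_left_mono power_mono) auto
        finally have "c ^ m * b ^ (n - m) \<le> c * b ^ (m - 1) * b ^ (n - m)"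
          using b by (intro mult_right_mono) auto
        also have "\<dots> = c * b ^ (n - 1)" using m n by (simp flip: power_add)
        finally show ?thesis using D by (intro mult_left_mono add_left_mono) auto
      qed
      also have "\<dots> = D * (b * b ^ (n - 1))" by (simp add: b_def algebra_simps)
      also have "\<dots> = D * b ^ n" using n by (simp flip: power_Suc)
      finally show ?thesis .
    qed
  qed
  then show ?thesis using that[of D] D unfolding b_def by blast
qed

end

section \<open>Pfister-Sullivan entropy\<close>

text \<open>The pushforward of the uniform law on {1..n} is a genuine measure, so the set function
  handed to \<open>measure_of\<close> is countably additive and \<open>empirical\<close> takes the
  intended values.\<close>

lemma empirical_eq_distr:
  assumes "n \<ge> 1"
  shows "empirical f n x = distr (uniform_count_measure {1..n}) borel (\<lambda>j. (f ^^ j) x)"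
proof -
  define \<nu> :: "'a measure" where "\<nu> = distr (uniform_count_measure {1..n}) borel (\<lambda>j. (f ^^ j) x)"
  have "empirical f n x = measure_of UNIV (sets borel) (emeasure \<nu>)"
    unfolding empirical_def
  proof (rule measure_of_eq)
    fix A :: "'a set" assume "A \<in> sigma_sets UNIV (sets borel)"
    then have A: "A \<in> sets borel" using sets.sigma_sets_eq[of "borel :: 'a measure"] by simp
    have "(\<Sum>j=1..n. emeasure (return borel ((f ^^ j) x)) A) = of_nat (card {j\<in>{1..n}. (f ^^ j) x \<in> A})"
      using A by (simp add: indicator_def sum.If_cases Int_def)
    moreover have "emeasure \<nu> A = ennreal (real (card {j\<in>{1..n}. (f ^^ j) x \<in> A}) / real n)"
    proof -
      have "emeasure \<nu> A = emeasure (uniform_count_measure {1..n}) {j\<in>{1..n}. (f ^^ j) x \<in> A}"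
        unfolding \<nu>_def using A
        by (subst emeasure_distr)
           (auto simp: space_uniform_count_measure intro!: arg_cong[of _ _ "emeasure _"])
      then show ?thesis by (subst (asm) emeasure_uniform_count_measure) auto
    qed
    ultimately show "ennreal (1 / real n) * (\<Sum>j=1..n. emeasure (return borel ((f ^^ j) x)) A) = emeasure \<nu> A"
      by (simp add: ennreal_of_nat_eq_real_of_nat ennreal_mult'[symmetric])
  qed simp
  also have "\<dots> = measure_of (space \<nu>) (sets \<nu>) (emeasure \<nu>)" by (simp add: \<nu>_def)
  also have "\<dots> = \<nu>" by (rule measure_of_of_measure)
  finally show ?thesis unfolding \<nu>_def .
qed

lemma empirical_in_borel_probs:
  assumes "n \<ge> 1"
  shows "empirical f n x \<in> borel_probs"
proof -
  interpret prob_space "uniform_count_measure {1..n}"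
    using assms by (intro prob_space_uniform_count_measure) auto
  have "prob_space (distr (uniform_count_measure {1..n}) borel (\<lambda>j. (f ^^ j) x))"
    by (rule prob_space_distr) simp
  then show ?thesis unfolding empirical_eq_distr[OF assms] borel_probs_def by simp
qed

lemma integral_empirical:
  fixes \<phi> :: "'a::topological_space \<Rightarrow> real"
  assumes "n \<ge> 1" "\<phi> \<in> borel_measurable borel"
  shows "(\<integral>y. \<phi> y \<partial>(empirical f n x)) = (\<Sum>j=1..n. \<phi> ((f ^^ j) x)) / real n"
  unfolding empirical_eq_distr[OF assms(1)] using assms(2)
  by (subst integral_distr) (auto simp: integral_uniform_count_measure)

lemma openin_weak_star_basic:
  fixes \<phi> :: "'a::topological_space \<Rightarrow> real"
  assumes "continuous_on UNIV \<phi>" "open U"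
  shows "openin weak_star {\<nu> \<in> borel_probs. (\<integral>x. \<phi> x \<partial>\<nu>) \<in> U}"
  unfolding weak_star_def using assms
  by (intro topology_generated_by_Basis) blast

lemma borel_probs_space:
  assumes "\<mu> \<in> borel_probs"
  shows "space \<mu> = UNIV"
  using assms sets_eq_imp_space_eq[of \<mu> borel] by (simp add: borel_probs_def)

context compact_dynamics
begin

lemma bounded_continuous:
  fixes \<phi> :: "'a \<Rightarrow> real"
  assumes "continuous_on UNIV \<phi>"
  obtains B where "\<And>x. \<bar>\<phi> x\<bar> \<le> B"
proof -
  have "bounded (range \<phi>)"
    using compact_continuous_image[OF assms compact_space] compact_imp_bounded by blast
  then show ?thesis using that unfolding bounded_iff by auto
qed

text \<open>Weak* neighbourhoods test only continuous functions, so the mass of an open set has to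
  be witnessed by one. The functions \<open>\<phi> k\<close> converge to the indicator from
  below.\<close>

lemma open_inner_function:
  assumes \<mu>: "\<mu> \<in> borel_probs" and U: "open U" "measure \<mu> U > a"
  obtains \<phi> :: "'a \<Rightarrow> real" where "continuous_on UNIV \<phi>" "\<And>x. \<phi> x \<le> indicator U x"
    "(\<integral>x. \<phi> x \<partial>\<mu>) > a"
proof -
  interpret prob_space \<mu> using \<mu> by (simp add: borel_probs_def)
  have sets [measurable_cong]: "sets \<mu> = sets borel" using \<mu> by (simp add: borel_probs_def)
  show ?thesis
  proof (cases "U = UNIV")
    \<comment> \<open>\<open>infdist\<close> to the empty set is 0, so the whole space needs its own
      witness.\<close>
    case True
    show ?thesis
      by (rule that[of "\<lambda>_. 1"]) (use U(2) True prob_space in \<open>auto simp: borel_probs_space[OF \<mu>]\<close>)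
  next
    case False
    define \<phi> where "\<phi> k x = min 1 (real k * infdist x (- U))" for k x
    have cont: "continuous_on UNIV (\<phi> k)" for k
      unfolding \<phi>_def by (intro continuous_intros)
    have [measurable]: "\<phi> k \<in> borel_measurable borel" for k
      by (rule borel_measurable_continuous_onI[OF cont])
    have le: "\<phi> k x \<le> indicator U x" for k x
      by (auto simp: \<phi>_def indicator_def)
    have nonneg: "0 \<le> \<phi> k x" for k x
      by (simp add: \<phi>_def infdist_nonneg)
    have "(\<lambda>k. \<integral>x. \<phi> k x \<partial>\<mu>) \<longlonglongrightarrow> (\<integral>x. indicator U x \<partial>\<mu>)"
    proof (rule integral_dominated_convergence[where w = "\<lambda>_. 1"])
      show "AE x in \<mu>. (\<lambda>k. \<phi> k x) \<longlonglongrightarrow> indicator U x"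
      proof (rule AE_I2)
        fix x
        show "(\<lambda>k. \<phi> k x) \<longlonglongrightarrow> indicator U x"
        proof (cases "x \<in> U")
          case True
          have "infdist x (- U) > 0"
            using True U(1) False by (intro infdist_pos_not_in_closed) auto
          then obtain k0 :: nat where k0: "1 < real k0 * infdist x (- U)"
            using reals_Archimedean3 by blast
          have "\<forall>\<^sub>F k in sequentially. \<phi> k x = indicator U x"
            using eventually_ge_at_top[of k0]
          proof eventually_elim
            case (elim k)
            then have "real k0 * infdist x (- U) \<le> real k * infdist x (- U)"
              by (intro mult_right_mono) (auto simp: infdist_nonneg)
            then show ?case using k0 True by (simp add: \<phi>_def)
          qed
          then show ?thesis by (rule tendsto_eventually)
        next
          case False
          then have "\<phi> k x = 0" for k by (simp add: \<phi>_def)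
          then show ?thesis using False by simp
        qed
      qed
      show "AE x in \<mu>. norm (\<phi> k x) \<le> 1" for k
        using nonneg by (auto simp: \<phi>_def)
      show "indicator U \<in> borel_measurable \<mu>"
        using U(1) by (intro borel_measurable_indicator) (simp add: sets)
    qed (simp_all)
    then have "(\<lambda>k. \<integral>x. \<phi> k x \<partial>\<mu>) \<longlonglongrightarrow> measure \<mu> U" by (simp add: borel_probs_space[OF \<mu>])
    then obtain k where "a < (\<integral>x. \<phi> k x \<partial>\<mu>)"
      using U(2) by (metis eventually_sequentially order_refl order_tendstoD(1))
    then show ?thesis using that[of "\<phi> k"] cont le by blast
  qed
qed

text \<open>A point whose empirical measure lies in V has at most 1 + \<delta> n bad visits, hence
  weight at least exp (- s (1 + \<delta> n)). The bound D b ^ n on the total weight then limits the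
  separated points to the growth rate ln b + \<delta> s < a.\<close>

lemma PS_entropy_le_upper_katok:
  assumes \<mu>: "\<mu> \<in> borel_probs" and \<epsilon>: "\<epsilon> > 0"
  shows "PS_entropy f \<mu> (2 * \<epsilon>) \<le> upper_katok f \<mu> \<epsilon>"
proof (rule ereal_le_real_gtI)
  fix a :: real assume "upper_katok f \<mu> \<epsilon> < ereal a"
  then obtain a' :: real where a': "upper_katok f \<mu> \<epsilon> < ereal a'" "a' < a"
    using ereal_dense2 by (metis less_ereal.simps(1))
  have a'0: "a' > 0" using upper_katok_nonneg[OF \<mu> \<epsilon>] a'(1)
    by (metis ereal_less(2) order_le_less_trans)
  obtain K :: nat and z :: "nat \<Rightarrow> 'a" and q :: "'a \<Rightarrow> nat"
    where "q \<in> borel \<rightarrow>\<^sub>M count_space UNIV" and q: "\<And>x. q x < K" "\<And>x. dist x (z (q x)) < \<epsilon>"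
    using finite_partition[OF \<epsilon>] by metis
  have K: "real K > 0" using q(1)[of undefined] by simp
  \<comment> \<open>Gives K u \<le> (exp a - exp a') / 2, which keeps b = exp a' + K u below exp a;
    the bound 1 / 2 makes s = - ln u positive.\<close>
  define u where "u = min (1 / 2) ((exp a - exp a') / (2 * real K))"
  have u: "0 < u" "u < 1" "u \<le> 1" using a'(2) K by (auto simp: u_def)
  define b where "b = exp a' + real K * u"
  have b0: "b > 0" using K u by (simp add: b_def add_pos_pos)
  have "real K * u \<le> real K * ((exp a - exp a') / (2 * real K))"
    using K by (intro mult_left_mono) (auto simp: u_def)
  also have "\<dots> < exp a - exp a'" using K a'(2) by (simp add: field_simps)
  finally have "b < exp a" by (simp add: b_def)
  then have lnb: "ln b < a" using b0 by (metis ln_exp ln_less_cancel_iff exp_gt_zero)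
  define s where "s = - ln u"
  have s: "s > 0" using u by (simp add: s_def)
  \<comment> \<open>s is the logarithmic price of one bad visit, so this \<delta> spends at most
    half of the gap a - ln b.\<close>
  define \<delta> where "\<delta> = min (1 / 2) ((a - ln b) / (2 * s))"
  have \<delta>: "\<delta> > 0" using lnb s by (simp add: \<delta>_def)
  have "\<delta> * s \<le> (a - ln b) / (2 * s) * s" using s by (intro mult_right_mono) (auto simp: \<delta>_def)
  also have "\<dots> < a - ln b" using s lnb by (simp add: field_simps)
  finally have rate: "ln b + \<delta> * s < a" by simp
  have "\<forall>\<^sub>F m in sequentially. m \<ge> 1 \<and> real (katok_number f \<mu> m \<epsilon> \<delta>) \<le> exp (real m * a')"
    using eventually_katok_number_le[OF \<mu> \<epsilon> \<delta> a'(1)] eventually_ge_at_top[of 1] by eventually_elim simp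
  then obtain m where m: "m \<ge> 1" "real (katok_number f \<mu> m \<epsilon> \<delta>) \<le> exp (real m * a')"
    using eventually_happens'[OF sequentially_bot] by blast
  obtain F where F: "finite F" "measure \<mu> (\<Union>x\<in>F. bowen_ball f m x \<epsilon>) > 1 - \<delta>"
    "card F = katok_number f \<mu> m \<epsilon> \<delta>"
    using katok_number_attained[OF \<mu> \<epsilon> \<delta>] .
  define U where "U = (\<Union>x\<in>F. bowen_ball f m x \<epsilon>)"
  have "open U" unfolding U_def by (intro open_UN ballI open_bowen_ball)
  have cF: "real (card F) \<le> exp a' ^ m" using m F(3) by (simp add: exp_of_nat_mult)
  obtain D where D: "D \<ge> 1" "\<And>n E. bowen_separated f n (2 * \<epsilon>) E \<Longrightarrow>
      (\<Sum>x\<in>E. u ^ bad_visits U n x) \<le> D * b ^ n"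
    using weighted_separated_bound[OF \<epsilon> m(1) F(1) cF _ u(1) u(3) q U_def] a'0
    unfolding b_def by (metis less_eq_real_def one_le_exp_iff)
  obtain \<phi> :: "'a \<Rightarrow> real" where \<phi>: "continuous_on UNIV \<phi>" "\<And>x. \<phi> x \<le> indicator U x"
    "(\<integral>x. \<phi> x \<partial>\<mu>) > 1 - \<delta>"
    using open_inner_function[OF \<mu> \<open>open U\<close>] F(2) unfolding U_def by metis
  have [measurable]: "\<phi> \<in> borel_measurable borel" by (rule borel_measurable_continuous_onI[OF \<phi>(1)])
  define V where "V = {\<nu> \<in> borel_probs. (\<integral>x. \<phi> x \<partial>\<nu>) \<in> {1 - \<delta><..}}"
  have "openin weak_star V" unfolding V_def by (rule openin_weak_star_basic[OF \<phi>(1)]) simp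
  then have V: "V \<in> weak_star_nhds \<mu>"
    unfolding weak_star_nhds_def using \<mu> \<phi>(3) by (auto simp: V_def)
  have few_bad: "real (bad_visits U n x) \<le> 1 + \<delta> * real n"
    if n: "n \<ge> 1" and x: "empirical f n x \<in> V" for n x
  proof -
    \<comment> \<open>\<open>empirical\<close> averages over times 1 to n but
      \<open>bad_visits\<close> counts times 0 to n - 1; time 0 is the extra 1.\<close>
    have "{j. j < n \<and> (f ^^ j) x \<notin> U} \<subseteq> insert 0 {j\<in>{1..n}. (f ^^ j) x \<notin> U}"
      by (auto simp: Suc_le_eq)
    then have "bad_visits U n x \<le> card (insert 0 {j\<in>{1..n}. (f ^^ j) x \<notin> U})"
      unfolding bad_visits_def by (intro card_mono) auto
    also have "\<dots> \<le> Suc (card {j\<in>{1..n}. (f ^^ j) x \<notin> U})" by (rule card_insert_le_m1) auto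
    finally have "real (bad_visits U n x) \<le> 1 + real (card {j\<in>{1..n}. (f ^^ j) x \<notin> U})" by simp
    also have "real (card {j\<in>{1..n}. (f ^^ j) x \<notin> U}) = (\<Sum>j\<in>{j\<in>{1..n}. (f ^^ j) x \<notin> U}. 1)" by simp
    also have "\<dots> = (\<Sum>j=1..n. 1 - indicator U ((f ^^ j) x))"
      by (subst sum.inter_filter) (auto simp: indicator_def intro!: sum.cong)
    also have "\<dots> \<le> (\<Sum>j=1..n. 1 - \<phi> ((f ^^ j) x))"
      by (intro sum_mono diff_left_mono \<phi>(2))
    also have "\<dots> = real n - (\<Sum>j=1..n. \<phi> ((f ^^ j) x))" by (simp add: sum_subtractf)
    also have "\<dots> \<le> \<delta> * real n"
    proof -
      have "1 - \<delta> < (\<Sum>j=1..n. \<phi> ((f ^^ j) x)) / real n"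
        using x n by (simp add: V_def integral_empirical)
      then show ?thesis using n by (simp add: field_simps)
    qed
    finally show ?thesis by simp
  qed
  define N where "N n = sep_number f n (2 * \<epsilon>) {x. empirical f n x \<in> V}" for n
  define t where "t n = (ln D + s) / real n + (ln b + \<delta> * s)" for n
  have bound: "ereal (1 / real n) * xln (real (N n)) \<le> ereal (t n)"
    if n: "n \<ge> 1" for n
  proof -
    obtain E where E: "E \<subseteq> {x. empirical f n x \<in> V}" "finite E" "bowen_separated f n (2 * \<epsilon>) E"
      "card E = N n"
      unfolding N_def using sep_number_attained[OF n, of "2 * \<epsilon>"] \<epsilon> by (metis mult_pos_pos zero_less_numeral)
    show ?thesis
    proof (cases "card E = 0")
      case True
      then show ?thesis using n by (simp add: xln_def flip: E(4))
    next
      case False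
      have "real (card E) * exp (- s * (1 + \<delta> * real n)) = (\<Sum>x\<in>E. exp (- s * (1 + \<delta> * real n)))" by simp
      also have "\<dots> \<le> (\<Sum>x\<in>E. u ^ bad_visits U n x)"
      proof (rule sum_mono)
        fix x assume "x \<in> E"
        then have "real (bad_visits U n x) \<le> 1 + \<delta> * real n" using few_bad[OF n] E(1) by auto
        then have "s * real (bad_visits U n x) \<le> s * (1 + \<delta> * real n)" using s by (intro mult_left_mono) auto
        then have "exp (- s * (1 + \<delta> * real n)) \<le> exp (real (bad_visits U n x) * ln u)"
          by (simp add: s_def mult.commute)
        also have "\<dots> = u ^ bad_visits U n x" using u by (simp add: exp_of_nat_mult)
        finally show "exp (- s * (1 + \<delta> * real n)) \<le> u ^ bad_visits U n x" .
      qed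
      also have "\<dots> \<le> D * b ^ n" by (rule D(2)[OF E(3)])
      finally have *: "real (card E) * exp (- s * (1 + \<delta> * real n)) \<le> D * b ^ n" .
      have "ln (real (card E) * exp (- s * (1 + \<delta> * real n))) \<le> ln (D * b ^ n)"
        using * False D(1) b0 by (subst ln_le_cancel_iff) auto
      then have "ln (real (card E)) - s * (1 + \<delta> * real n) \<le> ln D + real n * ln b"
        using False D(1) b0 by (simp add: ln_mult ln_realpow)
      moreover have "real n * t n = ln D + s + real n * (ln b + \<delta> * s)"
        using n unfolding t_def by (subst distrib_left) simp
      ultimately have "ln (real (card E)) \<le> real n * t n"
        by (simp add: algebra_simps)
      then have "ln (real (card E)) / real n \<le> t n" using n by (simp add: field_simps)
      then show ?thesis using False by (simp add: xln_def flip: E(4))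
    qed
  qed
  have "t \<longlonglongrightarrow> 0 + (ln b + \<delta> * s)"
    unfolding t_def by (intro tendsto_add tendsto_const lim_const_over_n)
  then have "\<forall>\<^sub>F n in sequentially. t n < a" using rate by (intro order_tendstoD(2)) auto
  then have "\<forall>\<^sub>F n in sequentially.
      ereal (1 / real n) * xln (real (N n)) \<le> ereal a"
    using eventually_ge_at_top[of 1]
  proof eventually_elim
    case (elim n)
    from bound[OF elim(2)] show ?case by (rule order_trans) (use elim(1) in simp)
  qed
  then have "limsup (\<lambda>n. ereal (1 / real n) * xln (real (N n))) \<le> ereal a"
    by (rule Limsup_bounded)
  then show "PS_entropy f \<mu> (2 * \<epsilon>) \<le> ereal a"
    unfolding PS_entropy_def N_def using V by (rule INF_lower2[rotated])
qed

end

section \<open>Ergodic constancy of the Brin-Katok rates\<close>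

context compact_dynamics
begin

lemma invariant_probsD:
  assumes "\<mu> \<in> invariant_probs f"
  shows "\<mu> \<in> borel_probs" "distr \<mu> borel f = \<mu>"
  using assms by (auto simp: invariant_probs_def)

lemma invariant_iterate:
  assumes "\<mu> \<in> invariant_probs f"
  shows "distr \<mu> borel (f ^^ n) = \<mu>"
proof (induction n)
  case 0
  have "sets \<mu> = sets borel" using assms by (auto simp: invariant_probs_def borel_probs_def)
  then show ?case by (simp add: distr_id2 id_def)
next
  case (Suc n)
  have [measurable_cong]: "sets \<mu> = sets borel" using assms by (auto simp: invariant_probs_def borel_probs_def)
  have "distr \<mu> borel (f ^^ Suc n) = distr (distr \<mu> borel (f ^^ n)) borel f"
    by (subst distr_distr) auto
  then show ?case using Suc invariant_probsD[OF assms] by (simp add: comp_def)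
qed

lemma measure_vimage_iterate:
  assumes "\<mu> \<in> invariant_probs f" "A \<in> sets borel"
  shows "measure \<mu> ((f ^^ n) -` A) = measure \<mu> A"
proof -
  have sets: "sets \<mu> = sets borel" using assms by (auto simp: invariant_probs_def borel_probs_def)
  have "measure \<mu> A = measure (distr \<mu> borel (f ^^ n)) A" by (simp add: invariant_iterate[OF assms(1)])
  also have "\<dots> = measure \<mu> ((f ^^ n) -` A \<inter> space \<mu>)"
    using assms(2) by (intro measure_distr) (auto simp: measurable_cong_sets[OF sets refl])
  finally show ?thesis using borel_probs_space[OF invariant_probsD(1)[OF assms(1)]] by simp
qed

lemma integral_iterate:
  fixes \<phi> :: "'a \<Rightarrow> real"
  assumes "\<mu> \<in> invariant_probs f" "\<phi> \<in> borel_measurable borel"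
  shows "(\<integral>x. \<phi> ((f ^^ n) x) \<partial>\<mu>) = (\<integral>x. \<phi> x \<partial>\<mu>)"
proof -
  have sets: "sets \<mu> = sets borel" using assms by (auto simp: invariant_probs_def borel_probs_def)
  have "(\<integral>x. \<phi> x \<partial>(distr \<mu> borel (f ^^ n))) = (\<integral>x. \<phi> ((f ^^ n) x) \<partial>\<mu>)"
    using assms(2) by (intro integral_distr) (auto simp: measurable_cong_sets[OF sets refl])
  then show ?thesis by (simp add: invariant_iterate[OF assms(1)])
qed

lemma ergodic_probsD:
  assumes "\<mu> \<in> ergodic_probs f"
  shows "\<mu> \<in> invariant_probs f" "\<mu> \<in> borel_probs" "prob_space \<mu>" "sets \<mu> = sets borel"
  using assms by (auto simp: ergodic_probs_def invariant_probs_def borel_probs_def)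

text \<open>For a function that does not increase along orbits, the superlevel set A contains its
  preimage but need not equal it. The intersection B of all its preimages is exactly invariant, as
  the definition of ergodicity requires, and has the measure of A because every preimage
  has.\<close>

lemma ergodic_superlevel:
  fixes g :: "'a \<Rightarrow> ereal"
  assumes \<mu>: "\<mu> \<in> ergodic_probs f" and g: "g \<in> borel_measurable borel" "\<And>x. g (f x) \<le> g x"
  shows "(AE x in \<mu>. c < g x) \<or> (AE x in \<mu>. g x \<le> c)"
proof -
  note inv = ergodic_probsD(1)[OF \<mu>] and sets [measurable_cong] = ergodic_probsD(4)[OF \<mu>]
  interpret prob_space \<mu> by (rule ergodic_probsD(3)[OF \<mu>])
  note [measurable] = g(1)
  define A where "A = {x. c < g x}"
  have A [measurable]: "A \<in> sets borel" unfolding A_def by measurable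
  have sub: "f -` A \<subseteq> A" unfolding A_def using g(2) by (auto intro: less_le_trans)
  have pre [measurable]: "(f ^^ n) -` A \<in> sets borel" for n
    using measurable_sets[OF measurable_iterate A, of n] by simp
  define B where "B = (\<Inter>n. (f ^^ n) -` A)"
  have B: "B \<in> sets borel" unfolding B_def by measurable
  have "f -` B = B"
  proof (intro equalityI subsetI)
    fix x assume "x \<in> f -` B"
    then have *: "(f ^^ n) (f x) \<in> A" for n by (auto simp: B_def)
    have "(f ^^ n) x \<in> A" for n
    proof (cases n)
      case 0
      then show ?thesis using *[of 0] sub by auto
    next
      case (Suc k)
      then show ?thesis using *[of k] by (simp add: funpow_swap1)
    qed
    then show "x \<in> B" by (simp add: B_def)
  next
    fix x assume "x \<in> B"
    then have *: "(f ^^ n) x \<in> A" for n by (auto simp: B_def)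
    have "(f ^^ n) (f x) \<in> A" for n using *[of "Suc n"] by (simp add: funpow_swap1)
    then show "x \<in> f -` B" by (simp add: B_def)
  qed
  then have "measure \<mu> B = 0 \<or> measure \<mu> B = 1"
    using \<mu> B by (auto simp: ergodic_probs_def)
  moreover have "measure \<mu> B = measure \<mu> A"
  proof -
    have "decseq (\<lambda>n. (f ^^ n) -` A)"
      by (rule decseq_SucI) (use sub in auto)
    then have "(\<lambda>n. measure \<mu> ((f ^^ n) -` A)) \<longlonglongrightarrow> measure \<mu> B"
      unfolding B_def using pre by (intro finite_Lim_measure_decseq) (auto simp: sets)
    then have "(\<lambda>n::nat. measure \<mu> A) \<longlonglongrightarrow> measure \<mu> B"
      by (simp add: measure_vimage_iterate[OF inv A])
    then show ?thesis using LIMSEQ_unique tendsto_const by metis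
  qed
  ultimately have "measure \<mu> A = 0 \<or> measure \<mu> A = 1" by simp
  then have "(AE x in \<mu>. x \<notin> A) \<or> (AE x in \<mu>. x \<in> A)"
    using prob_eq_1[of A] by (auto simp: null_sets_def sets emeasure_eq_measure intro!: AE_not_in)
  then show ?thesis unfolding A_def by (auto simp: not_less)
qed

text \<open>The preimage of the ball of length n at f x contains the ball of length n + 1 at x and
  has the same measure as the former; dividing by n + 1 instead of n leaves the factor.\<close>

lemma local_rate_map_le:
  assumes \<mu>: "\<mu> \<in> invariant_probs f" and n: "n \<ge> 1"
  shows "ereal (real n / real (Suc n)) * local_rate f \<mu> \<epsilon> (f x) n \<le> local_rate f \<mu> \<epsilon> x (Suc n)"
proof -
  have pr: "prob_space \<mu>" and sets: "sets \<mu> = sets borel"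
    using \<mu> by (auto simp: invariant_probs_def borel_probs_def)
  interpret prob_space \<mu> by (rule pr)
  define p where "p = measure \<mu> (bowen_ball f (Suc n) x \<epsilon>)"
  define p' where "p' = measure \<mu> (bowen_ball f n (f x) \<epsilon>)"
  have le: "p \<le> p'"
  proof -
    have "bowen_ball f (Suc n) x \<epsilon> \<subseteq> (f ^^ 1) -` bowen_ball f n (f x) \<epsilon>"
    proof
      fix y assume y: "y \<in> bowen_ball f (Suc n) x \<epsilon>"
      have "dist ((f ^^ j) (f x)) ((f ^^ j) (f y)) < \<epsilon>" if "j < n" for j
        using y that by (auto simp: mem_bowen_ball_iff dest!: spec[of _ "Suc j"] simp: funpow_swap1)
      then show "y \<in> (f ^^ 1) -` bowen_ball f n (f x) \<epsilon>" using n by (simp add: mem_bowen_ball_iff)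
    qed
    moreover have "(f ^^ 1) -` bowen_ball f n (f x) \<epsilon> \<in> sets \<mu>"
      using measurable_sets[OF measurable_iterate sets_bowen_ball, of 1] by (simp add: sets)
    ultimately have "p \<le> measure \<mu> ((f ^^ 1) -` bowen_ball f n (f x) \<epsilon>)"
      unfolding p_def by (intro finite_measure_mono)
    then show ?thesis by (simp only: p'_def measure_vimage_iterate[OF \<mu> sets_bowen_ball])
  qed
  show ?thesis
  proof (cases "p = 0")
    case True
    then show ?thesis by (simp add: local_rate_def xln_def flip: p_def)
  next
    case False
    have p: "p > 0" using False by (simp add: p_def order_less_le)
    then have "ln p \<le> ln p'" using le by simp
    moreover have "local_rate f \<mu> \<epsilon> x (Suc n) = ereal (- (ln p / real (Suc n)))"
      using p by (simp add: local_rate_def xln_def flip: p_def)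
    moreover have "local_rate f \<mu> \<epsilon> (f x) n = ereal (- (ln p' / real n))"
      using p le by (simp add: local_rate_def xln_def flip: p'_def)
    ultimately show ?thesis using n by (simp add: divide_right_mono)
  qed
qed

text \<open>The factor n / (n + 1) tends to 1 and a shift of time changes no limit. Only an
  inequality results, which is all that \<open>ergodic_superlevel\<close> asks for.\<close>

lemma local_rate_limits_map_le:
  assumes "\<mu> \<in> invariant_probs f"
  shows "limsup (local_rate f \<mu> \<epsilon> (f x)) \<le> limsup (local_rate f \<mu> \<epsilon> x)"
    and "liminf (local_rate f \<mu> \<epsilon> (f x)) \<le> liminf (local_rate f \<mu> \<epsilon> x)"
proof -
  have lim: "(\<lambda>n. ereal (real n / real (Suc n))) \<longlonglongrightarrow> ereal 1"
    using LIMSEQ_n_over_Suc_n by (intro tendsto_ereal) (simp add: add.commute)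
  have ev: "\<forall>\<^sub>F n in sequentially. ereal (real n / real (Suc n)) * local_rate f \<mu> \<epsilon> (f x) n
      \<le> local_rate f \<mu> \<epsilon> x (Suc n)"
    using eventually_ge_at_top[of 1] by eventually_elim (rule local_rate_map_le[OF assms])
  have "limsup (local_rate f \<mu> \<epsilon> (f x)) = limsup (\<lambda>n. ereal (real n / real (Suc n)) * local_rate f \<mu> \<epsilon> (f x) n)"
    using ereal_limsup_lim_mult[OF lim, of "local_rate f \<mu> \<epsilon> (f x)"] by (simp flip: one_ereal_def)
  also have "\<dots> \<le> limsup (\<lambda>n. local_rate f \<mu> \<epsilon> x (Suc n))" by (rule Limsup_mono[OF ev])
  finally show "limsup (local_rate f \<mu> \<epsilon> (f x)) \<le> limsup (local_rate f \<mu> \<epsilon> x)"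
    using limsup_shift[of "local_rate f \<mu> \<epsilon> x"] by simp
  have "liminf (local_rate f \<mu> \<epsilon> (f x)) = liminf (\<lambda>n. ereal (real n / real (Suc n)) * local_rate f \<mu> \<epsilon> (f x) n)"
    using ereal_liminf_lim_mult[OF lim, of "local_rate f \<mu> \<epsilon> (f x)"] by (simp flip: one_ereal_def)
  also have "\<dots> \<le> liminf (\<lambda>n. local_rate f \<mu> \<epsilon> x (Suc n))" by (rule Liminf_mono[OF ev])
  finally show "liminf (local_rate f \<mu> \<epsilon> (f x)) \<le> liminf (local_rate f \<mu> \<epsilon> x)"
    using liminf_shift[of "local_rate f \<mu> \<epsilon> x"] by simp
qed

text \<open>By the ergodic dichotomy the only alternative is a limsup above a almost everywhere, and
  the integral would then reach a.\<close>

lemma ergodic_upper_BK_AE: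
  assumes \<mu>: "\<mu> \<in> ergodic_probs f" and a: "upper_BK f \<mu> \<epsilon> < ereal a"
  shows "AE x in \<mu>. limsup (local_rate f \<mu> \<epsilon> x) \<le> ereal a"
proof -
  note inv = ergodic_probsD(1)[OF \<mu>]
  interpret prob_space \<mu> by (rule ergodic_probsD(3)[OF \<mu>])
  note [measurable] = measurable_local_rate[OF ergodic_probsD(2)[OF \<mu>]]
  define g where "g x = limsup (local_rate f \<mu> \<epsilon> x)" for x
  have g: "g \<in> borel_measurable borel" unfolding g_def by measurable
  have "\<not> (AE x in \<mu>. ereal a < g x)"
  proof
    assume "AE x in \<mu>. ereal a < g x"
    then have "(\<integral>\<^sup>+x. e2ennreal (ereal a) \<partial>\<mu>) \<le> (\<integral>\<^sup>+x. e2ennreal (g x) \<partial>\<mu>)"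
      by (intro nn_integral_mono_AE, eventually_elim) (rule e2ennreal_mono, simp)
    then have "e2ennreal (ereal a) \<le> (\<integral>\<^sup>+x. e2ennreal (g x) \<partial>\<mu>)" by (simp add: emeasure_space_1)
    then have "enn2ereal (e2ennreal (ereal a)) \<le> upper_BK f \<mu> \<epsilon>"
      unfolding upper_BK_def g_def by (simp add: less_eq_ennreal.rep_eq)
    moreover have "ereal a \<le> enn2ereal (e2ennreal (ereal a))" by (simp add: ennreal.rep_eq)
    ultimately show False using a by order
  qed
  then show ?thesis
    using ergodic_superlevel[OF \<mu> g, of "ereal a"] local_rate_limits_map_le(1)[OF inv] unfolding g_def by blast
qed

lemma ergodic_lower_BK_AE:
  assumes \<mu>: "\<mu> \<in> ergodic_probs f" and a: "ereal a < lower_BK f \<mu> \<epsilon>"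
  shows "AE x in \<mu>. ereal a \<le> liminf (local_rate f \<mu> \<epsilon> x)"
proof (cases "a \<ge> 0")
  \<comment> \<open>For negative a the clipping by \<open>e2ennreal\<close> would spoil the
    comparison of integrals; nonnegativity of the rates is enough here.\<close>
  case False
  show ?thesis
  proof (rule AE_I2, rule Liminf_bounded, rule always_eventually, rule allI)
    fix x n
    have "ereal a \<le> 0" using False by simp
    also have "0 \<le> local_rate f \<mu> \<epsilon> x n" by (rule local_rate_nonneg[OF ergodic_probsD(2)[OF \<mu>]])
    finally show "ereal a \<le> local_rate f \<mu> \<epsilon> x n" .
  qed
next
  case True
  note inv = ergodic_probsD(1)[OF \<mu>]
  interpret prob_space \<mu> by (rule ergodic_probsD(3)[OF \<mu>])
  note [measurable] = measurable_local_rate[OF ergodic_probsD(2)[OF \<mu>]]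
  define g where "g x = liminf (local_rate f \<mu> \<epsilon> x)" for x
  have g: "g \<in> borel_measurable borel" unfolding g_def by measurable
  have "\<not> (AE x in \<mu>. g x \<le> ereal a)"
  proof
    assume "AE x in \<mu>. g x \<le> ereal a"
    then have "(\<integral>\<^sup>+x. e2ennreal (g x) \<partial>\<mu>) \<le> (\<integral>\<^sup>+x. e2ennreal (ereal a) \<partial>\<mu>)"
      by (intro nn_integral_mono_AE, eventually_elim) (rule e2ennreal_mono)
    then have "(\<integral>\<^sup>+x. e2ennreal (g x) \<partial>\<mu>) \<le> e2ennreal (ereal a)" by (simp add: emeasure_space_1)
    then have "lower_BK f \<mu> \<epsilon> \<le> enn2ereal (e2ennreal (ereal a))"
      unfolding lower_BK_def g_def by (simp add: less_eq_ennreal.rep_eq)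
    moreover have "enn2ereal (e2ennreal (ereal a)) = ereal a" using True by simp
    ultimately show False using a by order
  qed
  then have "AE x in \<mu>. ereal a < g x"
    using ergodic_superlevel[OF \<mu> g, of "ereal a"] local_rate_limits_map_le(2)[OF inv] unfolding g_def by blast
  then show ?thesis unfolding g_def by eventually_elim simp
qed

text \<open>Packing: the \<epsilon>-balls around a maximal 2 \<epsilon>-separated subset of the good
  set \<open>S n\<close> are disjoint and have mass at least exp (- n a), so there are at most exp
  (n a) of them. The balls of radius 2 \<epsilon> cover \<open>S n\<close>, whose mass exceeds 1 -
  \<delta> for large n.\<close>

lemma upper_katok_le_upper_BK:
  assumes \<mu>: "\<mu> \<in> ergodic_probs f" and \<epsilon>: "\<epsilon> > 0"
  shows "upper_katok f \<mu> (2 * \<epsilon>) \<le> upper_BK f \<mu> \<epsilon>"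
proof (rule ereal_le_real_gtI)
  fix a :: real assume "upper_BK f \<mu> \<epsilon> < ereal a"
  then obtain a' :: real where a': "upper_BK f \<mu> \<epsilon> < ereal a'" "a' < a"
    using ereal_dense2 by (metis less_ereal.simps(1))
  note bp = ergodic_probsD(2)[OF \<mu>]
  note sets [measurable_cong] = ergodic_probsD(4)[OF \<mu>]
  interpret prob_space \<mu> by (rule ergodic_probsD(3)[OF \<mu>])
  note [measurable] = measurable_local_rate[OF bp]
  define S where "S n = {x. local_rate f \<mu> \<epsilon> x n < ereal a}" for n
  have S_borel: "S n \<in> sets borel" for n unfolding S_def by measurable
  have "AE x in \<mu>. \<forall>\<^sub>F n in sequentially. x \<in> S n"
    using ergodic_upper_BK_AE[OF \<mu> a'(1)]
  proof eventually_elim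
    case (elim x)
    then have "limsup (local_rate f \<mu> \<epsilon> x) < ereal a" using a'(2) by (metis less_ereal.simps(1) order_le_less_trans)
    then show ?case by (auto simp: S_def dest: Limsup_lessD)
  qed
  then have lim: "(\<lambda>n. prob (S n)) \<longlonglongrightarrow> 1"
    using S_borel by (intro prob_tendsto_1_of_AE_eventually) (simp_all add: sets)
  show "upper_katok f \<mu> (2 * \<epsilon>) \<le> ereal a"
  proof (subst upper_katok_eq_SUP[OF bp], use \<epsilon> in simp, rule SUP_least)
    fix \<delta> :: real assume "\<delta> \<in> {0<..}"
    then have "\<forall>\<^sub>F n in sequentially. 1 - \<delta> < prob (S n)" by (intro order_tendstoD(1)[OF lim]) simp
    then have "\<forall>\<^sub>F n in sequentially. ereal (1 / real n) * xln (real (katok_number f \<mu> n (2 * \<epsilon>) \<delta>)) \<le> ereal a"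
      using eventually_ge_at_top[of 1]
    proof eventually_elim
      case (elim n)
      obtain E where E: "E \<subseteq> S n" "finite E" "bowen_separated f n (2 * \<epsilon>) E"
        "S n \<subseteq> (\<Union>x\<in>E. bowen_ball f n x (2 * \<epsilon>))"
        using sep_number_attained[OF elim(2), of "2 * \<epsilon>"] \<epsilon> by (metis mult_pos_pos zero_less_numeral)
      have "real (card E) * exp (- (real n * a)) = (\<Sum>x\<in>E. exp (- (real n * a)))" by simp
      also have "\<dots> \<le> (\<Sum>x\<in>E. prob (bowen_ball f n x \<epsilon>))"
        using E(1) by (intro sum_mono local_rate_lessD[OF elim(2)]) (auto simp: S_def)
      also have "\<dots> = prob (\<Union>x\<in>E. bowen_ball f n x \<epsilon>)"
      proof (rule finite_measure_finite_Union[symmetric, OF E(2)])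
        show "disjoint_family_on (\<lambda>x. bowen_ball f n x \<epsilon>) E"
          unfolding disjoint_family_on_def
        proof safe
          fix x y w assume xy: "x \<in> E" "y \<in> E" "x \<noteq> y"
            and w: "w \<in> bowen_ball f n x \<epsilon>" "w \<in> bowen_ball f n y \<epsilon>"
          obtain j where j: "j < n" "2 * \<epsilon> \<le> dist ((f ^^ j) x) ((f ^^ j) y)"
            using E(3) xy unfolding bowen_separated_def by blast
          show "w \<in> {}"
            using w j dist_triangle2[of "(f ^^ j) x" "(f ^^ j) y" "(f ^^ j) w"]
            by (auto simp: mem_bowen_ball_iff[OF elim(2)] dest!: spec[of _ j])
        qed
      qed (auto simp: sets)
      also have "\<dots> \<le> 1" by (rule prob_le_1)
      finally have "real (card E) \<le> exp (real n * a)" by (simp add: exp_minus field_simps)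
      moreover have "katok_number f \<mu> n (2 * \<epsilon>) \<delta> \<le> card E"
      proof (rule katok_number_le[OF E(2)])
        have "prob (S n) \<le> prob (\<Union>x\<in>E. bowen_ball f n x (2 * \<epsilon>))"
          using E(2,4) by (intro finite_measure_mono sets.finite_UN) (auto simp: sets)
        then show "1 - \<delta> < prob (\<Union>x\<in>E. bowen_ball f n x (2 * \<epsilon>))" using elim(1) by simp
      qed
      ultimately have "real (katok_number f \<mu> n (2 * \<epsilon>) \<delta>) \<le> exp (real n * a)" by linarith
      then show ?case by (rule xln_rate_le[OF elim(2)])
    qed
    then show "katok_rate \<mu> (2 * \<epsilon>) \<delta> \<le> ereal a" unfolding katok_rate_def by (rule Limsup_bounded)
  qed
qed

end

section \<open>Generic points\<close>

context compact_dynamics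
begin

section \<open>Birkhoff averages of bounded functions by maximal sums\<close>

definition birkhoff_sum :: "('a \<Rightarrow> real) \<Rightarrow> nat \<Rightarrow> 'a \<Rightarrow> real" where
  "birkhoff_sum \<phi> n x = (\<Sum>j<n. \<phi> ((f ^^ j) x))"

lemma birkhoff_sum_Suc: "birkhoff_sum \<phi> (Suc n) x = \<phi> x + birkhoff_sum \<phi> n (f x)"
  unfolding birkhoff_sum_def by (subst sum.lessThan_Suc_shift) (simp add: funpow_swap1)

lemma measurable_birkhoff_sum [measurable]:
  assumes [measurable]: "\<phi> \<in> borel_measurable borel"
  shows "birkhoff_sum \<phi> n \<in> borel_measurable borel"
  unfolding birkhoff_sum_def by measurable

text \<open>The maximum of \<open>0\<close> and the first \<open>n\<close> Birkhoff sums.\<close>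

primrec max_birkhoff :: "('a \<Rightarrow> real) \<Rightarrow> nat \<Rightarrow> 'a \<Rightarrow> real" where
  "max_birkhoff \<phi> 0 x = 0"
| "max_birkhoff \<phi> (Suc n) x = max 0 (\<phi> x + max_birkhoff \<phi> n (f x))"

lemma measurable_max_birkhoff [measurable]:
  assumes [measurable]: "\<phi> \<in> borel_measurable borel"
  shows "max_birkhoff \<phi> n \<in> borel_measurable borel"
proof (induction n)
  case (Suc n)
  note [measurable] = Suc
  show ?case by simp
qed simp

lemma max_birkhoff_nonneg: "0 \<le> max_birkhoff \<phi> n x"
  by (cases n) auto

lemma max_birkhoff_mono_Suc: "max_birkhoff \<phi> n x \<le> max_birkhoff \<phi> (Suc n) x"
proof (induction n arbitrary: x)
  case (Suc n)
  from Suc[of "f x"] show ?case by auto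
qed simp

lemma birkhoff_sum_le_max: "k \<le> n \<Longrightarrow> birkhoff_sum \<phi> k x \<le> max_birkhoff \<phi> n x"
proof (induction n arbitrary: k x)
  case (Suc n)
  show ?case
  proof (cases k)
    case (Suc k')
    then show ?thesis using Suc.IH[of k' "f x"] Suc.prems by (auto simp: birkhoff_sum_Suc)
  qed (simp add: birkhoff_sum_def)
qed (simp add: birkhoff_sum_def)

lemma max_birkhoff_le:
  assumes "\<And>x. \<bar>\<phi> x\<bar> \<le> C"
  shows "max_birkhoff \<phi> n x \<le> real n * C"
proof (induction n arbitrary: x)
  case (Suc n)
  have "0 \<le> C" using assms[of x] by linarith
  moreover have "\<phi> x \<le> C" using assms[of x] by linarith
  ultimately show ?case using Suc[of "f x"] by (simp add: algebra_simps)
qed simp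

text \<open>Garsia's argument. With M_n the maximal sums, the function max(\<phi>, - M_n(f x))
  equals M_{n+1}(x) - M_n(f x) and has nonnegative integral, as M_n increases with n and \<mu> is
  invariant. Where the sums are unbounded it tends to \<phi>; if that were so almost everywhere,
  \<phi> would have nonnegative integral.\<close>

lemma AE_birkhoff_sum_bounded:
  assumes \<mu>: "\<mu> \<in> ergodic_probs f" and \<phi> [measurable]: "\<phi> \<in> borel_measurable borel"
    and C: "\<And>x. \<bar>\<phi> x\<bar> \<le> C" and neg: "(\<integral>x. \<phi> x \<partial>\<mu>) < 0"
  shows "AE x in \<mu>. \<exists>B. \<forall>n. birkhoff_sum \<phi> n x \<le> B"
proof -
  note inv = ergodic_probsD(1)[OF \<mu>] and sets [measurable_cong] = ergodic_probsD(4)[OF \<mu>]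
  interpret prob_space \<mu> by (rule ergodic_probsD(3)[OF \<mu>])
  define A where "A = {x. \<forall>m::nat. \<exists>n. real m < birkhoff_sum \<phi> n x}"
  have A [measurable]: "A \<in> sets borel" unfolding A_def by measurable
  \<comment> \<open>Passing from x to f x shifts the index of the sums and changes them by at most
    C, so unboundedness is an exactly invariant property.\<close>
  have "x \<in> A \<longleftrightarrow> f x \<in> A" for x
  proof
    assume x: "x \<in> A"
    show "f x \<in> A" unfolding A_def
    proof (rule CollectI, rule allI)
      fix m :: nat
      obtain m' :: nat where m': "real m + C < real m'" using reals_Archimedean2 by blast
      obtain n where n: "real m' < birkhoff_sum \<phi> n x" using x by (auto simp: A_def)
      obtain k where k: "n = Suc k" using n by (cases n) (auto simp: birkhoff_sum_def)
      have "real m < birkhoff_sum \<phi> k (f x)"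
        using n m' C[of x] unfolding k birkhoff_sum_Suc by linarith
      then show "\<exists>n. real m < birkhoff_sum \<phi> n (f x)" by blast
    qed
  next
    assume x: "f x \<in> A"
    show "x \<in> A" unfolding A_def
    proof (rule CollectI, rule allI)
      fix m :: nat
      obtain m' :: nat where m': "real m + C < real m'" using reals_Archimedean2 by blast
      obtain n where n: "real m' < birkhoff_sum \<phi> n (f x)" using x by (auto simp: A_def)
      have "real m < birkhoff_sum \<phi> (Suc n) x"
        using n m' C[of x] unfolding birkhoff_sum_Suc by linarith
      then show "\<exists>n. real m < birkhoff_sum \<phi> n x" by blast
    qed
  qed
  note A_inv = this
  then have "f -` A = A" by auto
  then have "measure \<mu> A = 0 \<or> measure \<mu> A = 1" using \<mu> A by (auto simp: ergodic_probs_def)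
  moreover have "measure \<mu> A \<noteq> 1"
  proof
    assume "measure \<mu> A = 1"
    then have ae: "AE x in \<mu>. x \<in> A" using prob_eq_1[of A] by (simp add: sets)
    define h where "h n x = max (\<phi> x) (- max_birkhoff \<phi> n (f x))" for n x
    have C0: "C \<ge> 0" using C[of undefined] by linarith
    have integrable_M: "integrable \<mu> (max_birkhoff \<phi> n)" for n
      by (rule integrable_const_bound[where B = "real n * C"])
         (auto simp: max_birkhoff_le[OF C] max_birkhoff_nonneg)
    have integrable_Mf: "integrable \<mu> (\<lambda>x. max_birkhoff \<phi> n (f x))" for n
      by (rule integrable_const_bound[where B = "real n * C"])
         (auto simp: max_birkhoff_le[OF C] max_birkhoff_nonneg)
    have h_eq: "h n x = max_birkhoff \<phi> (Suc n) x - max_birkhoff \<phi> n (f x)" for n x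
      by (simp add: h_def)
    have "0 \<le> (\<integral>x. h n x \<partial>\<mu>)" for n
    proof -
      have 1: "(\<integral>x. h n x \<partial>\<mu>) = (\<integral>x. max_birkhoff \<phi> (Suc n) x \<partial>\<mu>) - (\<integral>x. max_birkhoff \<phi> n (f x) \<partial>\<mu>)"
        unfolding h_eq by (intro Bochner_Integration.integral_diff integrable_M integrable_Mf)
      have 2: "(\<integral>x. max_birkhoff \<phi> n (f x) \<partial>\<mu>) = (\<integral>x. max_birkhoff \<phi> n x \<partial>\<mu>)"
        using integral_iterate[OF inv measurable_max_birkhoff[OF \<phi>], of n 1] by simp
      have 3: "(\<integral>x. max_birkhoff \<phi> n x \<partial>\<mu>) \<le> (\<integral>x. max_birkhoff \<phi> (Suc n) x \<partial>\<mu>)"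
        by (intro integral_mono integrable_M max_birkhoff_mono_Suc)
      from 1 2 3 show ?thesis by linarith
    qed
    moreover have "(\<lambda>n. \<integral>x. h n x \<partial>\<mu>) \<longlonglongrightarrow> (\<integral>x. \<phi> x \<partial>\<mu>)"
    proof (rule integral_dominated_convergence[where w = "\<lambda>_. C"])
      show "AE x in \<mu>. (\<lambda>n. h n x) \<longlonglongrightarrow> \<phi> x"
        using ae
      proof eventually_elim
        case (elim x)
        then have "f x \<in> A" using A_inv by blast
        obtain m :: nat where m: "- \<phi> x < real m" using reals_Archimedean2 by blast
        obtain k where k: "real m < birkhoff_sum \<phi> k (f x)" using \<open>f x \<in> A\<close> by (auto simp: A_def)
        have "\<forall>\<^sub>F n in sequentially. h n x = \<phi> x"
          using eventually_ge_at_top[of k]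
        proof eventually_elim
          case (elim n)
          from birkhoff_sum_le_max[OF this, of \<phi> "f x"] show ?case
            using m k by (simp add: h_def)
        qed
        then show ?case by (rule tendsto_eventually)
      qed
      show "AE x in \<mu>. norm (h n x) \<le> C" for n
      proof (rule AE_I2)
        fix x show "norm (h n x) \<le> C"
          using C[of x] max_birkhoff_nonneg[of \<phi> n "f x"] C0 by (auto simp: h_def max_def abs_if)
      qed
    qed (auto simp: h_def)
    ultimately have "0 \<le> (\<integral>x. \<phi> x \<partial>\<mu>)"
      by (intro LIMSEQ_le_const) auto
    then show False using neg by simp
  qed
  ultimately have "measure \<mu> A = 0" by blast
  then have "AE x in \<mu>. x \<notin> A"
    by (intro AE_not_in) (auto simp: null_sets_def sets emeasure_eq_measure)
  then show ?thesis by eventually_elim (auto simp: A_def not_less)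
qed

text \<open>Subtracting slightly more than the mean makes the integral negative; the resulting bound
  on the sums of \<open>\<psi>\<close> becomes negligible after division by n.\<close>

lemma AE_birkhoff_upper:
  assumes \<mu>: "\<mu> \<in> ergodic_probs f" and \<phi> [measurable]: "\<phi> \<in> borel_measurable borel"
    and C: "\<And>x. \<bar>\<phi> x\<bar> \<le> C" and e: "e > 0"
  shows "AE x in \<mu>. \<forall>\<^sub>F n in sequentially. birkhoff_sum \<phi> n x / real n < (\<integral>x. \<phi> x \<partial>\<mu>) + e"
proof -
  note inv = ergodic_probsD(1)[OF \<mu>] and sets [measurable_cong] = ergodic_probsD(4)[OF \<mu>]
  interpret prob_space \<mu> by (rule ergodic_probsD(3)[OF \<mu>])
  define I where "I = (\<integral>x. \<phi> x \<partial>\<mu>)"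
  define \<psi> where "\<psi> x = \<phi> x - (I + e / 2)" for x
  have int: "integrable \<mu> \<phi>" by (rule integrable_const_bound[where B = C]) (use C in auto)
  have "AE x in \<mu>. \<exists>B. \<forall>n. birkhoff_sum \<psi> n x \<le> B"
  proof (rule AE_birkhoff_sum_bounded[OF \<mu>])
    show "\<psi> \<in> borel_measurable borel" unfolding \<psi>_def by measurable
    show "\<bar>\<psi> x\<bar> \<le> C + \<bar>I + e / 2\<bar>" for x
      using C[of x] unfolding \<psi>_def by linarith
    have "(\<integral>x. \<psi> x \<partial>\<mu>) = I - (I + e / 2)"
      unfolding \<psi>_def using int by (simp add: I_def prob_space)
    then show "(\<integral>x. \<psi> x \<partial>\<mu>) < 0" using e by simp
  qed
  then show ?thesis
  proof eventually_elim
    case (elim x)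
    then obtain B where B: "\<And>n. birkhoff_sum \<psi> n x \<le> B" by blast
    have "(\<lambda>n. B / real n) \<longlonglongrightarrow> 0" by (rule lim_const_over_n)
    then have "\<forall>\<^sub>F n in sequentially. B / real n < e / 2" using e by (intro order_tendstoD(2)) auto
    then show ?case
      using eventually_ge_at_top[of 1]
    proof eventually_elim
      case (elim n)
      have "birkhoff_sum \<psi> n x = birkhoff_sum \<phi> n x - real n * (I + e / 2)"
        by (simp add: birkhoff_sum_def \<psi>_def sum_subtractf)
      then have "birkhoff_sum \<phi> n x / real n \<le> (B + real n * (I + e / 2)) / real n"
        using B[of n] by (intro divide_right_mono) auto
      also have "\<dots> = B / real n + (I + e / 2)" using elim(2) by (simp add: add_divide_distrib)
      also have "\<dots> < I + e" using elim(1) by linarith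
      finally show ?case by (simp add: I_def)
    qed
  qed
qed

text \<open>The one-sided estimate is used for \<phi> and - \<phi>, with the countably many errors 1
  / (k + 1) so that one null set suffices.\<close>

lemma AE_birkhoff:
  assumes \<mu>: "\<mu> \<in> ergodic_probs f" and \<phi> [measurable]: "\<phi> \<in> borel_measurable borel"
    and C: "\<And>x. \<bar>\<phi> x\<bar> \<le> C"
  shows "AE x in \<mu>. (\<lambda>n. birkhoff_sum \<phi> n x / real n) \<longlonglongrightarrow> (\<integral>x. \<phi> x \<partial>\<mu>)"
proof -
  have "AE x in \<mu>. \<forall>k::nat. \<forall>\<^sub>F n in sequentially.
      birkhoff_sum \<phi> n x / real n < (\<integral>x. \<phi> x \<partial>\<mu>) + 1 / real (Suc k)"
    unfolding AE_all_countable by (intro allI AE_birkhoff_upper[OF \<mu> \<phi> C]) simp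
  moreover have "AE x in \<mu>. \<forall>k::nat. \<forall>\<^sub>F n in sequentially.
      birkhoff_sum (\<lambda>x. - \<phi> x) n x / real n < (\<integral>x. - \<phi> x \<partial>\<mu>) + 1 / real (Suc k)"
    unfolding AE_all_countable by (intro allI AE_birkhoff_upper[OF \<mu>, where C = C]) (use C in auto)
  ultimately show ?thesis
  proof eventually_elim
    case (elim x)
    show ?case
    proof (rule tendstoI)
      fix e :: real assume "e > 0"
      then obtain k where k: "1 / real (Suc k) < e"
        using reals_Archimedean by (auto simp: inverse_eq_divide)
      show "\<forall>\<^sub>F n in sequentially. dist (birkhoff_sum \<phi> n x / real n) (\<integral>x. \<phi> x \<partial>\<mu>) < e"
        using elim(1)[rule_format, of k] elim(2)[rule_format, of k]
      proof eventually_elim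
        case (elim n)
        have "birkhoff_sum (\<lambda>x. - \<phi> x) n x / real n = - (birkhoff_sum \<phi> n x / real n)"
          by (simp add: birkhoff_sum_def sum_negf)
        then show ?case using elim k by (simp add: dist_real_def abs_less_iff)
      qed
    qed
  qed
qed

text \<open>Birkhoff averages of the indicators of finite partitions of arbitrarily small mesh
  determine those of all continuous functions, so no separability of \<open>C(X)\<close> is needed.\<close>

lemma AE_generic:
  assumes \<mu>: "\<mu> \<in> ergodic_probs f"
  shows "AE x in \<mu>. x \<in> generic_points f \<mu>"
proof -
  note inv = ergodic_probsD(1)[OF \<mu>] and sets [measurable_cong] = ergodic_probsD(4)[OF \<mu>]
  interpret prob_space \<mu> by (rule ergodic_probsD(3)[OF \<mu>])
  have "\<exists>K z q. q \<in> borel \<rightarrow>\<^sub>M count_space UNIV \<and> (\<forall>x::'a. q x < (K::nat)) \<and>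
      (\<forall>x. dist x (z (q x) :: 'a) < 1 / real (Suc k))" for k
    using finite_partition[of "1 / real (Suc k)"] by (metis of_nat_0_less_iff zero_less_Suc zero_less_divide_1_iff)
  then obtain K :: "nat \<Rightarrow> nat" and z :: "nat \<Rightarrow> nat \<Rightarrow> 'a" and q :: "nat \<Rightarrow> 'a \<Rightarrow> nat"
    where q [measurable]: "\<And>k. q k \<in> borel \<rightarrow>\<^sub>M count_space UNIV"
      and qK: "\<And>k x. q k x < K k" and qz: "\<And>k x. dist x (z k (q k x)) < 1 / real (Suc k)"
    by metis
  define ind where "ind k i x = (indicator {x. q k x = i} x :: real)" for k i x
  have [measurable]: "ind k i \<in> borel_measurable borel" for k i unfolding ind_def by measurable
  have ind1: "\<bar>ind k i x\<bar> \<le> 1" for k i x by (simp add: ind_def indicator_def)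
  have int_ind: "integrable \<mu> (ind k i)" for k i
    by (rule integrable_const_bound[where B = 1]) (use ind1 in auto)
  have "AE x in \<mu>. \<forall>k i. (\<lambda>n. birkhoff_sum (ind k i) n x / real n) \<longlonglongrightarrow> (\<integral>x. ind k i x \<partial>\<mu>)"
    unfolding AE_all_countable by (intro allI AE_birkhoff[OF \<mu> _ ind1]) simp
  then show ?thesis
  proof eventually_elim
    case (elim x)
    show ?case unfolding generic_points_def
    proof (rule CollectI, intro allI impI)
      fix \<phi> :: "'a \<Rightarrow> real" assume cont: "continuous_on UNIV \<phi>"
      have [measurable]: "\<phi> \<in> borel_measurable borel" by (rule borel_measurable_continuous_onI[OF cont])
      obtain B where B: "\<And>x. \<bar>\<phi> x\<bar> \<le> B" using bounded_continuous[OF cont] by blast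
      have int: "integrable \<mu> \<phi>" by (rule integrable_const_bound[where B = B]) (use B in auto)
      have "(\<lambda>n. birkhoff_sum \<phi> n x / real n) \<longlonglongrightarrow> (\<integral>y. \<phi> y \<partial>\<mu>)"
      proof (rule tendstoI)
        fix e :: real assume e: "e > 0"
        have "uniformly_continuous_on UNIV \<phi>"
          using compact_uniformly_continuous[OF cont compact_space] .
        then obtain d where d: "d > 0" "\<And>x y. dist x y < d \<Longrightarrow> dist (\<phi> x) (\<phi> y) < e / 3"
          unfolding uniformly_continuous_on_def using e by (metis UNIV_I divide_pos_pos zero_less_numeral)
        obtain k where k: "1 / real (Suc k) < d"
          using reals_Archimedean[OF d(1)] by (auto simp: inverse_eq_divide)
        \<comment> \<open>This step function is within e / 3 of \<phi> everywhere, so its averages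
          and its integral are within e / 3 of those of \<phi>; its own averages converge by the
          choice of x.\<close>
        define \<psi> where "\<psi> y = (\<Sum>i<K k. \<phi> (z k i) * ind k i y)" for y
        have \<psi>_eq: "\<psi> y = \<phi> (z k (q k y))" for y
        proof -
          have "\<psi> y = (\<Sum>i<K k. if i = q k y then \<phi> (z k i) else 0)"
            unfolding \<psi>_def ind_def by (intro sum.cong) auto
          then show ?thesis using qK by simp
        qed
        have close: "\<bar>\<phi> y - \<psi> y\<bar> \<le> e / 3" for y
          using d(2)[of y "z k (q k y)"] qz[of y k] k unfolding \<psi>_eq dist_real_def by linarith
        have int\<psi>: "integrable \<mu> \<psi>" unfolding \<psi>_def by (intro Bochner_Integration.integrable_sum integrable_mult_right int_ind)
        have "(\<lambda>n. \<Sum>i<K k. \<phi> (z k i) * (birkhoff_sum (ind k i) n x / real n))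
            \<longlonglongrightarrow> (\<Sum>i<K k. \<phi> (z k i) * (\<integral>x. ind k i x \<partial>\<mu>))"
          using elim by (intro tendsto_sum tendsto_mult_left) blast
        also have "(\<lambda>n. \<Sum>i<K k. \<phi> (z k i) * (birkhoff_sum (ind k i) n x / real n)) =
            (\<lambda>n. birkhoff_sum \<psi> n x / real n)"
        proof
          fix n
          have "birkhoff_sum \<psi> n x = (\<Sum>i<K k. \<phi> (z k i) * birkhoff_sum (ind k i) n x)"
            unfolding birkhoff_sum_def \<psi>_def sum_distrib_left by (rule sum.swap)
          then show "(\<Sum>i<K k. \<phi> (z k i) * (birkhoff_sum (ind k i) n x / real n)) = birkhoff_sum \<psi> n x / real n"
            by (simp add: sum_divide_distrib)
        qed
        also have "(\<Sum>i<K k. \<phi> (z k i) * (\<integral>x. ind k i x \<partial>\<mu>)) = (\<integral>x. \<psi> x \<partial>\<mu>)"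
          unfolding \<psi>_def by (simp add: int_ind Bochner_Integration.integral_sum)
        finally have "\<forall>\<^sub>F n in sequentially. dist (birkhoff_sum \<psi> n x / real n) (\<integral>x. \<psi> x \<partial>\<mu>) < e / 3"
          using e by (intro tendstoD) auto
        then show "\<forall>\<^sub>F n in sequentially. dist (birkhoff_sum \<phi> n x / real n) (\<integral>y. \<phi> y \<partial>\<mu>) < e"
          using eventually_ge_at_top[of 1]
        proof eventually_elim
          case (elim n)
          have "\<bar>birkhoff_sum \<phi> n x - birkhoff_sum \<psi> n x\<bar> \<le> (\<Sum>j<n. \<bar>\<phi> ((f ^^ j) x) - \<psi> ((f ^^ j) x)\<bar>)"
            unfolding birkhoff_sum_def by (simp add: sum_subtractf[symmetric] sum_abs)
          also have "\<dots> \<le> (\<Sum>j<n. e / 3)" by (intro sum_mono close)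
          finally have "\<bar>birkhoff_sum \<phi> n x - birkhoff_sum \<psi> n x\<bar> / real n \<le> e / 3"
            using elim(2) by (simp add: divide_le_eq mult.commute)
          then have "\<bar>birkhoff_sum \<phi> n x / real n - birkhoff_sum \<psi> n x / real n\<bar> \<le> e / 3"
            by (simp add: diff_divide_distrib[symmetric])
          moreover have "\<bar>(\<integral>y. \<phi> y \<partial>\<mu>) - (\<integral>y. \<psi> y \<partial>\<mu>)\<bar> \<le> e / 3"
          proof -
            have "\<bar>\<integral>y. \<phi> y - \<psi> y \<partial>\<mu>\<bar> \<le> (\<integral>y. \<bar>\<phi> y - \<psi> y\<bar> \<partial>\<mu>)"
              using integral_norm_bound[of \<mu> "\<lambda>y. \<phi> y - \<psi> y"] by simp
            also have "\<dots> \<le> (\<integral>y. e / 3 \<partial>\<mu>)"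
              using int int\<psi> close by (intro integral_mono) auto
            finally show ?thesis using int int\<psi> by (simp add: prob_space)
          qed
          ultimately show ?case using elim(1) unfolding dist_real_def by linarith
        qed
      qed
      then show "(\<lambda>n. 1 / real n * (\<Sum>j<n. \<phi> ((f ^^ j) x))) \<longlonglongrightarrow> (\<integral>y. \<phi> y \<partial>\<mu>)"
        by (simp add: birkhoff_sum_def)
    qed
  qed
qed

text \<open>\<open>lower_BK_le_bowen_mdim_at\<close> asks for a Borel set of full measure; finding
  one inside the generic points leaves their own measurability unsettled.\<close>

lemma generic_points_core:
  assumes \<mu>: "\<mu> \<in> ergodic_probs f"
  obtains Y where "Y \<in> sets borel" "measure \<mu> Y = 1" "Y \<subseteq> generic_points f \<mu>"
proof -
  note sets [measurable_cong] = ergodic_probsD(4)[OF \<mu>]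
  interpret prob_space \<mu> by (rule ergodic_probsD(3)[OF \<mu>])
  obtain N where N: "N \<in> null_sets \<mu>" "{x \<in> space \<mu>. x \<notin> generic_points f \<mu>} \<subseteq> N"
    using AE_generic[OF \<mu>] by (auto elim!: AE_E intro: null_setsI)
  show ?thesis
  proof (rule that[of "space \<mu> - N"])
    show "space \<mu> - N \<in> sets borel" using N(1) by (auto simp: sets[symmetric])
    show "measure \<mu> (space \<mu> - N) = 1"
      using N(1) by (subst prob_compl) (auto simp: measure_eq_0_null_sets)
    show "space \<mu> - N \<subseteq> generic_points f \<mu>" using N(2) by auto
  qed
qed

text \<open>Flattens countably many finite covers, one for each p, into the single family over the
  naturals that \<open>bowen_cover_sum\<close> expects.\<close>

lemma bowen_cover_sum_le:
  fixes m :: "nat \<Rightarrow> nat" and E :: "nat \<Rightarrow> 'a set"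
  assumes N: "\<And>p. N \<le> m p" and cover: "Z \<subseteq> (\<Union>p. \<Union>x\<in>E p. bowen_ball f (m p) x \<epsilon>)"
    and fin: "\<And>p. finite (E p)"
    and bound: "\<And>P. (\<Sum>p<P. real (card (E p)) * exp (- (real (m p) * t))) \<le> \<eta>"
  shows "bowen_cover_sum f Z t N \<epsilon> \<le> ennreal \<eta>"
proof -
  have "\<exists>xs. set xs = E p \<and> length xs = card (E p)" for p
    using finite_distinct_list[OF fin[of p]] by (metis distinct_card)
  then obtain xs where xs: "\<And>p. set (xs p) = E p" "\<And>p. length (xs p) = card (E p)" by metis
  define I where "I = prod_encode ` (SIGMA p:UNIV. {..<card (E p)})"
  define m' where "m' i = m (fst (prod_decode i))" for i
  define x' where "x' i = xs (fst (prod_decode i)) ! snd (prod_decode i)" for i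
  have cov: "Z \<subseteq> (\<Union>i\<in>I. bowen_ball f (m' i) (x' i) \<epsilon>)"
  proof
    fix y assume "y \<in> Z"
    then obtain p x where px: "x \<in> E p" "y \<in> bowen_ball f (m p) x \<epsilon>" using cover by blast
    then obtain i where "i < card (E p)" "x = xs p ! i" using xs by (metis in_set_conv_nth)
    moreover from this have "prod_encode (p, i) \<in> I" by (auto simp: I_def)
    ultimately show "y \<in> (\<Union>i\<in>I. bowen_ball f (m' i) (x' i) \<epsilon>)"
      using px(2) by (intro UN_I[of "prod_encode (p, i)"]) (simp_all add: m'_def x'_def)
  qed
  have "bowen_cover_sum f Z t N \<epsilon> \<le> (\<Sum>\<^sub>\<infinity>i\<in>I. ennreal (exp (- (real (m' i) * t))))"
    unfolding bowen_cover_sum_def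
    by (rule Inf_lower, rule CollectI, rule exI[of _ I], rule exI[of _ m'], rule exI[of _ x'])
       (use cov N in \<open>auto simp: m'_def\<close>)
  also have "\<dots> \<le> ennreal \<eta>"
  proof (rule infsum_le_finite_sums)
    fix J assume J: "finite J" "J \<subseteq> I"
    \<comment> \<open>A finite set of indices meets only rows p < P, so \<open>bound\<close>
      controls every finite partial sum.\<close>
    define P where "P = Suc (Max (insert 0 ((fst \<circ> prod_decode) ` J)))"
    define S where "S = (SIGMA p:{..<P}. {..<card (E p)})"
    have sub: "J \<subseteq> prod_encode ` S"
    proof
      fix i assume i: "i \<in> J"
      then obtain p k where pk: "i = prod_encode (p, k)" "k < card (E p)" using J(2) by (auto simp: I_def)
      have "p \<in> insert 0 ((fst \<circ> prod_decode) ` J)" using i pk(1) by force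
      then have "p < P" using J(1) by (simp add: P_def less_Suc_eq_le del: insert_iff)
      then show "i \<in> prod_encode ` S" using pk by (auto simp: S_def)
    qed
    have "(\<Sum>i\<in>J. ennreal (exp (- (real (m' i) * t)))) \<le> (\<Sum>i\<in>prod_encode ` S. ennreal (exp (- (real (m' i) * t))))"
      using sub by (intro sum_mono2) (auto simp: S_def)
    also have "\<dots> = (\<Sum>(p, k)\<in>S. ennreal (exp (- (real (m p) * t))))"
      by (subst sum.reindex) (auto simp: m'_def inj_prod_encode split_beta)
    also have "\<dots> = ennreal (\<Sum>(p, k)\<in>S. exp (- (real (m p) * t)))"
      by (simp add: split_beta sum_ennreal)
    also have "(\<Sum>(p, k)\<in>S. exp (- (real (m p) * t))) = (\<Sum>p<P. \<Sum>k<card (E p). exp (- (real (m p) * t)))"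
      unfolding S_def by (subst sum.Sigma) auto
    also have "\<dots> \<le> \<eta>" using bound[of P] by simp
    finally show "(\<Sum>i\<in>J. ennreal (exp (- (real (m' i) * t)))) \<le> ennreal \<eta>" by (simp add: ennreal_leI)
  qed (simp add: nonneg_summable_on_complete)
  finally show ?thesis .
qed

text \<open>Convergence of averages settles the subbasic sets. Being entered eventually passes to
  finite intersections and to unions, so induction over \<open>generate_topology_on\<close> reaches
  all weak* open sets.\<close>

lemma eventually_empirical_in_nhd:
  assumes x: "x \<in> generic_points f \<mu>" and F: "F \<in> weak_star_nhds \<mu>"
  shows "\<forall>\<^sub>F n in sequentially. empirical f n x \<in> F"
proof -
  obtain U where U: "openin weak_star U" "\<mu> \<in> U" "U \<subseteq> F" using F by (auto simp: weak_star_nhds_def)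
  have avg: "(\<lambda>n. (\<Sum>j=1..n. \<phi> ((f ^^ j) x)) / real n) \<longlonglongrightarrow> (\<integral>y. \<phi> y \<partial>\<mu>)"
    if cont: "continuous_on UNIV \<phi>" for \<phi> :: "'a \<Rightarrow> real"
  proof -
    obtain B where B: "\<And>x. \<bar>\<phi> x\<bar> \<le> B" using bounded_continuous[OF cont] by blast
    \<comment> \<open>\<open>generic_points\<close> averages over times 0 to n - 1 and
      \<open>empirical\<close> over times 1 to n; the two differ by this boundary term.\<close>
    have "(\<lambda>n. (\<phi> ((f ^^ n) x) - \<phi> x) / real n) \<longlonglongrightarrow> 0"
    proof (rule Lim_null_comparison)
      show "\<forall>\<^sub>F n in sequentially. norm ((\<phi> ((f ^^ n) x) - \<phi> x) / real n) \<le> 2 * B / real n"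
      proof (intro always_eventually allI)
        fix n
        have "\<bar>\<phi> ((f ^^ n) x) - \<phi> x\<bar> \<le> 2 * B" using B[of x] B[of "(f ^^ n) x"] by linarith
        then show "norm ((\<phi> ((f ^^ n) x) - \<phi> x) / real n) \<le> 2 * B / real n"
          by (simp add: divide_right_mono)
      qed
      show "(\<lambda>n. 2 * B / real n) \<longlonglongrightarrow> 0" by (rule lim_const_over_n)
    qed
    moreover have "(\<lambda>n. (1 / real n) * (\<Sum>j<n. \<phi> ((f ^^ j) x))) \<longlonglongrightarrow> (\<integral>y. \<phi> y \<partial>\<mu>)"
      using x cont by (auto simp: generic_points_def)
    ultimately have "(\<lambda>n. (\<phi> ((f ^^ n) x) - \<phi> x) / real n + (1 / real n) * (\<Sum>j<n. \<phi> ((f ^^ j) x)))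
        \<longlonglongrightarrow> 0 + (\<integral>y. \<phi> y \<partial>\<mu>)" by (rule tendsto_add)
    moreover have "(\<phi> ((f ^^ n) x) - \<phi> x) / real n + (1 / real n) * (\<Sum>j<n. \<phi> ((f ^^ j) x))
        = (\<Sum>j=1..n. \<phi> ((f ^^ j) x)) / real n" for n
    proof -
      have "(\<Sum>j=1..n. \<phi> ((f ^^ j) x)) = \<phi> ((f ^^ n) x) - \<phi> x + (\<Sum>j<n. \<phi> ((f ^^ j) x))"
        by (induction n) auto
      then show ?thesis by (simp add: add_divide_distrib diff_divide_distrib)
    qed
    ultimately show ?thesis by simp
  qed
  have "generate_topology_on {{\<nu> \<in> borel_probs. (\<integral>x. \<phi> x \<partial>\<nu>) \<in> U} |(\<phi> :: 'a \<Rightarrow> real) (U :: real set).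
        continuous_on UNIV \<phi> \<and> open U} U"
    using U(1) unfolding weak_star_def openin_topology_generated_by_iff .
  then have "\<mu> \<in> U \<longrightarrow> (\<forall>\<^sub>F n in sequentially. empirical f n x \<in> U)"
  proof (induction rule: generate_topology_on.induct)
    case (Int a b)
    then show ?case by (auto intro: eventually_conj)
  next
    case (UN K)
    show ?case
    proof
      assume "\<mu> \<in> \<Union>K"
      then obtain k where k: "k \<in> K" "\<mu> \<in> k" by blast
      then have "\<forall>\<^sub>F n in sequentially. empirical f n x \<in> k" using UN(2) by blast
      then show "\<forall>\<^sub>F n in sequentially. empirical f n x \<in> \<Union>K"
        by eventually_elim (use k in blast)
    qed
  next
    case (Basis s)
    then obtain \<phi> :: "'a \<Rightarrow> real" and V :: "real set" where s: "s = {\<nu> \<in> borel_probs. (\<integral>x. \<phi> x \<partial>\<nu>) \<in> V}"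
      "continuous_on UNIV \<phi>" "open V" by blast
    show ?case
    proof
      assume "\<mu> \<in> s"
      then have "\<forall>\<^sub>F n in sequentially. (\<Sum>j=1..n. \<phi> ((f ^^ j) x)) / real n \<in> V"
        using s by (intro topological_tendstoD[OF avg]) auto
      then show "\<forall>\<^sub>F n in sequentially. empirical f n x \<in> s"
        using eventually_ge_at_top[of 1]
        by eventually_elim
           (simp add: s empirical_in_borel_probs integral_empirical borel_measurable_continuous_onI)
    qed
  qed simp
  then have "\<forall>\<^sub>F n in sequentially. empirical f n x \<in> U" using U(2) by blast
  then show ?thesis by eventually_elim (use U(3) in blast)
qed

text \<open>The generic points lie in the union of the sets \<open>G p\<close> of points whose
  empirical measures stay in F from time p on. For all large n, \<open>G p\<close> is covered by at
  most exp (n a') balls of length n, and a' < a makes their cost as small as desired. Bowen covers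
  may use a different length for each p.\<close>

lemma bowen_mdim_at_generic_le_PS_entropy:
  assumes \<epsilon>: "\<epsilon> > 0"
  shows "bowen_mdim_at f (generic_points f \<mu>) \<epsilon> \<le> PS_entropy f \<mu> \<epsilon>"
proof (rule ereal_le_real_gtI)
  fix a :: real assume "PS_entropy f \<mu> \<epsilon> < ereal a"
  then obtain F where F: "F \<in> weak_star_nhds \<mu>"
    "limsup (\<lambda>n. ereal (1 / real n) * xln (real (sep_number f n \<epsilon> {x. empirical f n x \<in> F}))) < ereal a"
    unfolding PS_entropy_def by (auto simp: INF_less_iff)
  obtain a' :: real where a':
    "limsup (\<lambda>n. ereal (1 / real n) * xln (real (sep_number f n \<epsilon> {x. empirical f n x \<in> F}))) < ereal a'" "a' < a"
    using ereal_dense2[OF F(2)] by auto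
  define X where "X n = {x. empirical f n x \<in> F}" for n
  from Limsup_lessD[OF a'(1)]
  have ev: "\<forall>\<^sub>F n in sequentially. real (sep_number f n \<epsilon> (X n)) \<le> exp (real n * a')"
    using eventually_ge_at_top[of 1] unfolding X_def by eventually_elim (rule le_exp_of_xln_rate)
  define G where "G p = {x. \<forall>n\<ge>p. empirical f n x \<in> F}" for p
  have G: "generic_points f \<mu> \<subseteq> (\<Union>p. G p)"
    using eventually_empirical_in_nhd[OF _ F(1)] by (force simp: G_def eventually_sequentially)
  have "bowen_cover_sum f (generic_points f \<mu>) a N \<epsilon> \<le> ennreal \<eta>" if \<eta>: "\<eta> > 0" for N \<eta>
  proof -
    \<comment> \<open>The allowances \<eta> / 2 ^ (p + 1) add up to at most \<eta> over all
      p.\<close>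
    have "\<exists>n E. n \<ge> N \<and> finite E \<and> G p \<subseteq> (\<Union>x\<in>E. bowen_ball f n x \<epsilon>) \<and>
        real (card E) * exp (- (real n * a)) \<le> \<eta> * (1 / 2) ^ Suc p" for p
    proof -
      have "(\<lambda>n. exp (a' - a) ^ n) \<longlonglongrightarrow> 0" using a'(2) by (intro LIMSEQ_realpow_zero) auto
      then have "\<forall>\<^sub>F n in sequentially. exp (a' - a) ^ n < \<eta> * (1 / 2) ^ Suc p"
        using \<eta> by (intro order_tendstoD(2)) auto
      then have "\<forall>\<^sub>F n in sequentially. n \<ge> 1 \<and> n \<ge> N \<and> n \<ge> p \<and> real (sep_number f n \<epsilon> (X n)) \<le> exp (real n * a')
          \<and> exp (a' - a) ^ n < \<eta> * (1 / 2) ^ Suc p"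
        using ev eventually_ge_at_top[of 1] eventually_ge_at_top[of N] eventually_ge_at_top[of p]
        by eventually_elim simp
      then obtain n where n: "n \<ge> 1" "n \<ge> N" "n \<ge> p" "real (sep_number f n \<epsilon> (X n)) \<le> exp (real n * a')"
        "exp (a' - a) ^ n < \<eta> * (1 / 2) ^ Suc p"
        using eventually_happens'[OF sequentially_bot] by blast
      obtain E where E: "finite E" "card E = sep_number f n \<epsilon> (X n)" "X n \<subseteq> (\<Union>x\<in>E. bowen_ball f n x \<epsilon>)"
        using sep_number_attained[OF n(1) \<epsilon>] by metis
      have "real (card E) * exp (- (real n * a)) \<le> exp (real n * a') * exp (- (real n * a))"
        using n(4) E(2) by (intro mult_right_mono) auto
      also have "\<dots> = exp (a' - a) ^ n" by (simp flip: exp_add exp_of_nat_mult add: algebra_simps)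
      finally have "real (card E) * exp (- (real n * a)) \<le> \<eta> * (1 / 2) ^ Suc p" using n(5) by simp
      moreover have "G p \<subseteq> X n" using n(3) by (auto simp: G_def X_def)
      ultimately show ?thesis using n(2) E by blast
    qed
    then obtain m E where mE: "\<And>p. m p \<ge> N" "\<And>p. finite (E p)" "\<And>p. G p \<subseteq> (\<Union>x\<in>E p. bowen_ball f (m p) x \<epsilon>)"
      "\<And>p. real (card (E p)) * exp (- (real (m p) * a)) \<le> \<eta> * (1 / 2) ^ Suc p"
      by metis
    show ?thesis
    proof (rule bowen_cover_sum_le[where m = m and E = E])
      show "generic_points f \<mu> \<subseteq> (\<Union>p. \<Union>x\<in>E p. bowen_ball f (m p) x \<epsilon>)"
        using G mE(3) by (meson UN_mono order_refl order_trans)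
      fix P
      have "(\<Sum>p<P. real (card (E p)) * exp (- (real (m p) * a))) \<le> (\<Sum>p<P. \<eta> * (1 / 2) ^ Suc p)"
        by (intro sum_mono mE(4))
      also have "\<dots> = \<eta> * (1 - (1 / 2) ^ P)"
        by (induction P) (simp_all add: field_simps)
      also have "\<dots> \<le> \<eta>" using \<eta> by (simp add: algebra_simps)
      finally show "(\<Sum>p<P. real (card (E p)) * exp (- (real (m p) * a))) \<le> \<eta>" .
    qed (simp_all add: mE(1,2))
  qed
  note small = this
  have "bowen_cover_sum f (generic_points f \<mu>) a N \<epsilon> \<le> 0" for N
    by (rule ennreal_le_epsilon) (use small in simp)
  then have "bowen_outer f (generic_points f \<mu>) a \<epsilon> = 0" by (simp add: bowen_outer_eq_SUP)
  then show "bowen_mdim_at f (generic_points f \<mu>) \<epsilon> \<le> ereal a"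
    unfolding bowen_mdim_at_def by (intro Inf_lower) blast
qed

end

section \<open>Mutual information of finite-valued variables\<close>

context prob_space
begin

text \<open>Point masses presented as a density, the form in which
  \<open>mutual_information_distr\<close> takes its inputs.\<close>

lemma distributed_finite:
  assumes S: "finite S" and X: "X \<in> measurable M (count_space S)"
  shows "distributed M (count_space S) X (\<lambda>a. ennreal (prob (X -` {a} \<inter> space M)))"
  unfolding distributed_def
proof (intro conjI X)
  show "distr M (count_space S) X = density (count_space S) (\<lambda>a. ennreal (prob (X -` {a} \<inter> space M)))"
  proof (rule measure_eqI_finite)
    fix a assume a: "a \<in> S"
    have "emeasure (density (count_space S) (\<lambda>a. ennreal (prob (X -` {a} \<inter> space M)))) {a}
        = (\<integral>\<^sup>+y. ennreal (prob (X -` {y} \<inter> space M)) * indicator {a} y \<partial>count_space S)"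
      using a by (intro emeasure_density) auto
    also have "\<dots> = (\<Sum>y\<in>S. ennreal (prob (X -` {y} \<inter> space M)) * indicator {a} y)"
      by (rule nn_integral_count_space_finite[OF S])
    also have "\<dots> = (\<Sum>y\<in>S. if y = a then ennreal (prob (X -` {y} \<inter> space M)) else 0)"
      by (intro sum.cong) auto
    also have "\<dots> = ennreal (prob (X -` {a} \<inter> space M))"
      using a by (simp only: sum.delta[OF S] if_True)
    finally show "emeasure (distr M (count_space S) X) {a} =
        emeasure (density (count_space S) (\<lambda>a. ennreal (prob (X -` {a} \<inter> space M)))) {a}"
      using a X by (simp add: emeasure_distr emeasure_eq_measure)
  qed (simp_all add: S)
qed simp

context
  fixes A :: "'a \<Rightarrow> nat" and B :: "'a \<Rightarrow> nat" and k l :: nat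
  assumes A: "A \<in> measurable M (count_space {..<k})" and B: "B \<in> measurable M (count_space {..<l})"
begin

definition joint_event :: "nat \<Rightarrow> nat \<Rightarrow> 'a set" where
  "joint_event a b = (\<lambda>x. (A x, B x)) -` {(a, b)} \<inter> space M"
definition pA :: "nat \<Rightarrow> real" where "pA a = prob (A -` {a} \<inter> space M)"
definition pB :: "nat \<Rightarrow> real" where "pB b = prob (B -` {b} \<inter> space M)"
definition pAB :: "nat \<Rightarrow> nat \<Rightarrow> real" where "pAB a b = prob (joint_event a b)"

lemma sets_A: "A -` {a} \<inter> space M \<in> events"
proof (cases "a < k")
  case True
  then show ?thesis using A by (intro measurable_sets) auto
next
  case False
  then have "A -` {a} \<inter> space M = {}" using measurable_space[OF A] by auto
  then show ?thesis by simp
qed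

lemma sets_B: "B -` {b} \<inter> space M \<in> events"
proof (cases "b < l")
  case True
  then show ?thesis using B by (intro measurable_sets) auto
next
  case False
  then have "B -` {b} \<inter> space M = {}" using measurable_space[OF B] by auto
  then show ?thesis by simp
qed

lemma sets_AB: "joint_event a b \<in> events"
proof -
  have "joint_event a b = (A -` {a} \<inter> space M) \<inter> (B -` {b} \<inter> space M)" by (auto simp: joint_event_def)
  then show ?thesis using sets_A sets_B by simp
qed

lemma expectation_finite_pair:
  fixes \<phi> :: "nat \<Rightarrow> nat \<Rightarrow> real"
  shows "expectation (\<lambda>x. \<phi> (A x) (B x)) = (\<Sum>a<k. \<Sum>b<l. pAB a b * \<phi> a b)"
proof -
  have "expectation (\<lambda>x. \<phi> (A x) (B x)) =
      expectation (\<lambda>x. \<Sum>a<k. \<Sum>b<l. \<phi> a b * indicator (joint_event a b) x)"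
  proof (rule Bochner_Integration.integral_cong[OF refl])
    fix x assume x: "x \<in> space M"
    have "A x < k" "B x < l" using x measurable_space[OF A] measurable_space[OF B] by auto
    have "(\<Sum>a<k. \<Sum>b<l. \<phi> a b * indicator (joint_event a b) x)
        = (\<Sum>a<k. \<Sum>b<l. if a = A x then if b = B x then \<phi> a b else 0 else 0)"
      using x by (intro sum.cong) (auto simp: indicator_def joint_event_def)
    also have "\<dots> = (\<Sum>a<k. if a = A x then \<Sum>b<l. if b = B x then \<phi> a b else 0 else 0)"
      by (intro sum.cong) auto
    also have "\<dots> = \<phi> (A x) (B x)" using \<open>A x < k\<close> \<open>B x < l\<close> by (simp add: sum.delta)
    finally show "\<phi> (A x) (B x) = (\<Sum>a<k. \<Sum>b<l. \<phi> a b * indicator (joint_event a b) x)"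
      by simp
  qed
  also have "\<dots> = (\<Sum>a<k. \<Sum>b<l. expectation (\<lambda>x. \<phi> a b * indicator (joint_event a b) x))"
    by (subst Bochner_Integration.integral_sum, (intro Bochner_Integration.integrable_sum integrable_mult_right integrable_real_indicator sets_AB, simp add: emeasure_eq_measure),
        subst Bochner_Integration.integral_sum)
       (auto intro!: integrable_mult_right integrable_real_indicator sets_AB simp: emeasure_eq_measure)
  also have "\<dots> = (\<Sum>a<k. \<Sum>b<l. pAB a b * \<phi> a b)"
    using sets_AB by (simp add: pAB_def mult.commute)
  finally show ?thesis .
qed

lemma sum_pAB: "(\<Sum>a<k. \<Sum>b<l. pAB a b) = 1"
  using expectation_finite_pair[of "\<lambda>_ _. 1"] by (simp add: prob_space)

lemma sum_pAB_fst: "(\<Sum>b<l. pAB a b) = pA a"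
proof -
  have "pA a = prob (\<Union>b<l. joint_event a b)"
    unfolding pA_def using measurable_space[OF B] by (intro arg_cong[of _ _ prob]) (auto simp: joint_event_def)
  also have "\<dots> = (\<Sum>b<l. pAB a b)"
    unfolding pAB_def using sets_AB
    by (intro finite_measure_finite_Union) (auto simp: disjoint_family_on_def joint_event_def)
  finally show ?thesis by simp
qed

lemma sum_pAB_snd: "(\<Sum>a<k. pAB a b) = pB b"
proof -
  have "pB b = prob (\<Union>a<k. joint_event a b)"
    unfolding pB_def using measurable_space[OF A] by (intro arg_cong[of _ _ prob]) (auto simp: joint_event_def)
  also have "\<dots> = (\<Sum>a<k. pAB a b)"
    unfolding pAB_def using sets_AB
    by (intro finite_measure_finite_Union) (auto simp: disjoint_family_on_def joint_event_def)
  finally show ?thesis by simp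
qed

lemma pAB_le: "pAB a b \<le> pA a" "pAB a b \<le> pB b"
  unfolding pA_def pB_def pAB_def using sets_A sets_B by (auto simp: joint_event_def intro!: finite_measure_mono)

lemma pAB_nonneg: "0 \<le> pAB a b" "0 \<le> pA a" "0 \<le> pB b"
  by (simp_all add: pA_def pB_def pAB_def)

lemma sum_pA: "(\<Sum>a<k. pA a) = 1"
  using sum_pAB by (simp add: sum_pAB_fst)

lemma sum_pB: "(\<Sum>b<l. pB b) = 1"
  using sum_pAB by (subst (asm) sum.swap) (simp add: sum_pAB_snd)

abbreviation "info \<equiv> mutual_information (exp 1) (count_space {..<k}) (count_space {..<l}) A B"

lemma mutual_information_finite:
  "info =
     (\<Sum>a<k. \<Sum>b<l. pAB a b * ln (pAB a b / (pA a * pB b)))"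
proof -
  interpret information_space M "exp 1" by standard simp
  have eq: "count_space {..<k} \<Otimes>\<^sub>M count_space {..<l} = count_space ({..<k} \<times> {..<l})"
    by (simp add: pair_measure_count_space)
  have AB: "(\<lambda>x. (A x, B x)) \<in> measurable M (count_space ({..<k} \<times> {..<l}))"
    unfolding eq[symmetric] using A B by (rule measurable_Pair)
  have dAB: "distributed M (count_space {..<k} \<Otimes>\<^sub>M count_space {..<l}) (\<lambda>x. (A x, B x))
      (\<lambda>x. ennreal (case x of (a, b) \<Rightarrow> pAB a b))"
    using distributed_finite[OF _ AB] unfolding eq pAB_def joint_event_def by (simp add: split_beta)
  have "info =
      (\<integral>x. (case x of (a, b) \<Rightarrow> pAB a b) * log (exp 1) ((case x of (a, b) \<Rightarrow> pAB a b) / (pA (fst x) * pB (snd x)))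
        \<partial>(count_space {..<k} \<Otimes>\<^sub>M count_space {..<l}))"
    using distributed_finite[OF _ A] distributed_finite[OF _ B] dAB
    by (intro mutual_information_distr)
       (auto simp: sigma_finite_measure_count_space_finite pAB_nonneg pA_def[symmetric] pB_def[symmetric])
  also have "\<dots> = (\<Sum>x\<in>{..<k} \<times> {..<l}. (case x of (a, b) \<Rightarrow> pAB a b * ln (pAB a b / (pA a * pB b))))"
    unfolding eq by (subst lebesgue_integral_count_space_finite) (auto simp: log_def split_beta)
  finally show ?thesis by (simp add: sum.cartesian_product)
qed

text \<open>Since pAB \<le> pA, each summand is at most pAB ln (1 / pB); comparing pB with the
  uniform law on r values by ln t \<le> t - 1 gives ln r.\<close>

lemma mutual_information_le_ln_card:
  assumes R: "finite R" "\<And>x. x \<in> space M \<Longrightarrow> B x \<in> R" and r: "card R \<le> r"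
  shows "info \<le> ln (real r)"
proof -
  have "R \<noteq> {}" using R(2) not_empty by blast
  then have "card R > 0" using R(1) by (simp add: card_gt_0_iff)
  then have r1: "real r \<ge> 1" using r by simp
  have "pAB a b * ln (pAB a b / (pA a * pB b)) \<le> pAB a b * ln (real r) + pAB a b / (pB b * real r) - pAB a b" for a b
  proof (cases "pAB a b = 0")
    case False
    then have p: "pAB a b > 0" using pAB_nonneg by (simp add: order_less_le)
    then have pos: "pA a > 0" "pB b > 0" using pAB_le[of a b] by linarith+
    have "ln (pAB a b / (pA a * pB b)) = ln (real r) + ln (pAB a b / (pA a * pB b * real r))"
      using p pos r1 by (simp add: ln_div ln_mult)
    also have "ln (pAB a b / (pA a * pB b * real r)) \<le> pAB a b / (pA a * pB b * real r) - 1"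
      using p pos r1 by (intro ln_le_minus_one) simp
    also have "pAB a b / (pA a * pB b * real r) \<le> 1 / (pB b * real r)"
      using p pos r1 pAB_le(1)[of a b] by (simp add: field_simps)
    finally have "pAB a b * ln (pAB a b / (pA a * pB b)) \<le> pAB a b * (ln (real r) + (1 / (pB b * real r) - 1))"
      using p by (intro mult_left_mono) auto
    then show ?thesis by (simp add: algebra_simps)
  qed simp
  then have "info
      \<le> (\<Sum>a<k. \<Sum>b<l. pAB a b * ln (real r) + pAB a b / (pB b * real r) - pAB a b)"
    unfolding mutual_information_finite by (intro sum_mono)
  also have "\<dots> = (\<Sum>a<k. \<Sum>b<l. pAB a b) * ln (real r) + (\<Sum>a<k. \<Sum>b<l. pAB a b / (pB b * real r))
      - (\<Sum>a<k. \<Sum>b<l. pAB a b)"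
    by (simp add: sum.distrib sum_subtractf sum_distrib_right)
  also have "(\<Sum>a<k. \<Sum>b<l. pAB a b / (pB b * real r)) = (\<Sum>b<l. pB b / (pB b * real r))"
    by (subst sum.swap) (simp add: sum_pAB_snd flip: sum_divide_distrib)
  \<comment> \<open>A value b never taken has pB b = 0 and contributes 0 / 0 = 0, so at most card R
    terms 1 / r are left.\<close>
  also have "\<dots> \<le> (\<Sum>b\<in>R. 1 / real r)"
  proof -
    have "pB b = 0" if "b \<notin> R" for b
    proof -
      have "B -` {b} \<inter> space M = {}" using R(2) that by auto
      then show ?thesis by (simp add: pB_def)
    qed
    then have "(\<Sum>b<l. pB b / (pB b * real r)) = (\<Sum>b\<in>{..<l} \<inter> R. pB b / (pB b * real r))"
      by (intro sum.mono_neutral_right) auto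
    also have "\<dots> \<le> (\<Sum>b\<in>{..<l} \<inter> R. 1 / real r)" by (intro sum_mono) auto
    also have "\<dots> \<le> (\<Sum>b\<in>R. 1 / real r)" using R(1) by (intro sum_mono2) auto
    finally show ?thesis .
  qed
  also have "(\<Sum>b\<in>R. 1 / real r) \<le> 1" using r r1 by (simp add: field_simps)
  finally show ?thesis by (simp add: sum_pAB)
qed

text \<open>Gibbs' inequality: the tilted conditional law \<open>pB b exp(- s bad a b) / Z a\<close> is the
  minimiser of information plus \<open>s\<close> times distortion.\<close>

lemma mutual_information_ge_partition_function:
  fixes bad :: "nat \<Rightarrow> nat \<Rightarrow> real" and s :: real
  defines "Z \<equiv> \<lambda>a. \<Sum>b<l. pB b * exp (- s * bad a b)"
  shows "- expectation (\<lambda>x. ln (Z (A x))) \<le>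
    info + s * expectation (\<lambda>x. bad (A x) (B x))"
proof -
  have Z0: "Z a > 0" for a
  proof -
    have "\<exists>b<l. pB b \<noteq> 0"
    proof (rule ccontr)
      assume "\<not> ?thesis"
      then have "(\<Sum>b<l. pB b) = 0" by (intro sum.neutral) auto
      then show False using sum_pB by simp
    qed
    then obtain b where b: "b < l" "pB b > 0" using pAB_nonneg(3) by (auto simp: order_less_le)
    then have "0 < pB b * exp (- s * bad a b)" by simp
    also have "\<dots> \<le> Z a" unfolding Z_def using b pAB_nonneg
      by (intro member_le_sum[of b "{..<l}" "\<lambda>b. pB b * exp (- s * bad a b)"]) auto
    finally show ?thesis .
  qed
  have "- pAB a b * s * bad a b - pAB a b * ln (Z a) + (pAB a b - pA a * (pB b * exp (- s * bad a b)) / Z a)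
      \<le> pAB a b * ln (pAB a b / (pA a * pB b))" for a b
  proof (cases "pAB a b = 0")
    case False
    then have p: "pAB a b > 0" using pAB_nonneg by (simp add: order_less_le)
    then have pos: "pA a > 0" "pB b > 0" using pAB_le[of a b] by linarith+
    \<comment> \<open>t is the quotient of the tilted joint law by the actual one; ln t \<le> t - 1
      is Gibbs' inequality term by term.\<close>
    define t where "t = pA a * pB b * exp (- s * bad a b) / (Z a * pAB a b)"
    have t: "t > 0" unfolding t_def using p pos Z0[of a] by simp
    have "ln t = - ln (pAB a b / (pA a * pB b)) - s * bad a b - ln (Z a)"
      unfolding t_def using p pos Z0[of a] by (simp add: ln_div ln_mult)
    then have "- s * bad a b - ln (Z a) + (1 - t) \<le> ln (pAB a b / (pA a * pB b))"
      using ln_le_minus_one[OF t] by linarith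
    then have "pAB a b * (- s * bad a b - ln (Z a) + (1 - t)) \<le> pAB a b * ln (pAB a b / (pA a * pB b))"
      using p by (intro mult_left_mono) auto
    moreover have "pAB a b * t = pA a * (pB b * exp (- s * bad a b)) / Z a"
      using p by (simp add: t_def)
    ultimately show ?thesis by (simp add: algebra_simps)
  qed (use Z0[of a] pAB_nonneg in simp)
  then have "(\<Sum>a<k. \<Sum>b<l. - pAB a b * s * bad a b - pAB a b * ln (Z a) +
      (pAB a b - pA a * (pB b * exp (- s * bad a b)) / Z a))
      \<le> info"
    unfolding mutual_information_finite by (intro sum_mono)
  moreover have "(\<Sum>a<k. \<Sum>b<l. - pAB a b * s * bad a b - pAB a b * ln (Z a) +
      (pAB a b - pA a * (pB b * exp (- s * bad a b)) / Z a))
    = - s * (\<Sum>a<k. \<Sum>b<l. pAB a b * bad a b) - (\<Sum>a<k. \<Sum>b<l. pAB a b * ln (Z a)) +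
      ((\<Sum>a<k. \<Sum>b<l. pAB a b) - (\<Sum>a<k. \<Sum>b<l. pA a * (pB b * exp (- s * bad a b)) / Z a))"
    by (simp add: sum.distrib sum_subtractf sum_distrib_left sum_negf mult_ac)
  \<comment> \<open>The tilted joint law has total mass 1 like the actual one, so the linear
    corrections cancel.\<close>
  moreover have "(\<Sum>a<k. \<Sum>b<l. pA a * (pB b * exp (- s * bad a b)) / Z a) = 1"
  proof -
    have "(\<Sum>b<l. pA a * (pB b * exp (- s * bad a b)) / Z a) = pA a" for a
    proof -
      have "(\<Sum>b<l. pA a * (pB b * exp (- s * bad a b)) / Z a) = pA a * Z a / Z a"
        unfolding Z_def by (simp add: sum_distrib_left sum_divide_distrib)
      then show ?thesis using Z0[of a] by simp
    qed
    then show ?thesis by (simp add: sum_pA)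
  qed
  ultimately show ?thesis
    using expectation_finite_pair[of bad] expectation_finite_pair[of "\<lambda>a _. ln (Z a)"] sum_pAB by simp
qed

end

end

section \<open>Coding by Bowen balls: the upper bound on rate distortion\<close>

context compact_dynamics
begin

lemma rate_distortion_at_antimono:
  assumes "\<alpha> \<le> \<beta>"
  shows "rate_distortion_at f \<mu> \<epsilon> \<beta> \<le> rate_distortion_at f \<mu> \<epsilon> \<alpha>"
proof -
  have "\<alpha> * real n \<le> \<beta> * real n" for n using assms by (intro mult_right_mono) auto
  then show ?thesis
    unfolding rate_distortion_at_def by (intro Inf_superset_mono) (use order_less_le_trans in blast)
qed

lemma rate_distortion_eq_SUP: "rate_distortion f \<mu> \<epsilon> = (SUP \<alpha>\<in>{0<..}. rate_distortion_at f \<mu> \<epsilon> \<alpha>)"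
  unfolding rate_distortion_def
  by (intro tendsto_Lim tendsto_SUP_at_right_0 rate_distortion_at_antimono) simp_all

text \<open>The code sends the orbit of the centre of the first ball of a Katok cover that contains
  the point. Errors occur only outside the cover, with probability below \<delta> \<le> \<alpha>,
  and the code takes at most card F values, so its information is at most ln (card F).\<close>

lemma rate_distortion_le_upper_katok:
  assumes \<mu>: "\<mu> \<in> borel_probs" and \<epsilon>: "\<epsilon> > 0"
  shows "rate_distortion f \<mu> \<epsilon> \<le> upper_katok f \<mu> \<epsilon>"
proof (rule ereal_le_real_gtI)
  fix c :: real assume c: "upper_katok f \<mu> \<epsilon> < ereal c"
  have pr: "prob_space \<mu>" and sets: "sets \<mu> = sets borel"
    using \<mu> by (auto simp: borel_probs_def)
  interpret prob_space \<mu> by (rule pr)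
  note [measurable_cong] = sets
  note space = borel_probs_space[OF \<mu>]
  show "rate_distortion f \<mu> \<epsilon> \<le> ereal c"
    unfolding rate_distortion_eq_SUP
  proof (rule SUP_least)
    fix \<alpha> :: real assume "\<alpha> \<in> {0<..}"
    \<comment> \<open>\<delta> \<le> 1 makes the cover nonempty, so that index 0 names a
      ball.\<close>
    define \<delta> where "\<delta> = min \<alpha> (1 / 2)"
    have \<delta>: "\<delta> > 0" "\<delta> \<le> 1" "\<delta> \<le> \<alpha>" using \<open>\<alpha> \<in> {0<..}\<close> by (auto simp: \<delta>_def)
    have "\<forall>\<^sub>F n in sequentially. n \<ge> 1 \<and> real (katok_number f \<mu> n \<epsilon> \<delta>) \<le> exp (real n * c)"
      using eventually_katok_number_le[OF \<mu> \<epsilon> \<delta>(1) c] eventually_ge_at_top[of 1] by eventually_elim simp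
    then obtain n where n: "n \<ge> 1" "real (katok_number f \<mu> n \<epsilon> \<delta>) \<le> exp (real n * c)"
      using eventually_happens'[OF sequentially_bot] by blast
    obtain F where F: "finite F" "measure \<mu> (\<Union>x\<in>F. bowen_ball f n x \<epsilon>) > 1 - \<delta>"
      "card F = katok_number f \<mu> n \<epsilon> \<delta>"
      using katok_number_attained[OF \<mu> \<epsilon> \<delta>(1)] .
    obtain xs where xs: "set xs = F" "length xs = card F"
      using finite_distinct_list[OF F(1)] by (metis distinct_card)
    have len: "length xs \<ge> 1" using katok_number_pos[OF \<mu> \<epsilon> \<delta>(1,2)] xs(2) F(3) by simp
    define U where "U = (\<Union>x\<in>F. bowen_ball f n x \<epsilon>)"
    have U [measurable]: "U \<in> sets borel" unfolding U_def by (intro borel_open open_UN ballI open_bowen_ball)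
    \<comment> \<open>Outside U the index defaults to 0; the codeword may then be wrong at all n
      times, but only on a set of measure below \<delta>.\<close>
    define i where "i y = (LEAST i. (y \<in> bowen_ball f n (xs ! i) \<epsilon> \<and> i < length xs) \<or> (y \<notin> U \<and> i = 0))" for y
    have i_prop: "(y \<in> bowen_ball f n (xs ! i y) \<epsilon> \<and> i y < length xs) \<or> (y \<notin> U \<and> i y = 0)" for y
      unfolding i_def
    proof (rule LeastI_ex)
      show "\<exists>i. (y \<in> bowen_ball f n (xs ! i) \<epsilon> \<and> i < length xs) \<or> (y \<notin> U \<and> i = 0)"
      proof (cases "y \<in> U")
        case True
        then obtain x where "x \<in> set xs" "y \<in> bowen_ball f n x \<epsilon>" by (auto simp: U_def xs)
        then show ?thesis by (metis in_set_conv_nth)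
      qed blast
    qed
    have i_lt: "i y < length xs" for y using i_prop[of y] len by auto
    have i_meas [measurable]: "i \<in> borel \<rightarrow>\<^sub>M count_space UNIV"
      unfolding i_def by (rule measurable_Least) measurable
    define w where "w j = (\<lambda>m\<in>{..<n}. (f ^^ m) (xs ! j))" for j
    define g where "g y = w (i y)" for y
    \<comment> \<open>Sample points must have the type
      \<open>'a \<times> (nat \<Rightarrow> 'a)\<close>. \<mu> is carried there by an arbitrary
      embedding, and events depend on the first coordinate only, as both variables do.\<close>
    define P where "P = distr \<mu> (vimage_algebra UNIV fst borel) (\<lambda>x. (x, \<lambda>_::nat. x))"
    have emb: "(\<lambda>x. (x, \<lambda>_::nat. x)) \<in> \<mu> \<rightarrow>\<^sub>M vimage_algebra UNIV fst borel"
      by (intro measurable_vimage_algebra2) (auto simp: measurable_cong_sets[OF sets refl])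
    have prP: "prob_space P" unfolding P_def by (rule prob_space_distr[OF emb])
    have fst_meas: "fst \<in> P \<rightarrow>\<^sub>M borel"
      unfolding P_def measurable_distr_eq1 by (rule measurable_vimage_algebra1) simp
    have distr_fst: "distr P borel fst = \<mu>"
    proof -
      have "distr P borel fst = distr \<mu> borel (fst \<circ> (\<lambda>x. (x, \<lambda>_::nat. x)))"
        unfolding P_def using fst_meas emb unfolding P_def measurable_distr_eq1 by (rule distr_distr)
      also have "\<dots> = distr \<mu> borel (\<lambda>x. x)" by (simp add: comp_def)
      finally show ?thesis using sets by (simp add: distr_id2)
    qed
    have w_space: "w j \<in> space (\<Pi>\<^sub>M m\<in>{..<n}. borel)" for j
      by (simp add: space_PiM w_def)
    have g_meas: "g \<in> borel \<rightarrow>\<^sub>M (\<Pi>\<^sub>M m\<in>{..<n}. borel)"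
      unfolding g_def by (rule measurable_compose[OF i_meas]) (use w_space in auto)
    have eta_meas: "(\<lambda>\<omega>. g (fst \<omega>)) \<in> P \<rightarrow>\<^sub>M (\<Pi>\<^sub>M m\<in>{..<n}. borel)"
      by (rule measurable_compose[OF fst_meas g_meas])
    define dist_count where "dist_count x = real (card {k\<in>{..<n}. \<epsilon> \<le> dist ((f ^^ k) x) (g x k)})" for x
    have count_le: "dist_count x \<le> real n * indicator (- U) x" for x
    proof (cases "x \<in> U")
      case True
      then have "x \<in> bowen_ball f n (xs ! i x) \<epsilon>" using i_prop[of x] by auto
      then have "dist ((f ^^ k) x) (g x k) < \<epsilon>" if "k < n" for k
        using that by (auto simp: mem_bowen_ball_iff[OF n(1)] g_def w_def dist_commute)
      then have "{k\<in>{..<n}. \<epsilon> \<le> dist ((f ^^ k) x) (g x k)} = {}" by (auto simp: not_le)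
      then have "dist_count x = 0" by (simp only: dist_count_def card.empty of_nat_0)
      then show ?thesis by simp
    next
      case False
      have "card {k\<in>{..<n}. \<epsilon> \<le> dist ((f ^^ k) x) (g x k)} \<le> card {..<n}" by (intro card_mono) auto
      then show ?thesis using False by (simp add: dist_count_def)
    qed
    have count_meas: "dist_count \<in> borel_measurable borel"
    proof -
      have "(\<lambda>x. dist ((f ^^ k) x) (w (i x) k)) \<in> borel_measurable borel" for k
        by (rule measurable_compose_countable[OF _ i_meas]) measurable
      note [measurable] = this
      show ?thesis unfolding dist_count_def g_def by measurable
    qed
    have dist_lt: "(\<integral>\<omega>. real (card {k\<in>{..<n}. \<epsilon> \<le> dist ((f ^^ k) (fst \<omega>)) (g (fst \<omega>) k)}) \<partial>P) < \<alpha> * real n"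
    proof -
      have "(\<integral>\<omega>. dist_count (fst \<omega>) \<partial>P) = (\<integral>x. dist_count x \<partial>\<mu>)"
        using integral_distr[OF fst_meas count_meas] distr_fst by simp
      also have "\<dots> \<le> (\<integral>x. real n * indicator (- U) x \<partial>\<mu>)"
      proof (rule integral_mono_AE)
        show "integrable \<mu> dist_count"
        proof (rule integrable_const_bound[where B = "real n"])
          show "AE x in \<mu>. norm (dist_count x) \<le> real n"
          proof (rule AE_I2)
            fix x
            have "norm (dist_count x) = dist_count x" by (simp add: dist_count_def)
            also have "\<dots> \<le> real n" using count_le[of x] by (cases "x \<in> U") auto
            finally show "norm (dist_count x) \<le> real n" .
          qed
        qed (use count_meas in measurable)
        show "integrable \<mu> (\<lambda>x. real n * indicator (- U) x)"
          using borel_comp[OF U]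
          by (intro integrable_mult_right integrable_real_indicator) (auto simp: sets emeasure_eq_measure)
      qed (use count_le in auto)
      also have "\<dots> = real n * (1 - measure \<mu> U)"
        using prob_compl[of U] by (simp add: sets space Compl_eq_Diff_UNIV)
      also have "\<dots> < real n * \<delta>" using F(2) n(1) by (intro mult_strict_left_mono) (auto simp: U_def)
      also have "\<dots> \<le> \<alpha> * real n" using \<delta> by (simp add: mult.commute mult_right_mono)
      finally show ?thesis by (simp add: dist_count_def)
    qed
    let ?I = "mutual_info P borel (\<Pi>\<^sub>M m\<in>{..<n}. borel) fst (\<lambda>\<omega>. g (fst \<omega>))"
    have "?I \<le> ereal (ln (real (card F)))"
      unfolding mutual_info_def
    proof (rule Sup_least, clarify)
      fix k l :: nat and p :: "'a \<Rightarrow> nat" and q :: "(nat \<Rightarrow> 'a) \<Rightarrow> nat"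
      assume p: "p \<in> borel \<rightarrow>\<^sub>M count_space {..<k}" and q: "q \<in> (\<Pi>\<^sub>M m\<in>{..<n}. borel) \<rightarrow>\<^sub>M count_space {..<l}"
      interpret P: prob_space P by (rule prP)
      have 1: "p \<circ> fst \<in> P \<rightarrow>\<^sub>M count_space {..<k}" using fst_meas p by (rule measurable_comp)
      have 2: "q \<circ> (\<lambda>\<omega>. g (fst \<omega>)) \<in> P \<rightarrow>\<^sub>M count_space {..<l}" using eta_meas q by (rule measurable_comp)
      show "ereal (P.mutual_information (exp 1) (count_space {..<k}) (count_space {..<l}) (p \<circ> fst) (q \<circ> (\<lambda>\<omega>. g (fst \<omega>))))
          \<le> ereal (ln (real (card F)))"
        unfolding ereal_less_eq
      proof (rule P.mutual_information_le_ln_card[OF 1 2])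
        show "finite ((q \<circ> w) ` {..<length xs})" by simp
        show "(q \<circ> (\<lambda>\<omega>. g (fst \<omega>))) \<omega> \<in> (q \<circ> w) ` {..<length xs}" for \<omega>
          using i_lt by (auto simp: g_def)
        show "card ((q \<circ> w) ` {..<length xs}) \<le> card F"
          using card_image_le[of "{..<length xs}" "q \<circ> w"] xs(2) by simp
      qed
    qed
    also have "ereal (ln (real (card F))) \<le> ereal (real n * c)"
    proof -
      have "real (card F) > 0" using len xs(2) by simp
      then have "ln (real (card F)) \<le> ln (exp (real n * c))" using n(2) F(3) by (subst ln_le_cancel_iff) auto
      then show ?thesis by simp
    qed
    finally have "ereal (1 / real n) * ?I
        \<le> ereal (1 / real n) * ereal (real n * c)"
      by (rule ereal_mult_left_mono) simp
    also have "\<dots> = ereal c" using n(1) by simp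
    finally have "ereal (1 / real n) * ?I \<le> ereal c" .
    moreover have "rate_distortion_at f \<mu> \<epsilon> \<alpha>
        \<le> ereal (1 / real n) * ?I"
      unfolding rate_distortion_at_def
      by (rule Inf_lower, rule CollectI, rule exI[of _ n], rule exI[of _ P], rule exI[of _ fst],
          rule exI[of _ "\<lambda>\<omega>. g (fst \<omega>)"])
         (intro conjI refl n(1) prP fst_meas distr_fst eta_meas dist_lt)
    ultimately show "rate_distortion_at f \<mu> \<epsilon> \<alpha> \<le> ereal c" by (rule order_trans[rotated])
  qed
qed

end

section \<open>Weights of coded blocks\<close>

context compact_dynamics
begin

text \<open>Second countability is not part of the type class, so finite nets take the place of a
  countable dense set: the distance is below t iff some net point is within 1 / (k + 1) of X and
  within t - 1 / (k + 1) of Y.\<close>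

lemma measurable_dist_pair:
  assumes [measurable]: "X \<in> M \<rightarrow>\<^sub>M borel" "Y \<in> M \<rightarrow>\<^sub>M borel"
  shows "(\<lambda>\<omega>. dist (X \<omega> :: 'a) (Y \<omega>)) \<in> borel_measurable M"
proof (rule borel_measurableI_less)
  fix t :: real
  have "\<exists>K z q. (\<forall>x::'a. q x < (K::nat)) \<and> (\<forall>x. dist x (z (q x) :: 'a) < 1 / real (Suc k))" for k
    using finite_partition[of "1 / real (Suc k)"] by (metis of_nat_0_less_iff zero_less_Suc zero_less_divide_1_iff)
  then obtain K :: "nat \<Rightarrow> nat" and z :: "nat \<Rightarrow> nat \<Rightarrow> 'a" and q :: "nat \<Rightarrow> 'a \<Rightarrow> nat"
    where qK: "\<And>k x. q k x < K k" and qz: "\<And>k x. dist x (z k (q k x)) < 1 / real (Suc k)"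
    by metis
  have [measurable]: "(\<lambda>x. dist x w) \<in> borel_measurable borel" for w :: 'a
    using measurable_dist_iterate[of 0 w] by simp
  define near where "near k i = {\<omega>\<in>space M.
      dist (X \<omega>) (z k i) < 1 / real (Suc k) \<and> dist (Y \<omega>) (z k i) < t - 1 / real (Suc k)}" for k i
  have [measurable]: "near k i \<in> sets M" for k i unfolding near_def by measurable
  have "{\<omega>\<in>space M. dist (X \<omega>) (Y \<omega>) < t} = (\<Union>k. \<Union>i<K k. near k i)"
  proof (intro equalityI subsetI)
    fix \<omega> assume "\<omega> \<in> {\<omega>\<in>space M. dist (X \<omega>) (Y \<omega>) < t}"
    then have \<omega>: "\<omega> \<in> space M" "(t - dist (X \<omega>) (Y \<omega>)) / 2 > 0" by auto
    obtain k where "inverse (real (Suc k)) < (t - dist (X \<omega>) (Y \<omega>)) / 2"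
      using reals_Archimedean[OF \<omega>(2)] by blast
    then have k: "2 * (1 / real (Suc k)) < t - dist (X \<omega>) (Y \<omega>)" by (simp add: inverse_eq_divide)
    have "dist (Y \<omega>) (z k (q k (X \<omega>))) \<le> dist (X \<omega>) (Y \<omega>) + dist (X \<omega>) (z k (q k (X \<omega>)))"
      using dist_triangle3[of "Y \<omega>" "z k (q k (X \<omega>))" "X \<omega>"] .
    then have "dist (Y \<omega>) (z k (q k (X \<omega>))) < t - 1 / real (Suc k)"
      using k qz[of "X \<omega>" k] by linarith
    then show "\<omega> \<in> (\<Union>k. \<Union>i<K k. near k i)"
      using qz[of "X \<omega>" k] qK[of k "X \<omega>"] \<omega>(1) unfolding near_def by blast
  next
    fix \<omega> assume "\<omega> \<in> (\<Union>k. \<Union>i<K k. near k i)"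
    then obtain k i where \<omega>: "\<omega> \<in> space M" "dist (X \<omega>) (z k i) < 1 / real (Suc k)"
      "dist (Y \<omega>) (z k i) < t - 1 / real (Suc k)" unfolding near_def by blast
    then have "dist (X \<omega>) (Y \<omega>) < t"
      using dist_triangle2[of "X \<omega>" "Y \<omega>" "z k i"] by linarith
    then show "\<omega> \<in> {\<omega>\<in>space M. dist (X \<omega>) (Y \<omega>) < t}" using \<omega>(1) by simp
  qed
  also have "\<dots> \<in> sets M" by measurable
  finally show "{\<omega>\<in>space M. dist (X \<omega>) (Y \<omega>) < t} \<in> sets M" .
qed

text \<open>The condition carried through the induction that peels letters off a code. Clustered
  sets have no centre to keep track of, and for \<tau> = 0 the condition bounds the mass of S
  itself.\<close>

definition thin_on_clusters :: "'a measure \<Rightarrow> real \<Rightarrow> nat \<Rightarrow> ennreal \<Rightarrow> 'a set \<Rightarrow> bool" where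
  "thin_on_clusters \<mu> \<eta> \<tau> M S \<longleftrightarrow> S \<in> sets borel \<and> (\<forall>T\<in>sets borel. T \<subseteq> S \<longrightarrow>
     (\<forall>x\<in>T. \<forall>y\<in>T. \<forall>i<\<tau>. dist ((f ^^ i) x) ((f ^^ i) y) < \<eta>) \<longrightarrow> emeasure \<mu> T \<le> M)"

text \<open>Restricting to points that are close at time \<tau> supplies the one time that is no
  longer asked for.\<close>

lemma thin_on_clusters_Suc:
  assumes S: "thin_on_clusters \<mu> \<eta> (Suc \<tau>) M S" and "S' \<in> sets borel" "S' \<subseteq> S"
    and close: "\<And>x y. x \<in> S' \<Longrightarrow> y \<in> S' \<Longrightarrow> dist ((f ^^ \<tau>) x) ((f ^^ \<tau>) y) < \<eta>"
  shows "thin_on_clusters \<mu> \<eta> \<tau> M S'"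
  unfolding thin_on_clusters_def
proof (intro conjI ballI impI)
  fix T assume T: "T \<in> sets borel" "T \<subseteq> S'" "\<forall>x\<in>T. \<forall>y\<in>T. \<forall>i<\<tau>. dist ((f ^^ i) x) ((f ^^ i) y) < \<eta>"
  have "\<forall>x\<in>T. \<forall>y\<in>T. \<forall>i<Suc \<tau>. dist ((f ^^ i) x) ((f ^^ i) y) < \<eta>"
  proof (intro ballI allI impI)
    fix x y i assume xy: "x \<in> T" "y \<in> T" "i < Suc \<tau>"
    show "dist ((f ^^ i) x) ((f ^^ i) y) < \<eta>"
    proof (cases "i = \<tau>")
      case True
      then show ?thesis using close xy T(2) by blast
    next
      case False
      then show ?thesis using T(3) xy by simp
    qed
  qed
  moreover have "T \<subseteq> S" using T(2) assms(3) by (rule order_trans)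
  ultimately show "emeasure \<mu> T \<le> M"
    using conjunct2[OF S[unfolded thin_on_clusters_def], rule_format, OF T(1)] by simp
qed fact

context
  fixes \<mu> :: "'a measure" and \<epsilon> u :: real and K n l :: nat and z :: "nat \<Rightarrow> 'a" and q :: "'a \<Rightarrow> nat"
    and c :: "nat \<Rightarrow> real" and w :: "nat \<Rightarrow> nat \<Rightarrow> 'a"
  assumes \<mu>: "\<mu> \<in> invariant_probs f" and \<epsilon>: "\<epsilon> > 0" and u: "0 < u" "u \<le> 1"
    and q [measurable]: "q \<in> borel \<rightarrow>\<^sub>M count_space UNIV" and qK: "\<And>x. q x < K"
    and qz: "\<And>x. dist x (z (q x)) < \<epsilon>"
    and c: "\<And>b. 0 \<le> c b" "(\<Sum>b<l. c b) = 1"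
begin

text \<open>A mismatch starts at 3 \<epsilon> because both letters are quantised with error below
  \<epsilon>: it then forces a true distance of at least \<epsilon>.\<close>

definition letter_weight :: "'a \<Rightarrow> nat \<Rightarrow> 'a \<Rightarrow> real" where
  "letter_weight v \<tau> x = (if dist (z (q ((f ^^ \<tau>) x))) v < 3 * \<epsilon> then 1 else u)"

text \<open>The partition function of a code with words \<open>w b\<close> of probability
  \<open>c b\<close>, where each mismatched letter costs u.\<close>

definition block_weight :: "'a \<Rightarrow> real" where
  "block_weight x = (\<Sum>b<l. c b * (\<Prod>i<n. letter_weight (w b i) i x))"

lemma measurable_letter_weight [measurable]: "letter_weight v \<tau> \<in> borel_measurable borel"
proof -
  have "(\<lambda>x. q ((f ^^ \<tau>) x)) \<in> borel \<rightarrow>\<^sub>M count_space UNIV"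
    by (rule measurable_compose[OF measurable_iterate q])
  from measurable_compose[OF this, of "\<lambda>i. if dist (z i) v < 3 * \<epsilon> then 1 else u" borel]
  show ?thesis unfolding letter_weight_def by simp
qed

lemma measurable_block_weight [measurable]: "block_weight \<in> borel_measurable borel"
  unfolding block_weight_def by measurable

lemma letter_weight_bounds: "u \<le> letter_weight v \<tau> x" "0 < letter_weight v \<tau> x" "letter_weight v \<tau> x \<le> 1"
  using u by (auto simp: letter_weight_def)

lemma letter_weight_nonneg: "0 \<le> letter_weight v \<tau> x"
  using letter_weight_bounds(2)[of v \<tau> x] by simp

lemma letter_weight_shift: "letter_weight v i ((f ^^ \<tau>) x) = letter_weight v (\<tau> + i) x"
  by (simp add: letter_weight_def funpow_add add.commute[of \<tau>])

lemma block_weight_bounds: "u ^ n \<le> block_weight x" "0 < block_weight x" "block_weight x \<le> 1"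
proof -
  have "u ^ n = (\<Sum>b<l. c b * u ^ n)" using c(2) by (simp flip: sum_distrib_right)
  also have "\<dots> \<le> block_weight x" unfolding block_weight_def
  proof (intro sum_mono mult_left_mono c(1))
    fix b
    have "(\<Prod>i<n. u) \<le> (\<Prod>i<n. letter_weight (w b i) i x)"
      using u letter_weight_bounds by (intro prod_mono) (auto intro: less_imp_le)
    then show "u ^ n \<le> (\<Prod>i<n. letter_weight (w b i) i x)" by simp
  qed
  finally show "u ^ n \<le> block_weight x" .
  then show "0 < block_weight x" using u zero_less_power[of u n] by linarith
  have "block_weight x \<le> (\<Sum>b<l. c b * 1)" unfolding block_weight_def
    using letter_weight_bounds by (intro sum_mono mult_left_mono c(1) prod_le_1) (auto intro: less_imp_le)
  then show "block_weight x \<le> 1" using c(2) by simp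
qed

lemma block_weight_nonneg: "0 \<le> block_weight x"
  using block_weight_bounds(2)[of x] by simp

text \<open>Points whose letter at time \<tau> matches v lie within 4 \<epsilon> of v at that time,
  so they form one cluster of width 8 \<epsilon>, of weight 1. The others split into K cells of
  smaller width, each of weight u. This is the origin of the factor 1 + K u and of the 8.\<close>

lemma nn_integral_letter_step:
  assumes g [measurable]: "g \<in> borel_measurable borel"
    and IH: "\<And>S. thin_on_clusters \<mu> (8 * \<epsilon>) \<tau> M S \<Longrightarrow> (\<integral>\<^sup>+x. g x * indicator S x \<partial>\<mu>) \<le> C"
    and S: "thin_on_clusters \<mu> (8 * \<epsilon>) (Suc \<tau>) M S"
  shows "(\<integral>\<^sup>+x. g x * ennreal (letter_weight v \<tau> x) * indicator S x \<partial>\<mu>) \<le> C * ennreal (1 + real K * u)"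
proof -
  have sets [measurable_cong]: "sets \<mu> = sets borel" using \<mu> by (auto simp: invariant_probs_def borel_probs_def)
  have [measurable]: "S \<in> sets borel" using S by (simp add: thin_on_clusters_def)
  have qf [measurable]: "(\<lambda>x. q ((f ^^ \<tau>) x)) \<in> borel \<rightarrow>\<^sub>M count_space UNIV"
    by (rule measurable_compose[OF measurable_iterate q])
  define Sg where "Sg = {x\<in>S. dist (z (q ((f ^^ \<tau>) x))) v < 3 * \<epsilon>}"
  define Sc where "Sc i = {x\<in>S. q ((f ^^ \<tau>) x) = i}" for i
  have "Measurable.pred borel (\<lambda>x. dist (z (q ((f ^^ \<tau>) x))) v < 3 * \<epsilon>)"
    by (rule measurable_compose[OF qf]) simp
  note [measurable] = this
  have [measurable]: "Sg \<in> sets borel" unfolding Sg_def by measurable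
  have [measurable]: "Sc i \<in> sets borel" for i unfolding Sc_def by measurable
  have Sg: "(\<integral>\<^sup>+x. g x * indicator Sg x \<partial>\<mu>) \<le> C"
  proof (rule IH, rule thin_on_clusters_Suc[OF S])
    fix x y assume "x \<in> Sg" "y \<in> Sg"
    then have d: "dist (z (q ((f ^^ \<tau>) x))) v < 3 * \<epsilon>" "dist (z (q ((f ^^ \<tau>) y))) v < 3 * \<epsilon>"
      by (auto simp: Sg_def)
    have "dist ((f ^^ \<tau>) x) v < 4 * \<epsilon>"
      using d(1) qz[of "(f ^^ \<tau>) x"] dist_triangle[of "(f ^^ \<tau>) x" v "z (q ((f ^^ \<tau>) x))"] by linarith
    moreover have "dist ((f ^^ \<tau>) y) v < 4 * \<epsilon>"
      using d(2) qz[of "(f ^^ \<tau>) y"] dist_triangle[of "(f ^^ \<tau>) y" v "z (q ((f ^^ \<tau>) y))"] by linarith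
    ultimately show "dist ((f ^^ \<tau>) x) ((f ^^ \<tau>) y) < 8 * \<epsilon>"
      using dist_triangle2[of "(f ^^ \<tau>) x" "(f ^^ \<tau>) y" v] by linarith
  qed (auto simp: Sg_def)
  have Sc: "(\<integral>\<^sup>+x. g x * indicator (Sc i) x \<partial>\<mu>) \<le> C" for i
  proof (rule IH, rule thin_on_clusters_Suc[OF S])
    fix x y assume "x \<in> Sc i" "y \<in> Sc i"
    then have d: "q ((f ^^ \<tau>) x) = i" "q ((f ^^ \<tau>) y) = i"
      by (auto simp: Sc_def)
    show "dist ((f ^^ \<tau>) x) ((f ^^ \<tau>) y) < 8 * \<epsilon>"
      using qz[of "(f ^^ \<tau>) x"] qz[of "(f ^^ \<tau>) y"] \<epsilon>
        dist_triangle2[of "(f ^^ \<tau>) x" "(f ^^ \<tau>) y" "z i"] unfolding d by linarith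
  qed (auto simp: Sc_def)
  have "(\<integral>\<^sup>+x. g x * ennreal (letter_weight v \<tau> x) * indicator S x \<partial>\<mu>)
      \<le> (\<integral>\<^sup>+x. g x * indicator Sg x + (\<Sum>i<K. ennreal u * (g x * indicator (Sc i) x)) \<partial>\<mu>)"
  proof (rule nn_integral_mono)
    fix x
    show "g x * ennreal (letter_weight v \<tau> x) * indicator S x
        \<le> g x * indicator Sg x + (\<Sum>i<K. ennreal u * (g x * indicator (Sc i) x))"
    proof (cases "x \<in> S \<and> x \<notin> Sg")
      case True
      then have "g x * ennreal (letter_weight v \<tau> x) * indicator S x = ennreal u * (g x * indicator (Sc (q ((f ^^ \<tau>) x))) x)"
        by (auto simp: letter_weight_def Sg_def Sc_def mult.commute)
      also have "\<dots> \<le> (\<Sum>i<K. ennreal u * (g x * indicator (Sc i) x))"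
        using qK by (intro member_le_sum[of _ "{..<K}" "\<lambda>i. ennreal u * (g x * indicator (Sc i) x)"]) auto
      finally show ?thesis by (simp add: add_increasing)
    next
      case False
      then show ?thesis by (auto simp: letter_weight_def Sg_def indicator_def)
    qed
  qed
  also have "\<dots> = (\<integral>\<^sup>+x. g x * indicator Sg x \<partial>\<mu>) + (\<Sum>i<K. ennreal u * (\<integral>\<^sup>+x. g x * indicator (Sc i) x \<partial>\<mu>))"
    by (simp add: nn_integral_add nn_integral_sum nn_integral_cmult)
  also have "\<dots> \<le> C + (\<Sum>i<K. ennreal u * C)"
    by (intro add_mono Sg sum_mono mult_left_mono Sc) simp
  also have "\<dots> = C * ennreal (1 + real K * u)"
    using u by (simp add: ennreal_plus ennreal_mult ennreal_of_nat_eq_real_of_nat algebra_simps)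
  finally show ?thesis .
qed

text \<open>The last letter is removed at each step, in keeping with
  \<open>thin_on_clusters_Suc\<close>, which gives up the latest time.\<close>

lemma nn_integral_word_step:
  assumes g [measurable]: "g \<in> borel_measurable borel"
    and IH: "\<And>S. thin_on_clusters \<mu> (8 * \<epsilon>) \<tau> M S \<Longrightarrow> (\<integral>\<^sup>+x. g x * indicator S x \<partial>\<mu>) \<le> C"
    and S: "thin_on_clusters \<mu> (8 * \<epsilon>) (\<tau> + m) M S"
  shows "(\<integral>\<^sup>+x. g x * ennreal (\<Prod>i<m. letter_weight (v i) (\<tau> + i) x) * indicator S x \<partial>\<mu>)
    \<le> C * ennreal (1 + real K * u) ^ m"
  using S
proof (induction m arbitrary: S)
  case 0
  then show ?case using IH by simp
next
  case (Suc m)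
  have "(\<integral>\<^sup>+x. (g x * ennreal (\<Prod>i<m. letter_weight (v i) (\<tau> + i) x)) * ennreal (letter_weight (v m) (\<tau> + m) x) * indicator S x \<partial>\<mu>)
      \<le> (C * ennreal (1 + real K * u) ^ m) * ennreal (1 + real K * u)"
    by (rule nn_integral_letter_step[OF _ Suc.IH]) (use Suc.prems in simp_all)
  moreover have "ennreal (\<Prod>i<Suc m. letter_weight (v i) (\<tau> + i) x) =
      ennreal (\<Prod>i<m. letter_weight (v i) (\<tau> + i) x) * ennreal (letter_weight (v m) (\<tau> + m) x)" for x
    by (subst ennreal_mult'[symmetric]) (auto intro!: prod_nonneg simp: letter_weight_nonneg)
  ultimately show ?case by (simp add: mult_ac del: prod.lessThan_Suc)
qed

text \<open>A block weight averages word weights with total probability 1, so the bound for single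
  words survives.\<close>

lemma nn_integral_block_step:
  assumes g [measurable]: "g \<in> borel_measurable borel"
    and IH: "\<And>S. thin_on_clusters \<mu> (8 * \<epsilon>) \<tau> M S \<Longrightarrow> (\<integral>\<^sup>+x. g x * indicator S x \<partial>\<mu>) \<le> C"
    and S: "thin_on_clusters \<mu> (8 * \<epsilon>) (\<tau> + n) M S"
  shows "(\<integral>\<^sup>+x. g x * ennreal (block_weight ((f ^^ \<tau>) x)) * indicator S x \<partial>\<mu>)
    \<le> C * ennreal (1 + real K * u) ^ n"
proof -
  have sets [measurable_cong]: "sets \<mu> = sets borel" using \<mu> by (auto simp: invariant_probs_def borel_probs_def)
  have [measurable]: "S \<in> sets borel" using S by (simp add: thin_on_clusters_def)
  define p where "p b x = (\<Prod>i<n. letter_weight (w b i) (\<tau> + i) x)" for b x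
  have [measurable]: "p b \<in> borel_measurable borel" for b unfolding p_def by measurable
  have p0: "0 \<le> p b x" for b x unfolding p_def by (auto intro!: prod_nonneg letter_weight_nonneg)
  have "ennreal (block_weight ((f ^^ \<tau>) x)) = (\<Sum>b<l. ennreal (c b) * ennreal (p b x))" for x
    unfolding block_weight_def letter_weight_shift p_def[symmetric]
    using c(1) p0 by (simp add: ennreal_mult flip: sum_ennreal)
  then have "(\<integral>\<^sup>+x. g x * ennreal (block_weight ((f ^^ \<tau>) x)) * indicator S x \<partial>\<mu>)
      = (\<integral>\<^sup>+x. (\<Sum>b<l. ennreal (c b) * (g x * ennreal (p b x) * indicator S x)) \<partial>\<mu>)"
    by (simp add: sum_distrib_left sum_distrib_right mult_ac)
  also have "\<dots> = (\<Sum>b<l. ennreal (c b) * (\<integral>\<^sup>+x. g x * ennreal (p b x) * indicator S x \<partial>\<mu>))"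
    by (simp add: nn_integral_sum nn_integral_cmult)
  also have "\<dots> \<le> (\<Sum>b<l. ennreal (c b) * (C * ennreal (1 + real K * u) ^ n))"
    unfolding p_def by (intro sum_mono mult_left_mono nn_integral_word_step[OF g IH S]) simp_all
  also have "\<dots> = ennreal (\<Sum>b<l. c b) * (C * ennreal (1 + real K * u) ^ n)"
    using c(1) by (simp add: sum_ennreal flip: sum_distrib_right)
  also have "\<dots> = C * ennreal (1 + real K * u) ^ n" by (simp add: c(2))
  finally show ?thesis .
qed

lemma nn_integral_blocks_le:
  assumes "thin_on_clusters \<mu> (8 * \<epsilon>) (j * n) M S"
  shows "(\<integral>\<^sup>+x. ennreal (\<Prod>i<j. block_weight ((f ^^ (i * n)) x)) * indicator S x \<partial>\<mu>)
    \<le> M * ennreal (1 + real K * u) ^ (j * n)"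
  using assms
proof (induction j arbitrary: S)
  case 0
  have sets: "sets \<mu> = sets borel" using \<mu> by (auto simp: invariant_probs_def borel_probs_def)
  have "S \<in> sets borel" "emeasure \<mu> S \<le> M" using 0 by (auto simp: thin_on_clusters_def)
  then show ?case by (simp add: sets)
next
  case (Suc j)
  have "(\<integral>\<^sup>+x. ennreal (\<Prod>i<j. block_weight ((f ^^ (i * n)) x)) * ennreal (block_weight ((f ^^ (j * n)) x)) * indicator S x \<partial>\<mu>)
      \<le> (M * ennreal (1 + real K * u) ^ (j * n)) * ennreal (1 + real K * u) ^ n"
    by (rule nn_integral_block_step[OF _ Suc.IH]) (use Suc.prems in \<open>simp_all add: add.commute\<close>)
  moreover have "ennreal (\<Prod>i<Suc j. block_weight ((f ^^ (i * n)) x)) =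
      ennreal (\<Prod>i<j. block_weight ((f ^^ (i * n)) x)) * ennreal (block_weight ((f ^^ (j * n)) x))" for x
    by (subst ennreal_mult'[symmetric]) (auto intro!: prod_nonneg simp: block_weight_nonneg)
  ultimately show ?case by (simp add: mult_ac power_add del: prod.lessThan_Suc)
qed

text \<open>By invariance the right side is the integral of - ln Z for the product Z over j blocks,
  while Z has integral at most B over S. On S the tangent inequality ln (Z / B) \<le> Z / B - 1
  plays the part of Jensen's inequality; off S, - ln Z is nonnegative. The lost 1 disappears after
  division by j.\<close>

lemma integral_ln_block_weight_ge:
  assumes S: "thin_on_clusters \<mu> (8 * \<epsilon>) (j * n) (ennreal (exp (- (real (j * n) * h)))) S"
  shows "measure \<mu> S * (real (j * n) * (h - ln (1 + real K * u))) - 1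
    \<le> real j * (\<integral>x. - ln (block_weight x) \<partial>\<mu>)"
proof -
  have pr: "prob_space \<mu>" and sets: "sets \<mu> = sets borel"
    using \<mu> by (auto simp: invariant_probs_def borel_probs_def)
  interpret prob_space \<mu> by (rule pr)
  note [measurable_cong] = sets
  have [measurable]: "S \<in> sets borel" using S by (simp add: thin_on_clusters_def)
  define Z where "Z x = (\<Prod>i<j. block_weight ((f ^^ (i * n)) x))" for x
  have [measurable]: "Z \<in> borel_measurable borel" unfolding Z_def by measurable
  have Z: "0 < Z x" "Z x \<le> 1" for x
    unfolding Z_def using block_weight_bounds by (auto intro!: prod_pos prod_le_1 simp: block_weight_nonneg)
  define B where "B = exp (- (real (j * n) * h)) * (1 + real K * u) ^ (j * n)"
  have Ku: "1 + real K * u > 0" using u by (simp add: add_pos_nonneg)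
  have B: "B > 0" unfolding B_def using Ku by simp
  have lnB: "ln B = - (real (j * n) * (h - ln (1 + real K * u)))"
    unfolding B_def using Ku by (simp add: ln_mult ln_realpow algebra_simps)
  have int_ln: "integrable \<mu> (\<lambda>x. - ln (block_weight ((f ^^ i) x)))" for i
  proof (rule integrable_const_bound[where B = "- ln (u ^ n)"])
    have "norm (- ln (block_weight y)) \<le> - ln (u ^ n)" for y
    proof -
      have "ln (u ^ n) \<le> ln (block_weight y)" "ln (block_weight y) \<le> 0"
        using block_weight_bounds[of y] u by (auto intro!: ln_mono)
      then show ?thesis by simp
    qed
    then show "AE x in \<mu>. norm (- ln (block_weight ((f ^^ i) x))) \<le> - ln (u ^ n)" by simp
  qed measurable
  have lnZ: "- ln (Z x) = (\<Sum>i<j. - ln (block_weight ((f ^^ (i * n)) x)))" for x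
    unfolding Z_def using block_weight_bounds(2) by (subst ln_prod) (auto simp: sum_negf less_imp_neq[symmetric])
  have int_lnZ: "integrable \<mu> (\<lambda>x. - ln (Z x))"
    unfolding lnZ by (intro Bochner_Integration.integrable_sum int_ln)
  have int_ZS: "integrable \<mu> (\<lambda>x. Z x * indicator S x)"
    by (rule integrable_const_bound[where B = 1])
       (use Z in \<open>auto simp: indicator_def abs_of_pos\<close>)
  have "ennreal (\<integral>x. Z x * indicator S x \<partial>\<mu>) = (\<integral>\<^sup>+x. ennreal (Z x * indicator S x) \<partial>\<mu>)"
    using int_ZS Z by (intro nn_integral_eq_integral[symmetric]) (auto simp: indicator_def less_imp_le)
  also have "\<dots> = (\<integral>\<^sup>+x. ennreal (Z x) * indicator S x \<partial>\<mu>)"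
    by (intro nn_integral_cong) (auto simp: indicator_def)
  also have "\<dots> \<le> ennreal (exp (- (real (j * n) * h))) * ennreal (1 + real K * u) ^ (j * n)"
    unfolding Z_def by (rule nn_integral_blocks_le[OF S])
  also have "\<dots> = ennreal B" unfolding B_def using Ku by (simp add: ennreal_mult ennreal_power)
  finally have ZS: "(\<integral>x. Z x * indicator S x \<partial>\<mu>) \<le> B" using B by (simp add: ennreal_le_iff)
  have int_rhs: "integrable \<mu> (\<lambda>x. (1 - ln B) * indicator S x - (Z x * indicator S x) / B)"
    by (intro Bochner_Integration.integrable_diff integrable_mult_right integrable_divide int_ZS integrable_real_indicator)
       (auto simp: sets emeasure_eq_measure)
  have "measure \<mu> S * (- ln B) - 1 \<le> measure \<mu> S * (1 - ln B) - (\<integral>x. Z x * indicator S x \<partial>\<mu>) / B"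
  proof -
    have "(\<integral>x. Z x * indicator S x \<partial>\<mu>) / B \<le> 1" using ZS B by simp
    then show ?thesis by (simp add: algebra_simps measure_nonneg add_increasing2 add_increasing)
  qed
  also have "\<dots> = (\<integral>x. (1 - ln B) * indicator S x - (Z x * indicator S x) / B \<partial>\<mu>)"
    by (subst Bochner_Integration.integral_diff)
       (auto simp: int_ZS sets emeasure_eq_measure intro!: integrable_mult_right integrable_divide integrable_real_indicator)
  also have "\<dots> \<le> (\<integral>x. - ln (Z x) \<partial>\<mu>)"
  proof (rule integral_mono[OF int_rhs int_lnZ])
    fix x
    show "(1 - ln B) * indicator S x - (Z x * indicator S x) / B \<le> - ln (Z x)"
    proof (cases "x \<in> S")
      case True
      have "ln (Z x / B) \<le> Z x / B - 1" using Z B by (intro ln_le_minus_one) simp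
      moreover have "ln (Z x / B) = ln (Z x) - ln B" using Z(1)[of x] B by (simp add: ln_div)
      ultimately show ?thesis using True by simp
    next
      case False
      then show ?thesis using Z[of x] by simp
    qed
  qed
  also have "\<dots> = (\<Sum>i<j. (\<integral>x. - ln (block_weight ((f ^^ (i * n)) x)) \<partial>\<mu>))"
    unfolding lnZ by (intro Bochner_Integration.integral_sum int_ln)
  also have "\<dots> = real j * (\<integral>x. - ln (block_weight x) \<partial>\<mu>)"
    using integral_iterate[OF \<mu>, of "\<lambda>x. - ln (block_weight x)"] by simp
  finally show ?thesis unfolding lnB by simp
qed

end

end

section \<open>Rate distortion\<close>

text \<open>\<open>mutual_info\<close> quantises only to initial segments of the naturals, so words
  over K letters have to be numbered measurably.\<close>

lemma measurable_word_code:
  fixes h :: "nat \<Rightarrow> 'b \<Rightarrow> nat" and k :: nat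
  assumes h: "\<And>i. i < n \<Longrightarrow> h i \<in> M \<rightarrow>\<^sub>M count_space UNIV" "\<And>i x. h i x < K"
    and enc: "bij_betw enc (PiE {..<n} (\<lambda>_. {..<K})) {..<k}"
  shows "(\<lambda>x. enc (\<lambda>i\<in>{..<n}. h i x)) \<in> M \<rightarrow>\<^sub>M count_space {..<k}"
  unfolding measurable_count_space_eq2[OF finite_lessThan]
proof (intro conjI ballI)
  define W where "W = PiE {..<n} (\<lambda>_::nat. {..<K})"
  have word: "(\<lambda>i\<in>{..<n}. h i x) \<in> W" for x
    using h(2) by (auto simp: W_def PiE_iff)
  show "(\<lambda>x. enc (\<lambda>i\<in>{..<n}. h i x)) \<in> space M \<rightarrow> {..<k}"
    using bij_betwE[OF enc] word unfolding W_def by blast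
  fix a assume "a \<in> {..<k}"
  then obtain v where v: "v \<in> W" "enc v = a" using enc unfolding bij_betw_def W_def by (metis imageE)
  have "enc (\<lambda>i\<in>{..<n}. h i x) = a \<longleftrightarrow> (\<forall>i<n. h i x = v i)" for x
  proof -
    have "enc (\<lambda>i\<in>{..<n}. h i x) = a \<longleftrightarrow> (\<lambda>i\<in>{..<n}. h i x) = v"
      using enc word[of x] v unfolding bij_betw_def W_def by (metis inj_onD)
    also have "\<dots> \<longleftrightarrow> (\<forall>i<n. h i x = v i)"
    proof
      assume "\<forall>i<n. h i x = v i"
      then show "(\<lambda>i\<in>{..<n}. h i x) = v"
        using v(1) unfolding W_def by (intro PiE_ext[OF word[unfolded W_def]]) auto
    next
      assume eq: "(\<lambda>i\<in>{..<n}. h i x) = v"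
      show "\<forall>i<n. h i x = v i" unfolding eq[symmetric] by simp
    qed
    finally show ?thesis .
  qed
  then have "(\<lambda>x. enc (\<lambda>i\<in>{..<n}. h i x)) -` {a} \<inter> space M = {x\<in>space M. \<forall>i\<in>{..<n}. h i x = v i}" by auto
  also have "\<dots> \<in> sets M"
  proof (rule sets.sets_Collect_finite_All)
    fix i assume "i \<in> {..<n}"
    then have "h i -` {v i} \<inter> space M \<in> sets M" using h(1) by (intro measurable_sets) auto
    also have "h i -` {v i} \<inter> space M = {x\<in>space M. h i x = v i}" by auto
    finally show "{x\<in>space M. h i x = v i} \<in> sets M" .
  qed simp
  finally show "(\<lambda>x. enc (\<lambda>i\<in>{..<n}. h i x)) -` {a} \<inter> space M \<in> sets M" .
qed

context compact_dynamics
begin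

text \<open>A clustered set lies in the Bowen ball around any of its points, and the ball around a
  point of large rate has small mass.\<close>

lemma thin_on_clusters_local_rate:
  assumes \<mu>: "\<mu> \<in> borel_probs" and N: "N \<ge> 1"
  shows "thin_on_clusters \<mu> \<eta> N (ennreal (exp (- (real N * h)))) {x. ereal h < local_rate f \<mu> \<eta> x N}"
  unfolding thin_on_clusters_def
proof (intro conjI ballI impI)
  note [measurable] = measurable_local_rate[OF \<mu>]
  show "{x. ereal h < local_rate f \<mu> \<eta> x N} \<in> sets borel" by measurable
  have pr: "prob_space \<mu>" and sets: "sets \<mu> = sets borel" using \<mu> by (auto simp: borel_probs_def)
  interpret prob_space \<mu> by (rule pr)
  fix T assume T: "T \<in> sets borel" "T \<subseteq> {x. ereal h < local_rate f \<mu> \<eta> x N}"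
    "\<forall>x\<in>T. \<forall>y\<in>T. \<forall>i<N. dist ((f ^^ i) x) ((f ^^ i) y) < \<eta>"
  show "emeasure \<mu> T \<le> ennreal (exp (- (real N * h)))"
  proof (cases "T = {}")
    case False
    then obtain x where x: "x \<in> T" by blast
    have "T \<subseteq> bowen_ball f N x \<eta>" using T(3) x by (auto simp: mem_bowen_ball_iff[OF N])
    then have "emeasure \<mu> T \<le> emeasure \<mu> (bowen_ball f N x \<eta>)"
      by (intro emeasure_mono) (auto simp: sets)
    also have "\<dots> \<le> ennreal (exp (- (real N * h)))"
      unfolding emeasure_eq_measure using T(2) x by (intro ennreal_leI less_local_rateD[OF N]) auto
    finally show ?thesis .
  qed simp
qed

text \<open>Both variables are quantised through \<open>q\<close> and become numbered words. Gibbs'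
  inequality bounds J, the mean of - ln of the partition function, by the information plus s
  \<alpha> n. Conversely the same code on j consecutive blocks reads orbit segments of length j n,
  so for fixed n and j tending to infinity the local rates force J \<ge> n (h - ln (1 + K
  u)).\<close>

lemma rate_distortion_at_ge:
  fixes K :: nat and z :: "nat \<Rightarrow> 'a" and q :: "'a \<Rightarrow> nat"
  assumes \<mu>: "\<mu> \<in> ergodic_probs f" and \<epsilon>: "\<epsilon> > 0" and h: "ereal h < lower_BK f \<mu> (8 * \<epsilon>)"
    and s: "s > 0"
    and q [measurable]: "q \<in> borel \<rightarrow>\<^sub>M count_space UNIV" and qK: "\<And>x. q x < K"
    and qz: "\<And>x. dist x (z (q x)) < \<epsilon>"
  shows "ereal (h - ln (1 + real K * exp (- s)) - s * \<alpha>) \<le> rate_distortion_at f \<mu> \<epsilon> \<alpha>"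
  unfolding rate_distortion_at_def
proof (rule Inf_greatest, clarify)
  fix n and P :: "('a \<times> (nat \<Rightarrow> 'a)) measure" and \<xi> \<eta>
  assume n: "1 \<le> n" and prP: "prob_space P" and \<xi> [measurable]: "\<xi> \<in> P \<rightarrow>\<^sub>M borel"
    and \<mu>_def: "\<mu> = distr P borel \<xi>"
    and \<eta> [measurable]: "\<eta> \<in> P \<rightarrow>\<^sub>M (\<Pi>\<^sub>M k\<in>{..<n}. borel)"
    and distortion: "(\<integral>\<omega>. real (card {k\<in>{..<n}. \<epsilon> \<le> dist ((f ^^ k) (\<xi> \<omega>)) (\<eta> \<omega> k)}) \<partial>P) < \<alpha> * real n"
  note bp = ergodic_probsD(2)[OF \<mu>]
  note inv = ergodic_probsD(1)[OF \<mu>] and sets [measurable_cong] = ergodic_probsD(4)[OF \<mu>]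
  interpret prob_space \<mu> by (rule ergodic_probsD(3)[OF \<mu>])
  interpret P: prob_space P by (rule prP)
  define errors where "errors \<omega> = {k\<in>{..<n}. \<epsilon> \<le> dist ((f ^^ k) (\<xi> \<omega>)) (\<eta> \<omega> k)}" for \<omega>
  define u where "u = exp (- s)"
  have u: "0 < u" "u \<le> 1" using s by (auto simp: u_def)

  define W where "W = PiE {..<n} (\<lambda>_::nat. {..<K})"
  define k where "k = card W"
  have "finite W" unfolding W_def by (intro finite_PiE) auto
  then obtain enc where "bij_betw enc W {0..<card W}" using ex_bij_betw_finite_nat by blast
  then have enc: "bij_betw enc W {..<k}" by (simp add: k_def lessThan_atLeast0)
  define dec where "dec = inv_into W enc"
  have dec: "dec (enc v) = v" if "v \<in> W" for v
    unfolding dec_def using enc that by (simp add: bij_betw_inv_into_left)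
  define p where "p x = enc (\<lambda>i\<in>{..<n}. q ((f ^^ i) x))" for x
  define r where "r y = enc (\<lambda>i\<in>{..<n}. q (y i))" for y
  have p_meas: "p \<in> borel \<rightarrow>\<^sub>M count_space {..<k}"
    unfolding p_def using enc[unfolded W_def] qK
    by (intro measurable_word_code measurable_compose[OF measurable_iterate q]) auto
  have r_meas: "r \<in> (\<Pi>\<^sub>M k\<in>{..<n}. borel) \<rightarrow>\<^sub>M count_space {..<k}"
    unfolding r_def
  proof (rule measurable_word_code[OF _ qK enc[unfolded W_def]])
    fix i assume "i < n"
    then show "(\<lambda>y. q (y i)) \<in> (\<Pi>\<^sub>M k\<in>{..<n}. borel) \<rightarrow>\<^sub>M count_space UNIV"
      by (intro measurable_compose[OF _ q] measurable_component_singleton) simp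
  qed
  have dec_p: "dec (p x) i = q ((f ^^ i) x)" if "i < n" for x i
    unfolding p_def using that qK by (subst dec) (auto simp: W_def PiE_iff)
  have dec_r: "dec (r y) i = q (y i)" if "i < n" for y i
    unfolding r_def using that qK by (subst dec) (auto simp: W_def PiE_iff)
  have 1: "p \<circ> \<xi> \<in> P \<rightarrow>\<^sub>M count_space {..<k}" using \<xi> p_meas by (rule measurable_comp)
  have 2: "r \<circ> \<eta> \<in> P \<rightarrow>\<^sub>M count_space {..<k}" using \<eta> r_meas by (rule measurable_comp)
  define bad where "bad a b = real (card {i. i < n \<and> \<not> dist (z (dec a i)) (z (dec b i)) < 3 * \<epsilon>})" for a b
  define c where "c b = P.pB (r \<circ> \<eta>) b" for b
  define w where "w b i = z (dec b i)" for b i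
  define Z where "Z a = (\<Sum>b<k. c b * exp (- s * bad a b))" for a
  define I where "I = P.mutual_information (exp 1) (count_space {..<k}) (count_space {..<k}) (p \<circ> \<xi>) (r \<circ> \<eta>)"
  have c: "\<And>b. 0 \<le> c b" "(\<Sum>b<k. c b) = 1"
    unfolding c_def using P.pAB_nonneg(3)[OF 1 2] P.sum_pB[OF 1 2] by auto
  define \<zeta> where "\<zeta> = block_weight \<epsilon> u n k z q c w"
  have \<zeta>_eq: "Z (p x) = \<zeta> x" for x
  proof -
    have "exp (- s * bad (p x) b) = (\<Prod>i<n. letter_weight \<epsilon> u z q (w b i) i x)" for b
    proof -
      have "(\<Prod>i<n. letter_weight \<epsilon> u z q (w b i) i x)
          = (\<Prod>i<n. if \<not> dist (z (dec (p x) i)) (z (dec b i)) < 3 * \<epsilon> then u else 1)"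
        by (intro prod.cong) (auto simp: letter_weight_def[OF inv \<epsilon> u q qK qz c] w_def dec_p)
      also have "\<dots> = u ^ card {i. i < n \<and> \<not> dist (z (dec (p x) i)) (z (dec b i)) < 3 * \<epsilon>}"
        by (subst prod.inter_filter[symmetric]) auto
      also have "\<dots> = exp (- s * bad (p x) b)"
        unfolding u_def bad_def by (simp add: mult.commute flip: exp_of_nat_mult)
      finally show ?thesis by simp
    qed
    then show ?thesis unfolding Z_def \<zeta>_def block_weight_def[OF inv \<epsilon> u q qK qz c] by simp
  qed
  have \<zeta>_meas [measurable]: "\<zeta> \<in> borel_measurable borel"
    unfolding \<zeta>_def by (rule measurable_block_weight[OF inv \<epsilon> u q qK qz c])
  define J where "J = (\<integral>x. - ln (\<zeta> x) \<partial>\<mu>)"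

  have J_le: "J \<le> I + s * (\<alpha> * real n)"
  proof -
    have "J = - P.expectation (\<lambda>\<omega>. ln (Z ((p \<circ> \<xi>) \<omega>)))"
      unfolding J_def \<mu>_def by (subst integral_distr) (auto simp: \<zeta>_eq)
    also have "\<dots> \<le> I + s * P.expectation (\<lambda>\<omega>. bad ((p \<circ> \<xi>) \<omega>) ((r \<circ> \<eta>) \<omega>))"
      unfolding I_def Z_def c_def by (rule P.mutual_information_ge_partition_function[OF 1 2])
    also have "P.expectation (\<lambda>\<omega>. bad ((p \<circ> \<xi>) \<omega>) ((r \<circ> \<eta>) \<omega>)) \<le>
        (\<integral>\<omega>. real (card (errors \<omega>)) \<partial>P)"
    proof (rule integral_mono_AE)
      have bad_meas: "(\<lambda>\<omega>. bad ((p \<circ> \<xi>) \<omega>) ((r \<circ> \<eta>) \<omega>)) \<in> borel_measurable P"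
      proof -
        have "(\<lambda>\<omega>. ((p \<circ> \<xi>) \<omega>, (r \<circ> \<eta>) \<omega>)) \<in> P \<rightarrow>\<^sub>M count_space {..<k} \<Otimes>\<^sub>M count_space {..<k}"
          using 1 2 by (rule measurable_Pair)
        then have "(\<lambda>\<omega>. ((p \<circ> \<xi>) \<omega>, (r \<circ> \<eta>) \<omega>)) \<in> P \<rightarrow>\<^sub>M count_space ({..<k} \<times> {..<k})"
          by (simp add: pair_measure_count_space)
        from measurable_compose[OF this, of "\<lambda>(a, b). bad a b" borel] show ?thesis by simp
      qed
      have bad_bound: "norm (bad a b) \<le> real n" for a b
        unfolding bad_def using card_mono[of "{..<n}" "{i. i < n \<and> \<not> dist (z (dec a i)) (z (dec b i)) < 3 * \<epsilon>}"] by auto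
      show "integrable P (\<lambda>\<omega>. bad ((p \<circ> \<xi>) \<omega>) ((r \<circ> \<eta>) \<omega>))"
        by (rule P.integrable_const_bound[OF _ bad_meas, of "real n"]) (intro AE_I2 bad_bound)
      have count_meas: "(\<lambda>\<omega>. real (card (errors \<omega>))) \<in> borel_measurable P"
      proof -
        have meas: "(\<lambda>\<omega>. dist ((f ^^ k) (\<xi> \<omega>)) (\<eta> \<omega> k)) \<in> borel_measurable P" if "k \<in> {..<n}" for k
          using that by (intro measurable_dist_pair measurable_compose[OF \<xi> measurable_iterate]
              measurable_compose[OF \<eta> measurable_component_singleton])
        have "(\<lambda>\<omega>. \<Sum>k<n. indicator {\<epsilon>..} (dist ((f ^^ k) (\<xi> \<omega>)) (\<eta> \<omega> k)) :: real) \<in> borel_measurable P"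
          by (intro borel_measurable_sum measurable_compose[OF meas]) simp_all
        also have "(\<lambda>\<omega>. \<Sum>k<n. indicator {\<epsilon>..} (dist ((f ^^ k) (\<xi> \<omega>)) (\<eta> \<omega> k)) :: real)
            = (\<lambda>\<omega>. real (card (errors \<omega>)))"
        proof
          fix \<omega>
          have "real (card (errors \<omega>))
              = (\<Sum>k\<in>errors \<omega>. 1)" by simp
          also have "\<dots> = (\<Sum>k<n. indicator {\<epsilon>..} (dist ((f ^^ k) (\<xi> \<omega>)) (\<eta> \<omega> k)))"
            unfolding errors_def sum.inter_filter[OF finite_lessThan] by (rule sum.cong[OF refl]) simp
          finally show "(\<Sum>k<n. indicator {\<epsilon>..} (dist ((f ^^ k) (\<xi> \<omega>)) (\<eta> \<omega> k)) :: real)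
              = real (card (errors \<omega>))" by simp
        qed
        finally show ?thesis .
      qed
      have count_bound: "norm (real (card (errors \<omega>))) \<le> real n" for \<omega>
        using card_mono[of "{..<n}" "errors \<omega>"] by (auto simp: errors_def)
      show "integrable P (\<lambda>\<omega>. real (card (errors \<omega>)))"
        by (rule P.integrable_const_bound[OF _ count_meas, of "real n"]) (intro AE_I2 count_bound)
      show "AE \<omega> in P. bad ((p \<circ> \<xi>) \<omega>) ((r \<circ> \<eta>) \<omega>) \<le> real (card (errors \<omega>))"
      proof (rule AE_I2)
        fix \<omega>
        \<comment> \<open>A quantised gap of 3 \<epsilon> less two quantisation errors below
          \<epsilon> leaves a true error of at least \<epsilon>.\<close>
        have "{i. i < n \<and> \<not> dist (z (dec ((p \<circ> \<xi>) \<omega>) i)) (z (dec ((r \<circ> \<eta>) \<omega>) i)) < 3 * \<epsilon>}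
            \<subseteq> errors \<omega>"
          unfolding errors_def
        proof safe
          fix i assume i: "i < n" "\<not> dist (z (dec ((p \<circ> \<xi>) \<omega>) i)) (z (dec ((r \<circ> \<eta>) \<omega>) i)) < 3 * \<epsilon>"
          define a where "a = (f ^^ i) (\<xi> \<omega>)"
          define b where "b = \<eta> \<omega> i"
          have "3 * \<epsilon> \<le> dist (z (q a)) (z (q b))" using i by (simp add: dec_p dec_r a_def b_def)
          moreover have "dist (z (q a)) (z (q b)) \<le> dist a (z (q a)) + dist a (z (q b))" by (rule dist_triangle3)
          moreover have "dist a (z (q b)) \<le> dist a b + dist b (z (q b))" by (rule dist_triangle)
          ultimately have "\<epsilon> \<le> dist a b" using qz[of a] qz[of b] by linarith
          then show "\<epsilon> \<le> dist ((f ^^ i) (\<xi> \<omega>)) (\<eta> \<omega> i)" by (simp add: a_def b_def)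
        qed
        then show "bad ((p \<circ> \<xi>) \<omega>) ((r \<circ> \<eta>) \<omega>) \<le> real (card (errors \<omega>))"
          unfolding bad_def of_nat_le_iff by (intro card_mono) (simp_all add: errors_def)
      qed
    qed
    also have "\<dots> \<le> \<alpha> * real n" using distortion by (simp add: errors_def)
    finally show ?thesis using s by simp
  qed

  have J_ge: "real n * (h - ln (1 + real K * u)) \<le> J"
  proof -
    \<comment> \<open>A margin above h turns the almost sure bound on the liminf into a strict bound
      at all large times.\<close>
    obtain h' :: real where h': "ereal h < ereal h'" "ereal h' < lower_BK f \<mu> (8 * \<epsilon>)"
      using ereal_dense2[OF h] by blast
    note [measurable] = measurable_local_rate[OF bp]
    define S where "S N = {x. ereal h < local_rate f \<mu> (8 * \<epsilon>) x N}" for N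
    have S_borel: "S N \<in> sets borel" for N unfolding S_def by measurable
    have "AE x in \<mu>. \<forall>\<^sub>F N in sequentially. x \<in> S N"
      using ergodic_lower_BK_AE[OF \<mu> h'(2)]
    proof eventually_elim
      case (elim x)
      then have "ereal h < liminf (local_rate f \<mu> (8 * \<epsilon>) x)" using h'(1) by (rule less_le_trans[rotated])
      then show ?case by (auto simp: S_def dest: less_LiminfD)
    qed
    then have lim: "(\<lambda>N. prob (S N)) \<longlonglongrightarrow> 1"
      using S_borel by (intro prob_tendsto_1_of_AE_eventually) (simp_all add: sets)
    have "filterlim (\<lambda>j::nat. j * n) at_top at_top"
      using n by (intro filterlim_at_top_mono[OF filterlim_ident]) (auto intro!: always_eventually)
    from filterlim_compose[OF lim this] have lim_n: "(\<lambda>j. prob (S (j * n))) \<longlonglongrightarrow> 1" .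
    have "(\<lambda>j. prob (S (j * n)) * (real n * (h - ln (1 + real K * u))) - 1 / real j)
        \<longlonglongrightarrow> 1 * (real n * (h - ln (1 + real K * u))) - 0"
      by (intro tendsto_diff tendsto_mult lim_n tendsto_const lim_const_over_n)
    moreover have "\<exists>N. \<forall>j\<ge>N. prob (S (j * n)) * (real n * (h - ln (1 + real K * u))) - 1 / real j \<le> J"
    proof (intro exI allI impI)
      fix j :: nat assume j: "1 \<le> j"
      have "prob (S (j * n)) * (real (j * n) * (h - ln (1 + real K * u))) - 1 \<le> real j * J"
        unfolding J_def \<zeta>_def
        by (rule integral_ln_block_weight_ge[OF inv \<epsilon> u q qK qz c], unfold S_def,
            rule thin_on_clusters_local_rate[OF bp]) (use j n in simp)
      then have "(prob (S (j * n)) * (real (j * n) * (h - ln (1 + real K * u))) - 1) / real j \<le> J"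
        using j by (simp add: divide_le_eq mult.commute)
      then show "prob (S (j * n)) * (real n * (h - ln (1 + real K * u))) - 1 / real j \<le> J"
        using j by (simp add: diff_divide_distrib)
    qed
    ultimately have "1 * (real n * (h - ln (1 + real K * u))) - 0 \<le> J" by (rule LIMSEQ_le_const2)
    then show ?thesis by simp
  qed

  have "real n * (h - ln (1 + real K * u)) - s * (\<alpha> * real n) \<le> I" using J_le J_ge by linarith
  then have "h - ln (1 + real K * u) - s * \<alpha> \<le> I / real n" using n by (simp add: le_divide_eq algebra_simps)
  then have "ereal (h - ln (1 + real K * exp (- s)) - s * \<alpha>) \<le> ereal (1 / real n) * ereal I" by (simp add: u_def)
  \<comment> \<open>The two word codings are one admissible pair in the supremum defining
    \<open>mutual_info\<close>.\<close>
  also have "\<dots> \<le> ereal (1 / real n) * mutual_info P borel (\<Pi>\<^sub>M k\<in>{..<n}. borel) \<xi> \<eta>"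
    unfolding mutual_info_def I_def
    by (rule ereal_mult_left_mono, rule Sup_upper, rule CollectI, rule exI[of _ k], rule exI[of _ k],
        rule exI[of _ p], rule exI[of _ r], rule conjI[OF refl conjI[OF p_meas r_meas]]) simp
  finally show "ereal (h - ln (1 + real K * exp (- s)) - s * \<alpha>)
      \<le> ereal (1 / real n) * mutual_info P borel (\<Pi>\<^sub>M k\<in>{..<n}. borel) \<xi> \<eta>" .
qed

lemma lower_BK_le_rate_distortion:
  assumes \<mu>: "\<mu> \<in> ergodic_probs f" and \<epsilon>: "\<epsilon> > 0"
  shows "lower_BK f \<mu> (8 * \<epsilon>) \<le> rate_distortion f \<mu> \<epsilon>"
proof (rule ereal_le_real_ltI)
  fix h :: real assume "ereal h < lower_BK f \<mu> (8 * \<epsilon>)"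
  then obtain h' :: real where h': "ereal h < ereal h'" "ereal h' < lower_BK f \<mu> (8 * \<epsilon>)"
    using ereal_dense2 by blast
  define e where "e = h' - h"
  have e: "e > 0" using h'(1) by (simp add: e_def)
  obtain K z q where q: "q \<in> borel \<rightarrow>\<^sub>M count_space UNIV" "\<And>x::'a. q x < (K::nat)" "\<And>x. dist x (z (q x) :: 'a) < \<epsilon>"
    using finite_partition[OF \<epsilon>] by metis
  have K: "real K > 0" using q(2)[of undefined] by simp
  \<comment> \<open>This s makes K exp (- s) \<le> e / 2, and the later \<alpha> makes s \<alpha> =
    e / 2; together they use up the gap e = h' - h. The maximum with 1 keeps s positive.\<close>
  define s where "s = max 1 (ln (2 * real K / e))"
  have s: "s > 0" by (simp add: s_def)
  have "exp (- s) \<le> exp (- ln (2 * real K / e))" by (simp add: s_def)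
  also have "\<dots> = e / (2 * real K)" using K e by (simp add: exp_minus)
  finally have "real K * exp (- s) \<le> e / 2" using K by (simp add: field_simps)
  moreover have "ln (1 + real K * exp (- s)) \<le> real K * exp (- s)"
    using K by (intro ln_add_one_self_le_self) simp
  ultimately have 1: "ln (1 + real K * exp (- s)) \<le> e / 2" by linarith
  define \<alpha> where "\<alpha> = e / (2 * s)"
  have \<alpha>: "\<alpha> > 0" "s * \<alpha> = e / 2" using e s by (auto simp: \<alpha>_def)
  have "ereal h \<le> ereal (h' - ln (1 + real K * exp (- s)) - s * \<alpha>)"
    using 1 \<alpha>(2) by (simp add: e_def field_simps)
  also have "\<dots> \<le> rate_distortion_at f \<mu> \<epsilon> \<alpha>" by (rule rate_distortion_at_ge[OF \<mu> \<epsilon> h'(2) s q])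
  also have "\<dots> \<le> rate_distortion f \<mu> \<epsilon>"
    unfolding rate_distortion_eq_SUP using \<alpha>(1) by (intro SUP_upper) simp
  finally show "ereal h \<le> rate_distortion f \<mu> \<epsilon>" .
qed

section \<open>Comparison of the growth rates\<close>

lemma lower_BK_nonneg: "0 \<le> lower_BK f \<mu> \<epsilon>"
  by (simp add: lower_BK_def)

lemma upper_BK_nonneg: "0 \<le> upper_BK f \<mu> \<epsilon>"
  by (simp add: upper_BK_def)

lemma bowen_mdim_at_nonneg:
  assumes "\<mu> \<in> borel_probs" "Y \<in> sets borel" "measure \<mu> Y = 1" "Y \<subseteq> Z"
  shows "0 \<le> bowen_mdim_at f Z \<epsilon>"
  using lower_BK_nonneg lower_BK_le_bowen_mdim_at[OF assms] by (rule order_trans)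

lemma log_growth_lower_BK_le_bowen_mdim:
  assumes "\<mu> \<in> borel_probs" "Y \<in> sets borel" "measure \<mu> Y = 1" "Y \<subseteq> Z"
  shows "log_growth (lower_BK f \<mu>) \<le> upper_bowen_mdim f Z"
  unfolding upper_bowen_mdim_def
  by (rule log_growth_mono_scale[where C = 2])
     (simp_all add: lower_BK_le_bowen_mdim_at[OF assms] bowen_mdim_at_nonneg[OF assms])

lemma log_growth_chain:
  assumes \<mu>: "\<mu> \<in> ergodic_probs f"
  shows "log_growth (lower_BK f \<mu>) \<le> upper_bowen_mdim f (generic_points f \<mu>)"
    and "upper_bowen_mdim f (generic_points f \<mu>) \<le> log_growth (PS_entropy f \<mu>)"
    and "log_growth (PS_entropy f \<mu>) \<le> log_growth (upper_katok f \<mu>)"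
    and "log_growth (upper_katok f \<mu>) \<le> log_growth (upper_BK f \<mu>)"
    and "log_growth (lower_BK f \<mu>) \<le> upper_rdim f \<mu>"
    and "upper_rdim f \<mu> \<le> log_growth (upper_katok f \<mu>)"
proof -
  note bp = ergodic_probsD(2)[OF \<mu>]
  obtain Y where Y: "Y \<in> sets borel" "measure \<mu> Y = 1" "Y \<subseteq> generic_points f \<mu>"
    using generic_points_core[OF \<mu>] .
  show "log_growth (lower_BK f \<mu>) \<le> upper_bowen_mdim f (generic_points f \<mu>)"
    by (rule log_growth_lower_BK_le_bowen_mdim[OF bp Y])
  have "0 \<le> bowen_mdim_at f (generic_points f \<mu>) \<epsilon>" for \<epsilon>
    by (rule bowen_mdim_at_nonneg[OF bp Y])
  \<comment> \<open>Nonnegativity of the Pfister-Sullivan entropy is inherited from the Bowen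
    quantity below it.\<close>
  then have "0 \<le> PS_entropy f \<mu> \<epsilon>" if "\<epsilon> > 0" for \<epsilon>
    using bowen_mdim_at_generic_le_PS_entropy[OF that, of \<mu>] by (rule order_trans)
  then show "upper_bowen_mdim f (generic_points f \<mu>) \<le> log_growth (PS_entropy f \<mu>)"
    unfolding upper_bowen_mdim_def
    by (intro log_growth_mono bowen_mdim_at_generic_le_PS_entropy)
  show "log_growth (PS_entropy f \<mu>) \<le> log_growth (upper_katok f \<mu>)"
    by (rule log_growth_mono_scale[where C = 2])
       (simp_all add: PS_entropy_le_upper_katok[OF bp] upper_katok_nonneg[OF bp])
  show "log_growth (upper_katok f \<mu>) \<le> log_growth (upper_BK f \<mu>)"
    by (rule log_growth_mono_scale[where C = 2])
       (simp_all add: upper_katok_le_upper_BK[OF \<mu>] upper_BK_nonneg)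
  show "log_growth (lower_BK f \<mu>) \<le> upper_rdim f \<mu>"
    unfolding upper_rdim_def
  proof (rule log_growth_mono_scale[where C = 8])
    fix \<epsilon> :: real assume \<epsilon>: "0 < \<epsilon>"
    show *: "lower_BK f \<mu> (8 * \<epsilon>) \<le> rate_distortion f \<mu> \<epsilon>" by (rule lower_BK_le_rate_distortion[OF \<mu> \<epsilon>])
    show "0 \<le> rate_distortion f \<mu> \<epsilon>" using lower_BK_nonneg * by (rule order_trans)
  qed simp
  show "upper_rdim f \<mu> \<le> log_growth (upper_katok f \<mu>)"
    unfolding upper_rdim_def
    by (rule log_growth_mono) (simp_all add: rate_distortion_le_upper_katok[OF bp] upper_katok_nonneg[OF bp])
qed

end

theorem theorem1p5:
  fixes f :: "'a::metric_space \<Rightarrow> 'a"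
  assumes "compact (UNIV :: 'a set)"
    and "continuous_on UNIV f"
  shows "(\<forall>\<mu>\<in>invariant_probs f. \<forall>Y\<in>sets borel. measure \<mu> Y = 1 \<longrightarrow>
            log_growth (lower_BK f \<mu>) \<le> upper_bowen_mdim f Y)
       \<and> (\<forall>\<mu>\<in>ergodic_probs f.
            log_growth (upper_BK f \<mu>) = log_growth (lower_BK f \<mu>) \<longrightarrow>
              upper_bowen_mdim f (generic_points f \<mu>) = log_growth (PS_entropy f \<mu>)
            \<and> log_growth (PS_entropy f \<mu>) = log_growth (upper_katok f \<mu>)
            \<and> log_growth (upper_katok f \<mu>) = log_growth (upper_BK f \<mu>)
            \<and> log_growth (upper_BK f \<mu>) = log_growth (lower_BK f \<mu>)
            \<and> log_growth (lower_BK f \<mu>) = upper_rdim f \<mu>)"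
proof -
  interpret compact_dynamics f by standard (fact assms)+
  show ?thesis
  proof (intro conjI ballI impI)
    fix \<mu> :: "'a measure" and Y :: "'a set"
    assume "\<mu> \<in> invariant_probs f" "Y \<in> sets borel" "measure \<mu> Y = 1"
    then show "log_growth (lower_BK f \<mu>) \<le> upper_bowen_mdim f Y"
      using log_growth_lower_BK_le_bowen_mdim invariant_probsD(1) by blast
  next
    fix \<mu> :: "'a measure"
    assume \<mu>: "\<mu> \<in> ergodic_probs f" and eq: "log_growth (upper_BK f \<mu>) = log_growth (lower_BK f \<mu>)"
    note chain = log_growth_chain[OF \<mu>] eq
    show "upper_bowen_mdim f (generic_points f \<mu>) = log_growth (PS_entropy f \<mu>)" using chain by order
    show "log_growth (PS_entropy f \<mu>) = log_growth (upper_katok f \<mu>)" using chain by order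
    show "log_growth (upper_katok f \<mu>) = log_growth (upper_BK f \<mu>)" using chain by order
    show "log_growth (upper_BK f \<mu>) = log_growth (lower_BK f \<mu>)" by (rule eq)
    show "log_growth (lower_BK f \<mu>) = upper_rdim f \<mu>" using chain by order
  qed
qed

end
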